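(* Assume (H). Let $Y_0=(Y_0^1,\dots,Y_0^d)$ with $Y_0^i$ i.i.d. $N(0,1)$, and let $\eta\sim\mu_0$ be independent of $Y_0$ with $\sup_\omega\|\eta(\omega)\|_q\le K<\infty$ for some $q\in[1,\infty]$. Then there is a unique solution $(Y_t)_{t\in[0,T)}$ of the ODE $$\frac{dY_t}{dt}=b^{\mu_0}_t(Y_t),\quad t\in[0,T),\qquad Y_t|_{t=0}=Y_0.$$ Moreover, for each $t\in[0,T)$ the law $\mu_t$ of $Y_t$ has density $\phi_t$, and: (i) for every $p\ge1$, $\mathcal W_{q,p}(\mu_t,\mu_0)\le\big[K+(\mathbb E\|Y_0\|_q^p)^{1/p}\big]\sigma_t$ for $t\in[0,T)$; (ii) for all $t\in[0,T)$ and $z\in\mathbb R^d$, $\|Y_t-\beta_tz\|_q\le\sigma_t\|Y_0\|_q+\beta_t\sup_\omega\|\eta(\omega)-z\|_q$; (iii) for every $M>0$ and $t\in[0,T)$, $$\mathbb P\Big(\|Y_t\|_\infty\ge\beta_t\sup_\omega\|\eta(\omega)\|_\infty+\sigma_tM\Big)\le1-\big(1-\mathrm{erfc}(M/\sqrt2)\big)^d,$$ where $\mathrm{erfc}(r):=\frac{2}{\sqrt\pi}\int_r^\infty e^{-x^2}dx$.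
   Context: Fix $d\in\mathbb N$ and $T\in(0,\infty]$. $\|x\|_q$ is the $\ell^q$-norm on $\mathbb R^d$, $q\in[1,\infty]$. Assumption (H): $\sigma:[0,T)\to(0,\infty)$ is continuous, strictly decreasing and differentiable with derivative $\sigma'_t$ bounded on $[0,t_0]$ for every $t_0<T$, $\sigma_0=1$, $\lim_{t\uparrow T}\sigma_t=0$; and $\beta_t:=1-\sigma_t$. For $\sigma>0$, $\rho_\sigma(x):=(2\pi\sigma^2)^{-d/2}e^{-\|x\|_2^2/(2\sigma^2)}$. $\Gamma_t(x,y):=\|x-\beta_ty\|_2^2/(2\sigma_t^2)$; $\phi_t(x):=\int\rho_{\sigma_t}(x-\beta_ty)\mu_0(dy)$; $\mathcal D^{\mu_0}_t(x):=\mathbb E[\eta e^{-\Gamma_t(x,\eta)}]/\mathbb E[e^{-\Gamma_t(x,\eta)}]$ with the expectation taken over $\eta\sim\mu_0$ only; $b^{\mu_0}_t(x):=\frac{\sigma'_t}{\sigma_t}(x-\mathcal D^{\mu_0}_t(x))$. $\sup_\omega$ denotes the supremum over the (essential) range of $\eta$. $\mathcal W_{q,p}(\nu,\mu):=\inf(\mathbb E\|\xi-\zeta\|_q^p)^{1/p}$ over all couplings $\mathrm{Law}(\xi)=\nu$, $\mathrm{Law}(\zeta)=\mu$. *)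

theory Defs
  imports "HOL-Probability.Probability"
begin

definition qnorm :: "ereal \<Rightarrow> real ^ 'd \<Rightarrow> real" where
  "qnorm q x = (if q = \<infinity> then Max (range (\<lambda>i. \<bar>x $ i\<bar>))
               else (\<Sum>i\<in>UNIV. \<bar>x $ i\<bar> powr real_of_ereal q) powr (1 / real_of_ereal q))"

definition Tint :: "ereal \<Rightarrow> real set" where
  "Tint T = {t. 0 \<le> t \<and> ereal t < T}"

definition assumption_H :: "ereal \<Rightarrow> (real \<Rightarrow> real) \<Rightarrow> (real \<Rightarrow> real) \<Rightarrow> bool" where
  "assumption_H T \<sigma> \<sigma>' \<longleftrightarrow>
     0 < T \<and>
     (\<forall>t\<in>Tint T. 0 < \<sigma> t) \<and>
     continuous_on (Tint T) \<sigma> \<and>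
     (\<forall>s\<in>Tint T. \<forall>t\<in>Tint T. s < t \<longrightarrow> \<sigma> t < \<sigma> s) \<and>
     (\<forall>t\<in>Tint T. (\<sigma> has_real_derivative \<sigma>' t) (at t within Tint T)) \<and>
     (\<forall>t0. 0 \<le> t0 \<and> ereal t0 < T \<longrightarrow> (\<exists>B. \<forall>t\<in>{0..t0}. \<bar>\<sigma>' t\<bar> \<le> B)) \<and>
     \<sigma> 0 = 1 \<and>
     (\<forall>\<epsilon>>0. \<exists>t0\<in>Tint T. \<forall>t\<in>Tint T. t0 \<le> t \<longrightarrow> \<bar>\<sigma> t\<bar> < \<epsilon>)"

definition beta :: "(real \<Rightarrow> real) \<Rightarrow> real \<Rightarrow> real" where
  "beta \<sigma> t = 1 - \<sigma> t"

definition rho :: "real \<Rightarrow> real ^ 'd \<Rightarrow> real" where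
  "rho s x = (2 * pi * s\<^sup>2) powr (- real CARD('d) / 2) * exp (- (norm x)\<^sup>2 / (2 * s\<^sup>2))"

definition Gamma_t :: "(real \<Rightarrow> real) \<Rightarrow> real \<Rightarrow> real ^ 'd \<Rightarrow> real ^ 'd \<Rightarrow> real" where
  "Gamma_t \<sigma> t x y = (norm (x - beta \<sigma> t *\<^sub>R y))\<^sup>2 / (2 * (\<sigma> t)\<^sup>2)"

definition phi :: "(real \<Rightarrow> real) \<Rightarrow> (real ^ 'd) measure \<Rightarrow> real \<Rightarrow> real ^ 'd \<Rightarrow> real" where
  "phi \<sigma> \<mu>0 t x = (\<integral>y. rho (\<sigma> t) (x - beta \<sigma> t *\<^sub>R y) \<partial>\<mu>0)"

definition Dmu :: "(real \<Rightarrow> real) \<Rightarrow> (real ^ 'd) measure \<Rightarrow> real \<Rightarrow> real ^ 'd \<Rightarrow> real ^ 'd" where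
  "Dmu \<sigma> \<mu>0 t x = inverse (\<integral>y. exp (- Gamma_t \<sigma> t x y) \<partial>\<mu>0)
                   *\<^sub>R (\<integral>y. exp (- Gamma_t \<sigma> t x y) *\<^sub>R y \<partial>\<mu>0)"

definition bmu :: "(real \<Rightarrow> real) \<Rightarrow> (real \<Rightarrow> real) \<Rightarrow> (real ^ 'd) measure \<Rightarrow> real \<Rightarrow> real ^ 'd \<Rightarrow> real ^ 'd" where
  "bmu \<sigma> \<sigma>' \<mu>0 t x = (\<sigma>' t / \<sigma> t) *\<^sub>R (x - Dmu \<sigma> \<mu>0 t x)"

definition couplings :: "'b::topological_space measure \<Rightarrow> 'b measure \<Rightarrow> ('b \<times> 'b) measure set" where
  "couplings \<nu> \<mu> = {\<pi>. prob_space \<pi> \<and> sets \<pi> = sets (borel \<Otimes>\<^sub>M borel) \<and>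
                        distr \<pi> borel fst = \<nu> \<and> distr \<pi> borel snd = \<mu>}"

definition Wqp :: "ereal \<Rightarrow> real \<Rightarrow> (real ^ 'd) measure \<Rightarrow> (real ^ 'd) measure \<Rightarrow> ereal" where
  "Wqp q p \<nu> \<mu> = (INF \<pi>\<in>couplings \<nu> \<mu>.
      (let I = (\<integral>\<^sup>+ z. ennreal (qnorm q (fst z - snd z) powr p) \<partial>\<pi>)
       in if I = \<infinity> then \<infinity> else ereal (enn2real I powr (1 / p))))"

definition erfc :: "real \<Rightarrow> real" where
  "erfc r = 2 / sqrt pi * (LINT x:{r..}|lborel. exp (- x\<^sup>2))"

end

theory Submission
  imports Defs
begin

text \<open>
  In the time \<open>r = 1 / \<sigma>\<^sub>t - 1\<close> and the variable \<open>W = Y / \<sigma>\<^sub>t\<close> the equation becomes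
  \<open>W' = F r W\<close>, where \<open>F r w\<close> is the mean of \<open>\<eta>\<close> under the weight \<open>exp (- \<bar>w - r \<eta>\<bar>\<^sup>2 / 2)\<close>, that is,
  the conditional expectation of \<open>\<eta>\<close> given \<open>Y\<^sub>0 + r \<eta> = w\<close>. The field \<open>F\<close> is bounded, and locally in
  \<open>r\<close> it is Lipschitz in \<open>w\<close> with a quadratic Taylor remainder, uniformly in \<open>w\<close>.

  To see that \<open>W\<^sub>r\<close> has the law of \<open>Y\<^sub>0 + r \<eta>\<close>, compare both with the Euler scheme of step \<open>h\<close>. For a test
  function \<open>G\<close> with Lipschitz derivative, replacing \<open>\<eta>\<close> by its conditional expectation in
  \<open>G (Y\<^sub>0 + (r + h) \<eta>)\<close> costs only \<open>O(h\<^sup>2)\<close>, since the first-order term vanishes by conditioning; the class of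
  test functions is preserved by an Euler step up to a factor \<open>1 + O(h)\<close>, so the total error after \<open>1 / h\<close>
  steps is \<open>O(h)\<close>. No differentiability of the flow in its initial value and no continuity equation is needed.

  The bounds (ii) follow because \<open>W' - z\<close> stays in the convex set where the norm is at most
  \<open>sup \<parallel>\<eta> - z\<parallel>\<close>; (i) uses the coupling \<open>(\<sigma> Y\<^sub>0 + \<beta> \<eta>, \<eta>)\<close>, and (iii) is (ii) at \<open>z = 0\<close>.
\<close>

section \<open>Ordinary differential equations and convexity\<close>

text \<open>Hypothesis (H) bounds \<sigma>' on compact intervals but does not make it continuous, so
  \<open>bmu\<close> may be irregular in time and Picard iteration cannot be run on it directly. The
  new time depends on \<sigma> alone; \<sigma>' enters only through the chain rule, which asks for a
  derivative at each point. For the same reason uniqueness rests on the mean value theorem and not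
  on an integrated equation. The new time lives on the half-line r \<ge> 0 whatever T is, so one
  global flow serves finite and infinite T alike. The uniformity in w has one source: a shift of w
  by k tilts the weight by exp(r (k . y)), up to a factor that cancels in the mean, and y is
  bounded. Hence all estimates of F hold with constants in R and r only, with no control on how
  small the weights become. R is a Euclidean bound on \<eta> derived from K; it enters the Lipschitz
  and error constants but none of the final bounds.\<close>

lemma integral_from_0_has_vector_derivative:
  fixes f :: "real \<Rightarrow> 'a::banach"
  assumes "continuous_on {0..} f" "0 \<le> t"
  shows "((\<lambda>r. integral {0..r} f) has_vector_derivative f t) (at t within {0..})"
proof -
  have "((\<lambda>r. integral {0..r} f) has_vector_derivative f t) (at t within {0..t+1})"
    by (rule integral_has_vector_derivative) (use assms in \<open>auto intro: continuous_on_subset\<close>)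
  moreover have "at t within {0..} = at t within {0..t+1}"
    by (rule at_within_nhd[of t "{..<t+1}"]) auto
  ultimately show ?thesis by simp
qed

text \<open>Banach's theorem applied to \<open>exp (-2 c r) (u r - w)\<close>: with this weight the Picard operator is a contraction on the whole half-line.\<close>

lemma picard_lindelof_global:
  fixes F :: "real \<Rightarrow> 'a::banach \<Rightarrow> 'a"
  assumes cont: "continuous_on UNIV (\<lambda>(t,x). F t x)"
    and lip: "\<And>t x y. norm (F t x - F t y) \<le> L * norm (x - y)"
    and bd: "\<And>t x. norm (F t x) \<le> B"
  shows "\<exists>u. u 0 = w \<and> (\<forall>t\<ge>0. (u has_vector_derivative F t (u t)) (at t within {0..}))"
proof -
  \<comment> \<open>The maximum with 1 makes the exponent of the weight positive and large enough
    for r \<le> 2cr, on which the bound of \<open>P\<close> relies.\<close>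
  define c where "c = max 1 L"
  have c: "c \<ge> 1" and lip': "norm (F t x - F t y) \<le> c * norm (x - y)" for t x y
    using lip[of t x y] by (auto simp: c_def intro: order_trans[OF _ mult_right_mono])
  have B: "B \<ge> 0" using bd[of 0 0] norm_ge_zero order_trans by blast
  have contF: "continuous_on S (\<lambda>s. F (f s) (g s))" if "continuous_on S f" "continuous_on S g"
    for S :: "real set" and f g
    using continuous_on_compose2[OF cont, of S "\<lambda>s. (f s, g s)"] that
    by (auto intro: continuous_on_Pair)
  \<comment> \<open>Why 2c: the integral of c exp(2cs) over [0,r] is at most exp(2cr)/2, which
    yields the contraction factor 1/2.\<close>
  define U where "U u s = w + exp (2*c * s) *\<^sub>R apply_bcontfun u s" for u :: "real \<Rightarrow>\<^sub>C 'a" and s :: real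
  have contU: "continuous_on S (U u)" for S u unfolding U_def by (intro continuous_intros) simp
  define I where "I u r = integral {0..r} (\<lambda>s. F s (U u s))" for u r
  have contFU: "continuous_on S (\<lambda>s. F s (U u s))" for S u
    by (intro contF contU continuous_intros)
  have I_deriv: "(I u has_vector_derivative F t (U u t)) (at t within {0..})" if "t \<ge> 0" for u t
    unfolding I_def by (rule integral_from_0_has_vector_derivative[OF contFU that])
  have I_cont: "continuous_on {0..} (I u)" for u
    using I_deriv by (auto simp: continuous_on_eq_continuous_within intro: has_vector_derivative_continuous)
  \<comment> \<open>Bounded continuous functions are total on the real line, so
    \<open>max 0 r\<close> extends the operator constantly to negative times.\<close>
  define P where "P u r = exp (-2*c*max 0 r) *\<^sub>R I u (max 0 r)" for u r
  have P_cont: "continuous_on UNIV (P u)" for u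
    unfolding P_def by (intro continuous_intros continuous_on_compose2[OF I_cont]) auto
  have P_bd: "norm (P u r) \<le> B" for u r
  proof -
    let ?r = "max 0 r"
    have "norm (I u ?r) \<le> B * (?r - 0)"
      unfolding I_def by (rule integral_bound) (auto intro: contFU bd)
    also have "\<dots> \<le> B * exp (2*c*?r)"
    proof (rule mult_left_mono[OF _ B])
      have "?r \<le> 2*c*?r" using c mult_right_mono[of 1 "2*c" "?r"] by simp
      also have "\<dots> \<le> exp (2*c*?r)" using exp_ge_add_one_self[of "2*c*?r"] by linarith
      finally show "?r - 0 \<le> exp (2*c*?r)" by simp
    qed
    finally have "exp (-2*c*?r) * norm (I u ?r) \<le> exp (-2*c*?r) * (B * exp (2*c*?r))"
      by (rule mult_left_mono) simp
    also have "\<dots> = B" by (simp add: exp_minus)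
    finally show ?thesis by (simp add: P_def)
  qed
  have P_bc: "P u \<in> bcontfun" for u by (rule bcontfun_normI[OF P_cont P_bd])
  have contract: "dist (Bcontfun (P u)) (Bcontfun (P v)) \<le> 1/2 * dist u v" for u v
  proof (rule dist_bound)
    fix r :: real
    let ?r = "max 0 r"
    have int: "(\<lambda>s. F s (U u s)) integrable_on {0..?r}" for u
      by (rule integrable_continuous_real[OF contFU])
    have E: "((\<lambda>s. c * exp (2*c * s) * dist u v) has_integral
            exp (2*c*?r)/2 * dist u v - exp (2*c*0)/2 * dist u v) {0..?r}"
      by (rule fundamental_theorem_of_calculus)
        (auto intro!: derivative_eq_intros simp: has_real_derivative_iff_has_vector_derivative[symmetric])
    have "norm (I u ?r - I v ?r) = norm (integral {0..?r} (\<lambda>s. F s (U u s) - F s (U v s)))"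
      unfolding I_def by (simp add: integral_diff int)
    also have "\<dots> \<le> integral {0..?r} (\<lambda>s. c * exp (2*c * s) * dist u v)"
    proof (rule integral_norm_bound_integral)
      show "(\<lambda>s. F s (U u s) - F s (U v s)) integrable_on {0..?r}" by (intro integrable_diff int)
      show "(\<lambda>s. c * exp (2*c * s) * dist u v) integrable_on {0..?r}" using E by blast
      fix s
      have "norm (F s (U u s) - F s (U v s)) \<le> c * norm (U u s - U v s)" by (rule lip')
      also have "norm (U u s - U v s) = exp (2*c * s) * dist (apply_bcontfun u s) (apply_bcontfun v s)"
        by (simp add: U_def dist_norm flip: scaleR_diff_right)
      also have "c * \<dots> \<le> c * (exp (2*c * s) * dist u v)"
        using c by (intro mult_left_mono dist_bounded) auto
      finally show "norm (F s (U u s) - F s (U v s)) \<le> c * exp (2*c * s) * dist u v" by simp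
    qed
    also have "\<dots> = exp (2*c*?r)/2 * dist u v - exp (2*c*0)/2 * dist u v"
      using E by (rule integral_unique)
    also have "\<dots> \<le> exp (2*c*?r)/2 * dist u v" by simp
    finally have "exp (-2*c*?r) * norm (I u ?r - I v ?r) \<le> exp (-2*c*?r) * (exp (2*c*?r)/2 * dist u v)"
      by (rule mult_left_mono) simp
    also have "\<dots> = 1/2 * dist u v" by (simp add: exp_minus)
    finally show "dist (apply_bcontfun (Bcontfun (P u)) r) (apply_bcontfun (Bcontfun (P v)) r) \<le> 1/2 * dist u v"
      by (simp add: Bcontfun_inverse P_bc P_def dist_norm flip: scaleR_diff_right)
  qed
  obtain u where u: "Bcontfun (P u) = u"
    using banach_fix_type[of "1/2" "\<lambda>u. Bcontfun (P u)"] contract by auto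
  then have up: "apply_bcontfun u r = P u r" for r
    by (metis Bcontfun_inverse P_bc)
  have fixp: "U u r = w + I u r" if "r \<ge> 0" for r
    using that by (simp add: U_def up P_def exp_minus)
  show ?thesis
  proof (intro exI conjI allI impI)
    show "U u 0 = w" by (simp add: fixp I_def)
    fix t :: real assume t: "0 \<le> t"
    have "((\<lambda>r. w + I u r) has_vector_derivative F t (U u t)) (at t within {0..})"
      using I_deriv[OF t] by (auto intro!: derivative_eq_intros)
    then show "(U u has_vector_derivative F t (U u t)) (at t within {0..})"
      by (rule has_vector_derivative_transform[rotated 2]) (use t fixp in auto)
  qed
qed

text \<open>The function exp(-2Cs) |e(s)|^2 starts at 0 and has nonpositive derivative. Using the
  mean value theorem instead of integration allows \<open>g\<close> to be discontinuous in time, as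
  it may be when it carries the factor \<sigma>'.\<close>

lemma gronwall_zero:
  fixes e :: "real \<Rightarrow> 'a::real_inner"
  assumes deriv: "\<And>s. s \<in> {0..b} \<Longrightarrow> (e has_vector_derivative g s) (at s within {0..b})"
    and bound: "\<And>s. s \<in> {0..b} \<Longrightarrow> norm (g s) \<le> C * norm (e s)"
    and "e 0 = 0" "0 \<le> b"
  shows "e b = 0"
proof (cases "b = 0")
  case False
  with \<open>0 \<le> b\<close> have "0 < b" by simp
  define h where "h s = exp (-2*C * s) * (e s \<bullet> e s)" for s
  have h: "(h has_derivative (\<lambda>x. x * (exp (-2*C * s) * (2 * (e s \<bullet> g s) - 2 * C * (e s \<bullet> e s))))) (at s within {0..b})"
    if "0 \<le> s" "s \<le> b" for s
    unfolding h_def using deriv[of s] that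
    by (auto intro!: derivative_eq_intros simp: has_vector_derivative_def algebra_simps inner_commute)
  obtain s where s: "s \<in> {0<..<b}"
    "h b - h 0 = (b - 0) * (exp (-2*C * s) * (2 * (e s \<bullet> g s) - 2 * C * (e s \<bullet> e s)))"
    using mvt_simple[OF \<open>0 < b\<close> h] by auto
  have "e s \<bullet> g s \<le> norm (e s) * norm (g s)" by (rule norm_cauchy_schwarz)
  also have "\<dots> \<le> norm (e s) * (C * norm (e s))"
    using s by (intro mult_left_mono bound) auto
  finally have "e s \<bullet> g s \<le> C * (e s \<bullet> e s)" by (simp add: dot_square_norm power2_eq_square mult_ac)
  then have "h b - h 0 \<le> 0" unfolding s(2) using \<open>0 < b\<close>
    by (intro mult_nonneg_nonpos) auto
  moreover have "h 0 = 0" using \<open>e 0 = 0\<close> by (simp add: h_def)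
  ultimately have "e b \<bullet> e b \<le> 0" unfolding h_def by (simp add: mult_le_0_iff)
  then show ?thesis by (metis inner_gt_zero_iff not_le)
qed (use assms in auto)

text \<open>A difference quotient outside \<open>S\<close> could be strictly separated from it; the
  scalar mean value theorem along the normal \<open>v\<close> then contradicts
  \<open>g s \<in> S\<close> at an intermediate time. With balls for \<open>S\<close> this gives the
  local error of the Euler scheme, with sublevel sets of \<open>qnorm\<close> the pathwise
  bounds.\<close>

lemma mvt_closed_convex:
  fixes u :: "real \<Rightarrow> 'a::euclidean_space"
  assumes "convex S" "closed S" "a < b"
    and deriv: "\<And>s. s \<in> {a..b} \<Longrightarrow> (u has_vector_derivative g s) (at s within {a..b})"
    and mem: "\<And>s. s \<in> {a..b} \<Longrightarrow> g s \<in> S"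
  shows "(u b - u a) /\<^sub>R (b - a) \<in> S"
proof (rule ccontr)
  assume "\<not> ?thesis"
  then obtain v c where vc: "v \<bullet> ((u b - u a) /\<^sub>R (b - a)) < c" "\<And>x. x \<in> S \<Longrightarrow> c < v \<bullet> x"
    using separating_hyperplane_closed_point[OF assms(1,2)] by blast
  have "((\<lambda>s. v \<bullet> u s) has_derivative (\<lambda>x. x * (v \<bullet> g s))) (at s within {a..b})" if "a \<le> s" "s \<le> b" for s
    using deriv[of s] that by (auto intro!: derivative_eq_intros simp: has_vector_derivative_def)
  then obtain s where s: "s \<in> {a<..<b}" "v \<bullet> u b - v \<bullet> u a = (b - a) * (v \<bullet> g s)"
    using mvt_simple[OF \<open>a < b\<close>, of "\<lambda>s. v \<bullet> u s" "\<lambda>s x. x * (v \<bullet> g s)"] by auto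
  then have "v \<bullet> ((u b - u a) /\<^sub>R (b - a)) = v \<bullet> g s"
    using \<open>a < b\<close> by (simp add: inner_diff_right)
  with vc mem[of s] s show False by fastforce
qed

text \<open>Separation again: if the mean were outside \<open>S\<close>, its product with the
  separating normal, times the total weight, would be both at least and less than \<open>c\<close>
  times the total weight.\<close>

lemma weighted_mean_in_closed_convex:
  fixes h :: "'b \<Rightarrow> 'a::euclidean_space"
  assumes "convex S" "closed S"
    and e: "integrable M e" "\<And>y. 0 \<le> e y" "0 < (\<integral>y. e y \<partial>M)"
    and h: "integrable M (\<lambda>y. e y *\<^sub>R h y)" and mem: "AE y in M. h y \<in> S"
  shows "(\<integral>y. e y *\<^sub>R h y \<partial>M) /\<^sub>R (\<integral>y. e y \<partial>M) \<in> S"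
proof (rule ccontr)
  let ?Z = "\<integral>y. e y \<partial>M"
  assume "\<not> ?thesis"
  then obtain v c where vc: "v \<bullet> ((\<integral>y. e y *\<^sub>R h y \<partial>M) /\<^sub>R ?Z) < c" "\<And>x. x \<in> S \<Longrightarrow> c < v \<bullet> x"
    using separating_hyperplane_closed_point[OF assms(1,2)] by blast
  have "c * ?Z = (\<integral>y. c * e y \<partial>M)" by simp
  also have "\<dots> \<le> (\<integral>y. v \<bullet> (e y *\<^sub>R h y) \<partial>M)"
  proof (rule integral_mono_AE)
    show "AE y in M. c * e y \<le> v \<bullet> e y *\<^sub>R h y"
      using mem by eventually_elim (metis e(2) inner_scaleR_right less_imp_le mult.commute mult_left_mono vc(2))
    show "integrable M (\<lambda>y. v \<bullet> e y *\<^sub>R h y)" by (rule integrable_inner_right) (rule h)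
  qed (use e in simp)
  also have "\<dots> = v \<bullet> (\<integral>y. e y *\<^sub>R h y \<partial>M)" using h by (rule integral_inner_right)
  also have "\<dots> = v \<bullet> ((\<integral>y. e y *\<^sub>R h y \<partial>M) /\<^sub>R ?Z) * ?Z" using e(3) by simp
  also have "\<dots> < c * ?Z" using vc(1) e(3) by (rule mult_strict_right_mono)
  finally show False by simp
qed

section \<open>The norms qnorm\<close>

text \<open>Convexity of x^p up to the boundary point 0: when one argument vanishes, the claim
  reduces to \<open>c powr p \<le> c\<close> for a weight c in [0,1].\<close>

lemma powr_convex_combination:
  fixes x y :: real
  assumes p: "1 \<le> p" and st: "0 \<le> s" "0 \<le> t" "s + t = 1" and xy: "0 \<le> x" "0 \<le> y"
  shows "(s * x + t * y) powr p \<le> s * x powr p + t * y powr p"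
proof -
  have *: "c powr p \<le> c" if "0 \<le> c" "c \<le> 1" for c :: real
    using powr_mono'[of 1 p c] that p by simp
  consider "x = 0" | "y = 0" | "x > 0" "y > 0" using xy by linarith
  then show ?thesis
  proof cases
    case 3
    then show ?thesis using powr_convex[OF p] st unfolding convex_on_def by simp
  qed (use st xy p *[of s] *[of t] in \<open>auto simp: powr_mult intro: mult_right_mono\<close>)
qed

lemma qnorm_infinity: "qnorm \<infinity> x = Max (range (\<lambda>i. \<bar>x $ i\<bar>))"
  by (simp add: qnorm_def)

lemma qnorm_ereal: "qnorm (ereal r) x = (\<Sum>i\<in>UNIV. \<bar>x $ i\<bar> powr r) powr (1 / r)"
  by (simp add: qnorm_def)

lemma one_le_ereal_cases:
  assumes "1 \<le> (q::ereal)"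
  obtains (infinity) "q = \<infinity>" | (real) r where "q = ereal r" "1 \<le> r"
  using assms by (cases q) auto

lemma component_le_qnorm:
  assumes "1 \<le> q"
  shows "\<bar>x $ i\<bar> \<le> qnorm q x"
  using assms
proof (cases rule: one_le_ereal_cases)
  case (real r)
  have "\<bar>x $ i\<bar> = (\<bar>x $ i\<bar> powr r) powr (1/r)" using real by (simp add: powr_powr)
  also have "\<dots> \<le> (\<Sum>i\<in>UNIV. \<bar>x $ i\<bar> powr r) powr (1/r)"
    using real by (intro powr_mono2 member_le_sum) auto
  finally show ?thesis by (simp add: real qnorm_ereal)
qed (simp add: qnorm_infinity)

lemma qnorm_nonneg: "1 \<le> q \<Longrightarrow> 0 \<le> qnorm q x"
  using component_le_qnorm[of q x] abs_ge_zero order_trans by blast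

lemma qnorm_eq_0_imp: "1 \<le> q \<Longrightarrow> qnorm q x = 0 \<Longrightarrow> x = 0"
  using component_le_qnorm[of q x] by (auto simp: vec_eq_iff)

lemma qnorm_scaleR:
  assumes "1 \<le> q"
  shows "qnorm q (c *\<^sub>R x) = \<bar>c\<bar> * qnorm q x"
  using assms
proof (cases rule: one_le_ereal_cases)
  case (real r)
  have "(\<Sum>i\<in>UNIV. \<bar>(c *\<^sub>R x) $ i\<bar> powr r) = \<bar>c\<bar> powr r * (\<Sum>i\<in>UNIV. \<bar>x $ i\<bar> powr r)"
    by (simp add: abs_mult powr_mult sum_distrib_left)
  then show ?thesis using real by (simp add: qnorm_ereal powr_mult powr_powr sum_nonneg)
next
  case infinity
  have "\<bar>c\<bar> * Max (range (\<lambda>i. \<bar>x $ i\<bar>)) = Max ((\<lambda>a. \<bar>c\<bar> * a) ` range (\<lambda>i. \<bar>x $ i\<bar>))"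
    by (rule mono_Max_commute) (auto intro!: monoI mult_left_mono)
  then show ?thesis by (simp add: infinity qnorm_infinity abs_mult image_image)
qed

lemma qnorm_zero: "1 \<le> q \<Longrightarrow> qnorm q 0 = 0"
  using qnorm_scaleR[of q 0 0] by simp

text \<open>Minkowski's inequality by normalisation: (x + y)/(a + b) is the convex combination of
  x/a and y/b with weights a/(a + b) and b/(a + b), and each normalised vector has r-th power sum 1.
  Vanishing norms are split off since they cannot be divided by.\<close>

lemma qnorm_triangle:
  assumes q: "1 \<le> q"
  shows "qnorm q (x + y) \<le> qnorm q x + qnorm q y"
  using q
proof (cases rule: one_le_ereal_cases)
  case (real r)
  define a b where "a = qnorm q x" and "b = qnorm q y"
  consider "a = 0" | "b = 0" | "a > 0" "b > 0"
    unfolding a_def b_def using qnorm_nonneg[OF q] less_eq_real_def by metis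
  then show ?thesis
  proof cases
    case 3
    have sum_eq: "(\<Sum>i\<in>UNIV. (\<bar>z $ i\<bar> / qnorm q z) powr r) = 1" if "qnorm q z > 0" for z :: "real^'d"
    proof -
      let ?s = "\<Sum>i\<in>UNIV. \<bar>z $ i\<bar> powr r"
      have "qnorm q z powr r = ?s"
        using real by (simp add: qnorm_ereal powr_powr sum_nonneg)
      moreover have "qnorm q z powr r > 0" using that by simp
      ultimately show ?thesis using that
        by (simp add: powr_divide flip: sum_divide_distrib)
    qed
    define s t where "s = a / (a + b)" and "t = b / (a + b)"
    have st: "s \<ge> 0" "t \<ge> 0" "s + t = 1" using 3 by (auto simp: s_def t_def simp flip: add_divide_distrib)
    have le: "(\<bar>(x + y) $ i\<bar> / (a + b)) powr r \<le> s * (\<bar>x $ i\<bar> / a) powr r + t * (\<bar>y $ i\<bar> / b) powr r" for i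
    proof -
      have "(\<bar>(x + y) $ i\<bar> / (a + b)) powr r \<le> (s * (\<bar>x $ i\<bar> / a) + t * (\<bar>y $ i\<bar> / b)) powr r"
        using 3 real by (intro powr_mono2) (auto simp: s_def t_def simp flip: add_divide_distrib intro!: divide_right_mono)
      also have "\<dots> \<le> s * (\<bar>x $ i\<bar> / a) powr r + t * (\<bar>y $ i\<bar> / b) powr r"
        using powr_convex_combination[OF real(2) st, of "\<bar>x $ i\<bar> / a" "\<bar>y $ i\<bar> / b"] 3
        by simp
      finally show ?thesis .
    qed
    have "(\<Sum>i\<in>UNIV. (\<bar>(x + y) $ i\<bar> / (a + b)) powr r)
        \<le> s * (\<Sum>i\<in>UNIV. (\<bar>x $ i\<bar> / a) powr r) + t * (\<Sum>i\<in>UNIV. (\<bar>y $ i\<bar> / b) powr r)"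
      by (simp add: sum_distrib_left flip: sum.distrib) (rule sum_mono[OF le[simplified]])
    also have "\<dots> = 1" using sum_eq[of x] sum_eq[of y] 3 st by (simp add: a_def b_def)
    finally have "(\<Sum>i\<in>UNIV. \<bar>(x + y) $ i\<bar> powr r) / (a + b) powr r \<le> 1"
      using 3 by (simp add: powr_divide flip: sum_divide_distrib)
    then have "(\<Sum>i\<in>UNIV. \<bar>(x + y) $ i\<bar> powr r) \<le> (a + b) powr r"
      using 3 by (simp add: divide_le_eq)
    then have "(\<Sum>i\<in>UNIV. \<bar>(x + y) $ i\<bar> powr r) powr (1/r) \<le> ((a + b) powr r) powr (1/r)"
      using real by (intro powr_mono2) (auto intro: sum_nonneg)
    then show ?thesis using 3 real by (simp add: powr_powr a_def b_def qnorm_ereal)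
  qed (use q in \<open>auto simp: a_def b_def qnorm_zero dest: qnorm_eq_0_imp\<close>)
next
  case infinity
  have "\<bar>x $ i + y $ i\<bar> \<le> Max (range (\<lambda>i. \<bar>x $ i\<bar>)) + Max (range (\<lambda>i. \<bar>y $ i\<bar>))" for i
    by (rule order_trans[OF abs_triangle_ineq]) (intro add_mono Max_ge; simp)
  then show ?thesis by (simp add: infinity qnorm_infinity)
qed

lemma convex_on_qnorm: "1 \<le> q \<Longrightarrow> convex_on UNIV (qnorm q)"
  unfolding convex_on_def
  by (auto intro!: order_trans[OF qnorm_triangle] simp: qnorm_scaleR)

text \<open>A finite convex function on a finite-dimensional space is continuous.\<close>

lemma continuous_on_qnorm: "1 \<le> q \<Longrightarrow> continuous_on S (qnorm q)"
  using convex_on_continuous[OF _ convex_on_qnorm] continuous_on_subset by blast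

lemma borel_measurable_qnorm: "1 \<le> q \<Longrightarrow> qnorm q \<in> borel_measurable borel"
  by (intro borel_measurable_continuous_onI continuous_on_qnorm)

lemma convex_qnorm_le: "1 \<le> q \<Longrightarrow> convex {x. qnorm q x \<le> k}"
  by (auto simp: convex_def qnorm_scaleR intro!: order_trans[OF qnorm_triangle] convex_bound_le)

lemma closed_qnorm_le: "1 \<le> q \<Longrightarrow> closed {x. qnorm q x \<le> k}"
  by (intro closed_Collect_le continuous_on_qnorm continuous_on_const)

text \<open>The crude factor d in place of d^(1/r) is uniform in q, the case of infinite q included.
  It only serves integrability and finiteness, never a sharp bound.\<close>

lemma qnorm_le_card_infinity:
  fixes x :: "real ^ 'd"
  assumes "1 \<le> q"
  shows "qnorm q x \<le> real CARD('d) * qnorm \<infinity> x"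
  using assms
proof (cases rule: one_le_ereal_cases)
  case (real r)
  let ?m = "qnorm \<infinity> x"
  have "(\<Sum>i\<in>UNIV. \<bar>x $ i\<bar> powr r) powr (1/r) \<le> (\<Sum>i\<in>(UNIV::'d set). ?m powr r) powr (1/r)"
    using real component_le_qnorm[of \<infinity> x] by (intro powr_mono2 sum_mono) (auto intro: sum_nonneg)
  also have "\<dots> = real CARD('d) powr (1/r) * ?m"
    using real qnorm_nonneg[of \<infinity> x] by (simp add: powr_mult powr_powr)
  also have "\<dots> \<le> real CARD('d) powr 1 * ?m"
    using real qnorm_nonneg[of \<infinity> x] by (intro mult_right_mono powr_mono) (auto simp: Suc_le_eq)
  finally show ?thesis by (simp add: real qnorm_ereal)
next
  case infinity
  then show ?thesis using qnorm_nonneg[of \<infinity> x] mult_right_mono[of 1 "real CARD('d)" "qnorm \<infinity> x"]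
    by (simp add: Suc_le_eq)
qed

lemma norm_le_card_qnorm:
  fixes x :: "real ^ 'd"
  assumes "1 \<le> q"
  shows "norm x \<le> real CARD('d) * qnorm q x"
proof -
  have "norm x \<le> (\<Sum>i\<in>UNIV. \<bar>x $ i\<bar>)" by (rule norm_le_l1_cart)
  also have "\<dots> \<le> (\<Sum>i\<in>(UNIV::'d set). qnorm q x)" by (intro sum_mono component_le_qnorm assms)
  finally show ?thesis by simp
qed

section \<open>The conditional expectation field\<close>

text \<open>The working form of a bounded Lipschitz derivative. One constant controls both the
  derivative and the Taylor remainder, so that composition with an Euler step costs a single factor.
  Second derivatives are not asked for: the test functions below are built from squared positive
  parts, whose second derivative jumps.\<close>

definition C11 :: "real \<Rightarrow> ('a::euclidean_space \<Rightarrow> real) \<Rightarrow> bool" where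
  "C11 c G \<longleftrightarrow> 0 \<le> c \<and> (\<exists>D. \<forall>x. linear (D x) \<and> (\<forall>k. \<bar>D x k\<bar> \<le> c * norm k) \<and>
     (\<forall>k. \<bar>G (x + k) - G x - D x k\<bar> \<le> c * (norm k)\<^sup>2))"

text \<open>Chain rule: the derivative of the composite is \<open>D (T x)\<close> applied to k + h A
  k. Its remainder is that of G at the true displacement \<open>k'\<close>, plus h times D applied
  to the remainder of F.\<close>

lemma C11_euler_step:
  assumes G: "C11 c G" and h: "0 \<le> h" "h \<le> 1" and L: "0 \<le> L"
    and lip: "\<And>x k. norm (F (x + k) - F x) \<le> L * norm k"
    and diff: "\<And>x. \<exists>A. linear A \<and> (\<forall>k. norm (A k) \<le> L * norm k) \<and>
                 (\<forall>k. norm (F (x + k) - F x - A k) \<le> L * (norm k)\<^sup>2)"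
  shows "C11 (c * (1 + h * (3 * L + L\<^sup>2))) (\<lambda>x. G (x + h *\<^sub>R F x))"
proof -
  obtain D where c: "0 \<le> c" and D: "\<And>x. linear (D x)" "\<And>x k. \<bar>D x k\<bar> \<le> c * norm k"
    "\<And>x k. \<bar>G (x + k) - G x - D x k\<bar> \<le> c * (norm k)\<^sup>2"
    using G unfolding C11_def by metis
  obtain A where A: "\<And>x. linear (A x)" "\<And>x k. norm (A x k) \<le> L * norm k"
    "\<And>x k. norm (F (x + k) - F x - A x k) \<le> L * (norm k)\<^sup>2"
    using diff by metis
  define T where "T x = x + h *\<^sub>R F x" for x
  have hL: "0 \<le> h * L" "0 \<le> h * L\<^sup>2" using h L by auto
  have *: "linear (\<lambda>k. D (T x) (k + h *\<^sub>R A x k))" for x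
    using linear_compose[OF linear_compose_add[OF linear_ident linear_compose_scale_right[OF A(1)[of x], of h]] D(1)[of "T x"]]
    by (simp add: o_def)
  have lin: "\<bar>D (T x) (k + h *\<^sub>R A x k)\<bar> \<le> c * (1 + h * (3 * L + L\<^sup>2)) * norm k" for x k
  proof -
    have "norm (k + h *\<^sub>R A x k) \<le> norm k + h * (L * norm k)"
      using h A(2)[of x k] by (intro norm_triangle_le) (simp add: mult_left_mono)
    also have "\<dots> \<le> (1 + h * (3 * L + L\<^sup>2)) * norm k"
      using mult_right_mono[OF hL(1), of "norm k"] mult_right_mono[OF hL(2), of "norm k"] by (simp add: algebra_simps)
    finally have "c * norm (k + h *\<^sub>R A x k) \<le> c * ((1 + h * (3 * L + L\<^sup>2)) * norm k)"
      using c by (rule mult_left_mono)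
    then show ?thesis using D(2)[of "T x" "k + h *\<^sub>R A x k"] by (simp add: mult.assoc)
  qed
  have rem: "\<bar>G (T (x + k)) - G (T x) - D (T x) (k + h *\<^sub>R A x k)\<bar> \<le> c * (1 + h * (3 * L + L\<^sup>2)) * (norm k)\<^sup>2" for x k
  proof -
    define k' where "k' = k + h *\<^sub>R (F (x + k) - F x)"
    define e where "e = F (x + k) - F x - A x k"
    have T: "T (x + k) = T x + k'" by (simp add: T_def k'_def algebra_simps)
    have k'e: "k' = (k + h *\<^sub>R A x k) + h *\<^sub>R e" by (simp add: k'_def e_def algebra_simps)
    have "norm k' \<le> norm k + h * (L * norm k)"
      unfolding k'_def using h lip[of x k] by (intro norm_triangle_le) (simp add: mult_left_mono)
    then have nk': "norm k' \<le> (1 + h * L) * norm k" by (simp add: algebra_simps)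
    \<comment> \<open>Here h \<le> 1 turns h^2 L^2 into h L^2. The further h L in \<open>sq\<close>
      pays for the remainder of F.\<close>
    have "(1 + h * L)\<^sup>2 = 1 + 2 * (h * L) + h * (h * L\<^sup>2)" by (simp add: power2_eq_square algebra_simps)
    also have "\<dots> \<le> 1 + 2 * (h * L) + 1 * (h * L\<^sup>2)" by (intro add_left_mono mult_right_mono h hL)
    finally have sq: "(1 + h * L)\<^sup>2 + h * L \<le> 1 + h * (3 * L + L\<^sup>2)" by (simp add: algebra_simps)
    have "D (T x) k' = D (T x) (k + h *\<^sub>R A x k) + h * D (T x) e"
      unfolding k'e by (simp add: linear_add[OF D(1)] linear_cmul[OF D(1)])
    then have "G (T (x + k)) - G (T x) - D (T x) (k + h *\<^sub>R A x k)
        = (G (T x + k') - G (T x) - D (T x) k') + h * D (T x) e"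
      by (simp add: T)
    also have "\<bar>\<dots>\<bar> \<le> c * (norm k')\<^sup>2 + h * (c * norm e)"
      using D(3)[of "T x" k'] mult_left_mono[OF D(2)[of "T x" e] h(1)] h(1)
      by (intro order_trans[OF abs_triangle_ineq] add_mono) (auto simp: abs_mult)
    also have "\<dots> \<le> c * ((1 + h * L) * norm k)\<^sup>2 + h * (c * (L * (norm k)\<^sup>2))"
      using nk' A(3)[of x k] c h L by (intro add_mono mult_left_mono power_mono) (auto simp: e_def)
    also have "\<dots> = c * ((1 + h * L)\<^sup>2 + h * L) * (norm k)\<^sup>2" unfolding power_mult_distrib by (simp add: algebra_simps)
    also have "\<dots> \<le> c * (1 + h * (3 * L + L\<^sup>2)) * (norm k)\<^sup>2"
      by (intro mult_right_mono mult_left_mono sq c) simp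
    finally show ?thesis .
  qed
  have "0 \<le> c * (1 + h * (3 * L + L\<^sup>2))" using c hL h L by (simp add: algebra_simps)
  then show ?thesis
    unfolding C11_def T_def[symmetric]
    by (intro conjI exI[of _ "\<lambda>x k. D (T x) (k + h *\<^sub>R A x k)"] allI * lin rem)
qed

section \<open>Taylor bounds for the exponential\<close>

lemma exp_minus_one_bound: "\<bar>exp a - 1\<bar> \<le> \<bar>a\<bar> * exp \<bar>a\<bar>" for a :: real
proof -
  obtain t where t: "\<bar>t\<bar> \<le> \<bar>a\<bar>" "exp a = (\<Sum>m<1. a ^ m / fact m) + exp t / fact 1 * a ^ 1"
    using Maclaurin_exp_le[of a 1] by blast
  then have "\<bar>exp a - 1\<bar> = exp t * \<bar>a\<bar>" by (simp add: abs_mult)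
  also have "\<dots> \<le> exp \<bar>a\<bar> * \<bar>a\<bar>" using t(1) by (intro mult_right_mono) auto
  finally show ?thesis by (simp add: mult.commute)
qed

lemma exp_minus_one_minus_bound: "\<bar>exp a - 1 - a\<bar> \<le> a\<^sup>2 / 2 * exp \<bar>a\<bar>" for a :: real
proof -
  obtain t where t: "\<bar>t\<bar> \<le> \<bar>a\<bar>" "exp a = (\<Sum>m<2. a ^ m / fact m) + exp t / fact 2 * a ^ 2"
    using Maclaurin_exp_le[of a 2] by blast
  then have "\<bar>exp a - 1 - a\<bar> = exp t * (a\<^sup>2 / 2)" by (simp add: abs_mult numeral_2_eq_2)
  also have "\<dots> \<le> exp \<bar>a\<bar> * (a\<^sup>2 / 2)" using t(1) by (intro mult_right_mono) auto
  finally show ?thesis by (simp add: mult.commute)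
qed

section \<open>Posterior means under a prior with bounded support\<close>

locale bounded_prior = prob_space \<mu> for \<mu> :: "'a::euclidean_space measure" +
  fixes R :: real
  assumes sets_prior [measurable_cong]: "sets \<mu> = sets borel"
    and prior_bound: "AE y in \<mu>. norm y \<le> R"
begin

lemma R_nonneg: "0 \<le> R"
proof -
  have "AE y in \<mu>. 0 \<le> R" using prior_bound by eventually_elim (use norm_ge_zero order_trans in blast)
  then show ?thesis by simp
qed

definition wt :: "real \<Rightarrow> 'a \<Rightarrow> 'a \<Rightarrow> real" where
  "wt r w y = exp (- (norm (w - r *\<^sub>R y))\<^sup>2 / 2)"

definition Z :: "real \<Rightarrow> 'a \<Rightarrow> real" where
  "Z r w = (\<integral>y. wt r w y \<partial>\<mu>)"

definition F :: "real \<Rightarrow> 'a \<Rightarrow> 'a" where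
  "F r w = (\<integral>y. wt r w y *\<^sub>R y \<partial>\<mu>) /\<^sub>R Z r w"

lemma wt_measurable [measurable]: "(\<lambda>(w, y). wt r w y) \<in> borel_measurable (borel \<Otimes>\<^sub>M borel)"
  unfolding wt_def by measurable

lemma wt_measurable' [measurable]: "wt r w \<in> borel_measurable \<mu>"
  unfolding wt_def by measurable

lemma wt_pos: "0 < wt r w y" and wt_le_1: "wt r w y \<le> 1"
  by (auto simp: wt_def)

lemma integrable_bounded:
  fixes f :: "'a \<Rightarrow> 'b::{banach,second_countable_topology}"
  assumes "f \<in> borel_measurable \<mu>" "AE y in \<mu>. norm (f y) \<le> B"
  shows "integrable \<mu> f"
  using integrable_const_bound[OF assms(2,1)] .

lemma integrable_wt_scaleR:
  fixes f :: "'a \<Rightarrow> 'b::{banach,second_countable_topology}"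
  assumes [measurable]: "f \<in> borel_measurable \<mu>" and "AE y in \<mu>. norm (f y) \<le> B"
  shows "integrable \<mu> (\<lambda>y. wt r w y *\<^sub>R f y)"
proof (rule integrable_bounded[where B=B])
  show "AE y in \<mu>. norm (wt r w y *\<^sub>R f y) \<le> B"
    using assms(2)
  proof eventually_elim
    fix y assume "norm (f y) \<le> B"
    then show "norm (wt r w y *\<^sub>R f y) \<le> B"
      using mult_left_le_one_le[of "norm (f y)" "wt r w y"] wt_pos[of r w y] wt_le_1[of r w y] by (simp add: less_imp_le)
  qed
qed measurable

lemma integrable_wt: "integrable \<mu> (wt r w)"
  using integrable_wt_scaleR[of "\<lambda>_. 1::real" 1 r w] by simp

lemma integrable_wt_y: "integrable \<mu> (\<lambda>y. wt r w y *\<^sub>R y)"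
  by (rule integrable_wt_scaleR[OF _ prior_bound]) measurable

lemma Z_pos: "0 < Z r w"
proof -
  have "AE y in \<mu>. exp (- (norm w + \<bar>r\<bar> * R)\<^sup>2 / 2) \<le> wt r w y"
    using prior_bound
  proof eventually_elim
    fix y :: 'a assume y: "norm y \<le> R"
    have "norm (w - r *\<^sub>R y) \<le> norm w + norm (r *\<^sub>R y)" by (rule norm_triangle_ineq4)
    also have "\<dots> \<le> norm w + \<bar>r\<bar> * R" using y by (simp add: mult_left_mono)
    finally show "exp (- (norm w + \<bar>r\<bar> * R)\<^sup>2 / 2) \<le> wt r w y" by (simp add: wt_def power_mono)
  qed
  then have "exp (- (norm w + \<bar>r\<bar> * R)\<^sup>2 / 2) \<le> Z r w"
    unfolding Z_def using integrable_wt by (intro integral_ge_const) auto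
  then show ?thesis using exp_gt_zero order_less_le_trans by blast
qed

lemma F_bound: "norm (F r w) \<le> R"
proof -
  have "F r w \<in> cball 0 R"
    unfolding F_def Z_def
    by (rule weighted_mean_in_closed_convex)
      (use prior_bound integrable_wt integrable_wt_y Z_pos wt_pos in \<open>auto simp: less_imp_le Z_def\<close>)
  then show ?thesis by simp
qed

text \<open>The vector \<open>m\<close> is kept free: for \<open>m = F r w\<close> the integral
  vanishes, and for \<open>m = z\<close> it compares the field with the point z of the pathwise
  bound.\<close>

lemma Z_scaleR_F_diff: "(\<integral>y. wt r w y *\<^sub>R (y - m) \<partial>\<mu>) = Z r w *\<^sub>R (F r w - m)"
proof -
  have "(\<integral>y. wt r w y *\<^sub>R (y - m) \<partial>\<mu>) = (\<integral>y. wt r w y *\<^sub>R y - wt r w y *\<^sub>R m \<partial>\<mu>)"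
    by (simp add: scaleR_diff_right)
  also have "\<dots> = (\<integral>y. wt r w y *\<^sub>R y \<partial>\<mu>) - Z r w *\<^sub>R m"
    unfolding Z_def
    by (subst Bochner_Integration.integral_diff)
      (auto intro: integrable_wt_y simp: Bochner_Integration.integral_scaleR_left integrable_wt)
  finally show ?thesis using Z_pos[of r w] by (simp add: F_def scaleR_diff_right)
qed

lemma F_centered: "(\<integral>y. wt r w y *\<^sub>R (y - F r w) \<partial>\<mu>) = 0"
  by (simp add: Z_scaleR_F_diff)

lemma continuous_integral_wt:
  fixes f :: "'a \<Rightarrow> 'b::{banach,second_countable_topology}"
  assumes [measurable]: "f \<in> borel_measurable \<mu>" and f: "AE y in \<mu>. norm (f y) \<le> B"
  shows "continuous_on UNIV (\<lambda>(r, w). \<integral>y. wt r w y *\<^sub>R f y \<partial>\<mu>)"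
  unfolding continuous_on_sequentially
proof (intro allI ballI impI)
  fix x :: "nat \<Rightarrow> real \<times> 'a" and a
  assume "(\<forall>n. x n \<in> UNIV) \<and> x \<longlonglongrightarrow> a"
  then have x: "x \<longlonglongrightarrow> a" by simp
  have lim: "(\<lambda>n. wt (fst (x n)) (snd (x n)) y *\<^sub>R f y) \<longlonglongrightarrow> wt (fst a) (snd a) y *\<^sub>R f y" for y
    unfolding wt_def by (intro tendsto_intros x) simp
  have "(\<lambda>n. \<integral>y. wt (fst (x n)) (snd (x n)) y *\<^sub>R f y \<partial>\<mu>) \<longlonglongrightarrow> (\<integral>y. wt (fst a) (snd a) y *\<^sub>R f y \<partial>\<mu>)"
  proof (rule integral_dominated_convergence[where w="\<lambda>_. B"])
    fix n
    show "AE y in \<mu>. norm (wt (fst (x n)) (snd (x n)) y *\<^sub>R f y) \<le> B"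
      using f
    proof eventually_elim
      fix y assume "norm (f y) \<le> B"
      then show "norm (wt (fst (x n)) (snd (x n)) y *\<^sub>R f y) \<le> B"
        using mult_left_le_one_le[of "norm (f y)" "wt (fst (x n)) (snd (x n)) y"]
          wt_pos[of "fst (x n)" "snd (x n)" y] wt_le_1[of "fst (x n)" "snd (x n)" y] by (simp add: less_imp_le)
    qed
  qed (use lim in auto)
  then show "((\<lambda>(r, w). \<integral>y. wt r w y *\<^sub>R f y \<partial>\<mu>) \<circ> x) \<longlonglongrightarrow> (case a of (r, w) \<Rightarrow> \<integral>y. wt r w y *\<^sub>R f y \<partial>\<mu>)"
    by (simp add: o_def case_prod_beta)
qed

lemma F_continuous: "continuous_on UNIV (\<lambda>(r, w). F r w)"
proof -
  have "continuous_on UNIV (\<lambda>p. (case p of (r, w) \<Rightarrow> \<integral>y. wt r w y *\<^sub>R y \<partial>\<mu>) /\<^sub>R (case p of (r, w) \<Rightarrow> \<integral>y. wt r w y *\<^sub>R 1 \<partial>\<mu>))"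
    using Z_pos
    by (intro continuous_intros continuous_integral_wt[OF _ prior_bound] continuous_integral_wt[where B=1])
      (auto simp: Z_def less_le)
  then show ?thesis by (simp add: F_def Z_def case_prod_beta)
qed

lemma F_measurable [measurable]: "F r \<in> borel_measurable borel"
proof (rule borel_measurable_continuous_onI)
  have "continuous_on UNIV (\<lambda>w. (r, w))"
    by (intro continuous_on_Pair continuous_on_const continuous_on_id)
  from continuous_on_compose2[OF F_continuous this] show "continuous_on UNIV (F r)" by simp
qed

text \<open>The bound is relative to \<open>Z r w\<close>, so dividing by the normaliser leaves a
  constant independent of \<open>w\<close>. The norm estimate is applied with \<open>s\<close> equal
  to a, exp a - 1 and exp a - 1 - a for the tilt exponent a.\<close>

lemma
  assumes [measurable]: "s \<in> borel_measurable \<mu>" and s: "AE y in \<mu>. \<bar>s y\<bar> \<le> A"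
  shows integrable_weighted_deviation: "integrable \<mu> (\<lambda>y. wt r w y *\<^sub>R s y *\<^sub>R (y - F r w))" (is ?int)
    and weighted_deviation_bound:
      "norm (\<integral>y. wt r w y *\<^sub>R s y *\<^sub>R (y - F r w) \<partial>\<mu>) \<le> A * (2 * R) * Z r w" (is ?bound)
proof -
  have le: "AE y in \<mu>. norm (s y *\<^sub>R (y - F r w)) \<le> A * (2 * R)"
    using s prior_bound
  proof eventually_elim
    fix y assume "\<bar>s y\<bar> \<le> A" "norm y \<le> R"
    moreover have "norm (y - F r w) \<le> 2 * R"
      using norm_triangle_ineq4[of y "F r w"] \<open>norm y \<le> R\<close> F_bound[of r w] by simp
    ultimately show "norm (s y *\<^sub>R (y - F r w)) \<le> A * (2 * R)"
      unfolding norm_scaleR by (intro mult_mono) auto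
  qed
  show int: ?int
    by (rule integrable_wt_scaleR[OF _ le]) measurable
  have "norm (\<integral>y. wt r w y *\<^sub>R s y *\<^sub>R (y - F r w) \<partial>\<mu>) \<le> (\<integral>y. norm (wt r w y *\<^sub>R s y *\<^sub>R (y - F r w)) \<partial>\<mu>)"
    by (rule integral_norm_bound)
  also have "\<dots> \<le> (\<integral>y. A * (2 * R) * wt r w y \<partial>\<mu>)"
  proof (rule integral_mono_AE)
    show "AE y in \<mu>. norm (wt r w y *\<^sub>R s y *\<^sub>R (y - F r w)) \<le> A * (2 * R) * wt r w y"
      using le
    proof eventually_elim
      fix y assume "norm (s y *\<^sub>R (y - F r w)) \<le> A * (2 * R)"
      from mult_left_mono[OF this, of "wt r w y"] wt_pos[of r w y]
      show "norm (wt r w y *\<^sub>R s y *\<^sub>R (y - F r w)) \<le> A * (2 * R) * wt r w y"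
        by (simp add: abs_mult mult_ac)
    qed
    show "integrable \<mu> (\<lambda>y. norm (wt r w y *\<^sub>R s y *\<^sub>R (y - F r w)))"
      by (rule integrable_norm) fact
  qed (use integrable_wt in auto)
  finally show ?bound by (simp add: Z_def)
qed

text \<open>Expanding the square shows that a shift of \<open>w\<close> by \<open>k\<close>
  multiplies the weight by exp(r (k . y)) and by a factor free of y. The latter cancels in the
  quotient, so the mean at w + k is an exponentially tilted mean at w. Since |y| \<le> R almost
  surely, the exponent is at most \<alpha> in modulus, uniformly in w.\<close>

lemma F_translate:
  fixes r :: real and w k :: 'a
  defines "a \<equiv> \<lambda>y. r * (k \<bullet> y)" and "\<alpha> \<equiv> \<bar>r\<bar> * norm k * R"
  defines "Zk \<equiv> \<integral>y. wt r w y * exp (a y) \<partial>\<mu>"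
  shows "Zk *\<^sub>R (F r (w + k) - m) = (\<integral>y. wt r w y *\<^sub>R exp (a y) *\<^sub>R (y - m) \<partial>\<mu>)" (is ?eq)
    and "AE y in \<mu>. \<bar>a y\<bar> \<le> \<alpha>" (is ?bd)
    and "exp (- \<alpha>) * Z r w \<le> Zk" (is ?lo)
    and "\<bar>Zk - Z r w\<bar> \<le> \<alpha> * exp \<alpha> * Z r w" (is ?diff)
proof -
  define \<kappa> where "\<kappa> = exp (- (w \<bullet> k) - (norm k)\<^sup>2 / 2)"
  have a_meas [measurable]: "a \<in> borel_measurable \<mu>" unfolding a_def by measurable
  show bd: ?bd
    using prior_bound
  proof eventually_elim
    fix y :: 'a assume y: "norm y \<le> R"
    have "\<bar>k \<bullet> y\<bar> \<le> norm k * norm y" by (rule Cauchy_Schwarz_ineq2)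
    also have "\<dots> \<le> norm k * R" using y by (rule mult_left_mono) simp
    finally show "\<bar>a y\<bar> \<le> \<alpha>" by (simp add: a_def \<alpha>_def abs_mult mult_left_mono mult.assoc)
  qed
  have int: "integrable \<mu> (\<lambda>y. wt r w y * exp (a y))"
  proof -
    have "AE y in \<mu>. norm (exp (a y)) \<le> exp \<alpha>" using bd by eventually_elim auto
    from integrable_wt_scaleR[OF _ this, of r w] show ?thesis by simp
  qed
  have wt: "wt r (w + k) y = \<kappa> * (wt r w y * exp (a y))" for y
  proof -
    have "(norm (w + k - r *\<^sub>R y))\<^sup>2 = (norm (w - r *\<^sub>R y))\<^sup>2 + 2 * (w \<bullet> k) + (norm k)\<^sup>2 - 2 * a y"
      unfolding a_def power2_norm_eq_inner by (simp add: inner_simps inner_commute algebra_simps)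
    then show ?thesis unfolding wt_def \<kappa>_def exp_add[symmetric]
      by (simp add: exp_add[symmetric] field_simps)
  qed
  have "\<kappa> > 0" by (simp add: \<kappa>_def)
  have "\<kappa> *\<^sub>R Zk *\<^sub>R (F r (w + k) - m) = Z r (w + k) *\<^sub>R (F r (w + k) - m)"
    by (simp add: Z_def Zk_def wt)
  also have "\<dots> = \<kappa> *\<^sub>R (\<integral>y. wt r w y *\<^sub>R exp (a y) *\<^sub>R (y - m) \<partial>\<mu>)"
    unfolding Z_scaleR_F_diff[symmetric] wt
    by (simp flip: scaleR_scaleR add: Bochner_Integration.integral_scaleR_right)
  finally show ?eq using \<open>\<kappa> > 0\<close> by (metis less_irrefl scaleR_left_imp_eq)
  have "(\<integral>y. exp (- \<alpha>) * wt r w y \<partial>\<mu>) \<le> Zk"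
    unfolding Zk_def
  proof (rule integral_mono_AE)
    show "AE y in \<mu>. exp (- \<alpha>) * wt r w y \<le> wt r w y * exp (a y)"
      using bd by eventually_elim (auto simp: mult.commute wt_pos less_imp_le)
  qed (use integrable_wt int in auto)
  then show ?lo by (simp add: Z_def)
  have "\<bar>Zk - Z r w\<bar> = norm (\<integral>y. wt r w y * exp (a y) - wt r w y \<partial>\<mu>)"
    unfolding Zk_def Z_def by (subst Bochner_Integration.integral_diff) (auto intro: int integrable_wt)
  also have "\<dots> \<le> (\<integral>y. norm (wt r w y * exp (a y) - wt r w y) \<partial>\<mu>)"
    by (rule integral_norm_bound)
  also have "\<dots> \<le> (\<integral>y. \<alpha> * exp \<alpha> * wt r w y \<partial>\<mu>)"
  proof (rule integral_mono_AE)
    show "AE y in \<mu>. norm (wt r w y * exp (a y) - wt r w y) \<le> \<alpha> * exp \<alpha> * wt r w y"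
      using bd
    proof eventually_elim
      fix y assume y: "\<bar>a y\<bar> \<le> \<alpha>"
      have "norm (wt r w y * exp (a y) - wt r w y) = wt r w y * \<bar>exp (a y) - 1\<bar>"
        using wt_pos[of r w y] abs_mult[of "wt r w y" "exp (a y) - 1"] by (simp add: right_diff_distrib)
      also have "\<dots> \<le> wt r w y * (\<alpha> * exp \<alpha>)"
        using y wt_pos[of r w y]
        by (intro mult_left_mono) (auto intro!: order_trans[OF exp_minus_one_bound] mult_mono)
      finally show "norm (wt r w y * exp (a y) - wt r w y) \<le> \<alpha> * exp \<alpha> * wt r w y" by (simp add: mult_ac)
    qed
  qed (use integrable_wt int in auto)
  finally show ?diff by (simp add: Z_def)
qed

lemma exp_two_le_8: "exp (2 * 1) \<le> (8::real)"
proof -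
  have "exp (1::real) * exp 1 \<le> 2.72 * 2.72" using e_less_272 by (intro mult_mono) auto
  then show ?thesis unfolding exp_double by (simp add: power2_eq_square)
qed

text \<open>Subtracting the centred integral at \<open>w\<close> turns the tilt exp a into exp a -
  1, and removing the linear term leaves exp a - 1 - a. That linear term is r times the posterior
  covariance applied to k, the derivative of \<open>F r\<close>. When \<alpha> > 1 the exponential
  bounds are too large, but then F being bounded by R is enough.\<close>

lemma F_taylor:
  shows F_lipschitz: "norm (F r (w + k) - F r w) \<le> 16 * R\<^sup>2 * \<bar>r\<bar> * norm k"
    and F_differential_bound:
      "norm ((\<integral>y. wt r w y *\<^sub>R (r * (k \<bullet> y)) *\<^sub>R (y - F r w) \<partial>\<mu>) /\<^sub>R Z r w) \<le> 2 * R\<^sup>2 * \<bar>r\<bar> * norm k"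
    and F_remainder_bound:
      "norm (F r (w + k) - F r w - (\<integral>y. wt r w y *\<^sub>R (r * (k \<bullet> y)) *\<^sub>R (y - F r w) \<partial>\<mu>) /\<^sub>R Z r w)
        \<le> 24 * R ^ 3 * r\<^sup>2 * (norm k)\<^sup>2"
proof -
  define a where "a = (\<lambda>y. r * (k \<bullet> y))"
  define \<alpha> where "\<alpha> = \<bar>r\<bar> * norm k * R"
  define Zk where "Zk = (\<integral>y. wt r w y * exp (a y) \<partial>\<mu>)"
  have T1: "Zk *\<^sub>R (F r (w + k) - m) = (\<integral>y. wt r w y *\<^sub>R exp (a y) *\<^sub>R (y - m) \<partial>\<mu>)" for m
    unfolding Zk_def a_def by (rule F_translate)
  have T2: "AE y in \<mu>. \<bar>a y\<bar> \<le> \<alpha>"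
    unfolding \<alpha>_def a_def by (rule F_translate)
  have T3: "exp (- \<alpha>) * Z r w \<le> Zk"
    unfolding Zk_def \<alpha>_def a_def by (rule F_translate)
  have T4: "\<bar>Zk - Z r w\<bar> \<le> \<alpha> * exp \<alpha> * Z r w"
    unfolding Zk_def \<alpha>_def a_def by (rule F_translate)
  have Zk: "0 \<le> Zk" by (rule order_trans[OF _ T3]) (simp add: Z_pos less_imp_le)
  define \<Delta> where "\<Delta> = F r (w + k) - F r w"
  define A where "A = (\<integral>y. wt r w y *\<^sub>R a y *\<^sub>R (y - F r w) \<partial>\<mu>) /\<^sub>R Z r w"
  have \<alpha>: "0 \<le> \<alpha>" using R_nonneg by (simp add: \<alpha>_def)
  have a_meas [measurable]: "a \<in> borel_measurable \<mu>" unfolding a_def by measurable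
  have exp_bd: "AE y in \<mu>. \<bar>exp (a y)\<bar> \<le> exp \<alpha>"
    using T2 by eventually_elim auto
  have int_exp: "integrable \<mu> (\<lambda>y. wt r w y *\<^sub>R exp (a y) *\<^sub>R (y - F r w))"
    by (rule integrable_weighted_deviation[OF _ exp_bd]) measurable
  have int_1: "integrable \<mu> (\<lambda>y. wt r w y *\<^sub>R (y - F r w))"
    using integrable_weighted_deviation[of "\<lambda>_. 1" 1 r w] by simp
  have int_a: "integrable \<mu> (\<lambda>y. wt r w y *\<^sub>R a y *\<^sub>R (y - F r w))"
    by (rule integrable_weighted_deviation[OF _ T2]) measurable
  have collect1: "p *\<^sub>R e *\<^sub>R v - p *\<^sub>R v = p *\<^sub>R (e - 1) *\<^sub>R v"
    and collect2: "p *\<^sub>R e *\<^sub>R v - p *\<^sub>R f *\<^sub>R v = p *\<^sub>R (e - f) *\<^sub>R v" for p e f and v :: 'a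
    by (simp_all add: scaleR_diff_left scaleR_diff_right)
  have \<Delta>_bd: "norm \<Delta> \<le> 2 * R"
    using norm_triangle_ineq4[of "F r (w + k)" "F r w"] F_bound[of r w] F_bound[of r "w + k"] by (simp add: \<Delta>_def)
  have A_bd: "norm A \<le> 2 * R * \<alpha>"
  proof -
    have "norm A = norm (\<integral>y. wt r w y *\<^sub>R a y *\<^sub>R (y - F r w) \<partial>\<mu>) / Z r w"
      using Z_pos[of r w] by (simp add: A_def divide_inverse mult.commute)
    also have "\<dots> \<le> 2 * R * \<alpha>"
      using weighted_deviation_bound[OF a_meas T2, of r w] Z_pos[of r w]
      by (simp add: pos_divide_le_eq mult_ac)
    finally show ?thesis .
  qed
  \<comment> \<open>Dividing by \<open>Zk\<close> costs exp \<alpha>, as \<open>Zk\<close> is at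
    least exp(-\<alpha>) times \<open>Z r w\<close>. Together with the exp \<alpha> of the Taylor
    bound this gives exp(2\<alpha>) \<le> 8. Hence 16 = 8 * 2, and for the remainder 24 = 8 *
    3.\<close>
  have cancel: "norm v \<le> 8 * C" if v: "Zk * norm v \<le> C * exp \<alpha> * Z r w" and "0 \<le> C" "\<alpha> \<le> 1" for v :: 'a and C
  proof -
    have "exp (- \<alpha>) * Z r w * norm v \<le> Zk * norm v" using T3 by (rule mult_right_mono) simp
    with v have "(exp (- \<alpha>) * norm v) * Z r w \<le> (C * exp \<alpha>) * Z r w" by (simp add: mult_ac)
    then have "exp (- \<alpha>) * norm v \<le> C * exp \<alpha>" using Z_pos[of r w] by (rule mult_right_le_imp_le)
    then have "exp \<alpha> * (exp (- \<alpha>) * norm v) \<le> exp \<alpha> * (C * exp \<alpha>)" by (rule mult_left_mono) simp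
    also have "exp \<alpha> * (exp (- \<alpha>) * norm v) = norm v" by (simp add: exp_minus)
    also have "exp \<alpha> * (C * exp \<alpha>) = C * exp (2 * \<alpha>)" by (subst exp_double) (simp add: power2_eq_square)
    finally have "norm v \<le> C * exp (2 * \<alpha>)" .
    also have "\<dots> \<le> C * exp (2 * 1)" using \<open>\<alpha> \<le> 1\<close> \<open>0 \<le> C\<close> by (intro mult_left_mono) auto
    also have "\<dots> \<le> C * 8" using exp_two_le_8 \<open>0 \<le> C\<close> by (rule mult_left_mono)
    finally show ?thesis by simp
  qed
  have "norm \<Delta> \<le> 16 * R * \<alpha>"
  proof (cases "\<alpha> \<le> 1")
    case True
    have bd: "AE y in \<mu>. \<bar>exp (a y) - 1\<bar> \<le> \<alpha> * exp \<alpha>"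
      using T2 by eventually_elim (auto intro!: order_trans[OF exp_minus_one_bound] mult_mono \<alpha>)
    have "Zk *\<^sub>R \<Delta> = (\<integral>y. wt r w y *\<^sub>R exp (a y) *\<^sub>R (y - F r w) \<partial>\<mu>) - (\<integral>y. wt r w y *\<^sub>R (y - F r w) \<partial>\<mu>)"
      unfolding \<Delta>_def T1 F_centered by simp
    also have "\<dots> = (\<integral>y. wt r w y *\<^sub>R (exp (a y) - 1) *\<^sub>R (y - F r w) \<partial>\<mu>)"
      unfolding Bochner_Integration.integral_diff[OF int_exp int_1, symmetric]
      by (simp only: collect1)
    finally have "norm (Zk *\<^sub>R \<Delta>) \<le> \<alpha> * exp \<alpha> * (2 * R) * Z r w"
      using weighted_deviation_bound[OF _ bd] by simp
    then have "Zk * norm \<Delta> \<le> (2 * R * \<alpha>) * exp \<alpha> * Z r w" using Zk by (simp add: mult_ac)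
    from cancel[OF this _ True] show ?thesis using R_nonneg \<alpha> by simp
  next
    case False
    note \<Delta>_bd
    also have "2 * R \<le> 2 * R * \<alpha>" using False R_nonneg mult_left_mono[of 1 \<alpha> "2 * R"] by simp
    also have "\<dots> \<le> 16 * R * \<alpha>" using R_nonneg \<alpha> by (intro mult_right_mono) auto
    finally show ?thesis .
  qed
  then show "norm (F r (w + k) - F r w) \<le> 16 * R\<^sup>2 * \<bar>r\<bar> * norm k"
    by (simp add: \<Delta>_def \<alpha>_def power2_eq_square mult_ac)
  show "norm ((\<integral>y. wt r w y *\<^sub>R (r * (k \<bullet> y)) *\<^sub>R (y - F r w) \<partial>\<mu>) /\<^sub>R Z r w) \<le> 2 * R\<^sup>2 * \<bar>r\<bar> * norm k"
    using A_bd by (simp add: A_def a_def \<alpha>_def power2_eq_square mult_ac)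
  have "norm (\<Delta> - A) \<le> 24 * R * \<alpha>\<^sup>2"
  proof (cases "\<alpha> \<le> 1")
    case True
    have bd: "AE y in \<mu>. \<bar>exp (a y) - 1 - a y\<bar> \<le> \<alpha>\<^sup>2 / 2 * exp \<alpha>"
      using T2
    proof eventually_elim
      fix y assume "\<bar>a y\<bar> \<le> \<alpha>"
      then have "(a y)\<^sup>2 / 2 * exp \<bar>a y\<bar> \<le> \<alpha>\<^sup>2 / 2 * exp \<alpha>"
        using power_mono[of "\<bar>a y\<bar>" \<alpha> 2] by (intro mult_mono) auto
      then show "\<bar>exp (a y) - 1 - a y\<bar> \<le> \<alpha>\<^sup>2 / 2 * exp \<alpha>"
        using exp_minus_one_minus_bound[of "a y"] by linarith
    qed
    define V where "V = (\<integral>y. wt r w y *\<^sub>R (exp (a y) - 1 - a y) *\<^sub>R (y - F r w) \<partial>\<mu>)"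
    have ZA: "Z r w *\<^sub>R A = (\<integral>y. wt r w y *\<^sub>R a y *\<^sub>R (y - F r w) \<partial>\<mu>)"
      using Z_pos[of r w] by (simp add: A_def)
    have "Zk *\<^sub>R \<Delta> = (\<integral>y. wt r w y *\<^sub>R exp (a y) *\<^sub>R (y - F r w) \<partial>\<mu>) - (\<integral>y. wt r w y *\<^sub>R (y - F r w) \<partial>\<mu>)"
      unfolding \<Delta>_def T1 F_centered by simp
    also have "\<dots> - Z r w *\<^sub>R A = V"
      unfolding ZA V_def Bochner_Integration.integral_diff[OF int_exp int_1, symmetric]
        Bochner_Integration.integral_diff[OF Bochner_Integration.integrable_diff[OF int_exp int_1] int_a, symmetric]
      by (simp only: collect1 collect2)
    \<comment> \<open>The normaliser moves as well: exchanging \<open>Zk\<close> and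
      \<open>Z r w\<close> in front of A costs 2 R \<alpha>^2, in addition to R \<alpha>^2 from the
      second-order remainder, both up to exp \<alpha> times \<open>Z r w\<close>. This is the 3
      below.\<close>
    finally have "Zk *\<^sub>R (\<Delta> - A) = V + (Z r w - Zk) *\<^sub>R A" by (simp add: algebra_simps)
    also have "norm \<dots> \<le> \<alpha>\<^sup>2 / 2 * exp \<alpha> * (2 * R) * Z r w + (\<alpha> * exp \<alpha> * Z r w) * (2 * R * \<alpha>)"
      using weighted_deviation_bound[OF _ bd, of r w] T4 A_bd \<alpha> Z_pos[of r w]
      by (intro norm_triangle_le add_mono) (auto simp: V_def abs_minus_commute intro!: mult_mono)
    finally have "norm (Zk *\<^sub>R (\<Delta> - A)) \<le> (3 * R * \<alpha>\<^sup>2) * exp \<alpha> * Z r w"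
      by (simp add: power2_eq_square mult_ac)
    then have "Zk * norm (\<Delta> - A) \<le> (3 * R * \<alpha>\<^sup>2) * exp \<alpha> * Z r w" using Zk by simp
    from cancel[OF this _ True] show ?thesis using R_nonneg \<alpha> by simp
  next
    case False
    then have ge: "1 \<le> \<alpha>\<^sup>2" "\<alpha> \<le> \<alpha>\<^sup>2"
      using one_le_power[of \<alpha> 2] mult_left_mono[of 1 \<alpha> \<alpha>] by (auto simp: power2_eq_square)
    have "norm (\<Delta> - A) \<le> 2 * R + 2 * R * \<alpha>"
      using norm_triangle_ineq4[of \<Delta> A] \<Delta>_bd A_bd by linarith
    also have "\<dots> \<le> 2 * R * \<alpha>\<^sup>2 + 2 * R * \<alpha>\<^sup>2"
      using ge R_nonneg mult_left_mono[OF ge(1), of "2 * R"] mult_left_mono[OF ge(2), of "2 * R"]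
      by (intro add_mono) auto
    also have "\<dots> \<le> 24 * R * \<alpha>\<^sup>2" using R_nonneg by (simp add: mult_right_mono)
    finally show ?thesis .
  qed
  also have "24 * R * \<alpha>\<^sup>2 = 24 * R ^ 3 * r\<^sup>2 * (norm k)\<^sup>2"
    by (simp add: \<alpha>_def power_mult_distrib power3_eq_cube power2_eq_square mult_ac)
  finally show "norm (F r (w + k) - F r w - (\<integral>y. wt r w y *\<^sub>R (r * (k \<bullet> y)) *\<^sub>R (y - F r w) \<partial>\<mu>) /\<^sub>R Z r w)
        \<le> 24 * R ^ 3 * r\<^sup>2 * (norm k)\<^sup>2"
    by (simp add: A_def \<Delta>_def a_def)
qed

lemma F_differentiable:
  "\<exists>A. linear A \<and> (\<forall>k. norm (A k) \<le> 2 * R\<^sup>2 * \<bar>r\<bar> * norm k) \<and>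
    (\<forall>k. norm (F r (w + k) - F r w - A k) \<le> 24 * R ^ 3 * r\<^sup>2 * (norm k)\<^sup>2)"
proof (intro exI conjI allI)
  let ?A = "\<lambda>k. (\<integral>y. wt r w y *\<^sub>R (r * (k \<bullet> y)) *\<^sub>R (y - F r w) \<partial>\<mu>) /\<^sub>R Z r w"
  have int: "integrable \<mu> (\<lambda>y. wt r w y *\<^sub>R (r * (k \<bullet> y)) *\<^sub>R (y - F r w))" for k
    by (rule integrable_weighted_deviation[OF _ F_translate(2)]) measurable
  show "linear ?A"
  proof (rule linearI)
    fix k k' :: 'a
    have "(\<integral>y. wt r w y *\<^sub>R (r * ((k + k') \<bullet> y)) *\<^sub>R (y - F r w) \<partial>\<mu>)
        = (\<integral>y. wt r w y *\<^sub>R (r * (k \<bullet> y)) *\<^sub>R (y - F r w) + wt r w y *\<^sub>R (r * (k' \<bullet> y)) *\<^sub>R (y - F r w) \<partial>\<mu>)"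
      by (simp add: inner_add_left distrib_left scaleR_add_left scaleR_add_right)
    then show "?A (k + k') = ?A k + ?A k'"
      by (simp only: Bochner_Integration.integral_add[OF int int] scaleR_add_right)
  next
    fix c :: real and k :: 'a
    have "(\<integral>y. wt r w y *\<^sub>R (r * ((c *\<^sub>R k) \<bullet> y)) *\<^sub>R (y - F r w) \<partial>\<mu>)
        = (\<integral>y. c *\<^sub>R wt r w y *\<^sub>R (r * (k \<bullet> y)) *\<^sub>R (y - F r w) \<partial>\<mu>)"
      by (simp add: mult_ac)
    then show "?A (c *\<^sub>R k) = c *\<^sub>R ?A k"
      by (simp only: Bochner_Integration.integral_scaleR_right scaleR_left_commute)
  qed
qed (rule F_differential_bound F_remainder_bound)+

end

section \<open>Euler scheme and the Gaussian channel\<close>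

fun euler :: "(real \<Rightarrow> 'a \<Rightarrow> 'a::real_vector) \<Rightarrow> real \<Rightarrow> nat \<Rightarrow> 'a \<Rightarrow> 'a" where
  "euler F h 0 w = w"
| "euler F h (Suc k) w = euler F h k w + h *\<^sub>R F (real k * h) (euler F h k w)"

text \<open>F is merely continuous in time, so the local error is o(h): it comes from the uniform
  continuity of t \<mapsto> F t (W t) on [0,S]. A discrete Gronwall estimate adds up the local
  errors. The Lipschitz bound is asked on [0,S] only, because for the posterior mean it grows with
  time.\<close>

lemma euler_converges:
  fixes W :: "real \<Rightarrow> 'a::euclidean_space"
  assumes cont: "continuous_on UNIV (\<lambda>(t, x). F t x)"
    and lip: "\<And>t x y. t \<in> {0..S} \<Longrightarrow> norm (F t x - F t y) \<le> L * norm (x - y)"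
    and deriv: "\<And>t. 0 \<le> t \<Longrightarrow> (W has_vector_derivative F t (W t)) (at t within {0..})"
    and "0 \<le> S" "0 \<le> L"
  shows "(\<lambda>n. euler F (S / real (Suc n)) (Suc n) (W 0)) \<longlonglongrightarrow> W S"
proof (rule LIMSEQ_I)
  fix r :: real assume "0 < r"
  \<comment> \<open>Chosen so that the final error S \<epsilon> exp(LS) is at most r/2; the 1 keeps
    the denominator positive when S = 0.\<close>
  define \<epsilon> where "\<epsilon> = (r / 2) / (1 + S * exp (L * S))"
  have pos: "1 + S * exp (L * S) > 0" using \<open>0 \<le> S\<close> by (simp add: add_pos_nonneg)
  then have "\<epsilon> > 0" using \<open>0 < r\<close> by (simp add: \<epsilon>_def)
  define g where "g t = F t (W t)" for t
  have "continuous_on {0..S} W"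
    unfolding continuous_on_eq_continuous_within
  proof
    fix t assume t: "t \<in> {0..S}"
    have "(W has_vector_derivative F t (W t)) (at t within {0..S})"
      by (rule has_vector_derivative_within_subset[OF deriv]) (use t in auto)
    then show "continuous (at t within {0..S}) W" by (rule has_vector_derivative_continuous)
  qed
  then have "continuous_on {0..S} g"
    using continuous_on_compose2[OF cont, of "{0..S}" "\<lambda>t. (t, W t)"]
    by (simp add: g_def continuous_on_Pair)
  then have "uniformly_continuous_on {0..S} g"
    by (rule compact_uniformly_continuous) simp
  then obtain d where d: "d > 0" "\<And>s t. \<lbrakk>s \<in> {0..S}; t \<in> {0..S}; dist s t < d\<rbrakk> \<Longrightarrow> dist (g s) (g t) < \<epsilon>"
    unfolding uniformly_continuous_on_def using \<open>\<epsilon> > 0\<close> by metis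
  obtain N where N: "S / d < real N" using reals_Archimedean2 by blast
  show "\<exists>no. \<forall>n\<ge>no. norm (euler F (S / real (Suc n)) (Suc n) (W 0) - W S) < r"
  proof (intro exI[of _ N] allI impI)
    fix n assume "N \<le> n"
    define h where "h = S / real (Suc n)"
    have h: "0 \<le> h" using \<open>0 \<le> S\<close> by (simp add: h_def)
    have "S / d < real (Suc n)" using N \<open>N \<le> n\<close> by simp
    then have "h < d" using d(1) by (simp add: h_def field_simps)
    have hS: "real (Suc n) * h = S" by (simp add: h_def)
    have step: "norm (W (real (Suc k) * h) - W (real k * h) - h *\<^sub>R g (real k * h)) \<le> h * \<epsilon>" if "k < Suc n" for k
    proof (cases "h = 0")
      case False
      with h have "h > 0" by simp
      let ?a = "real k * h" and ?b = "real (Suc k) * h"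
      have ab: "?a < ?b" "0 \<le> ?a" "?b - ?a = h" using \<open>h > 0\<close> by (auto simp: algebra_simps)
      have "?b \<le> S" unfolding hS[symmetric] using that h by (intro mult_right_mono) auto
      \<comment> \<open>On a step shorter than \<open>d\<close> every slope is within \<epsilon> of
        the slope at the left end, hence so is the average slope.\<close>
      have "(W ?b - W ?a) /\<^sub>R (?b - ?a) \<in> cball (g ?a) \<epsilon>"
      proof (rule mvt_closed_convex)
        fix s assume s: "s \<in> {?a..?b}"
        have "0 \<le> s" using s ab(2) by (meson atLeastAtMost_iff order_trans)
        then show "(W has_vector_derivative g s) (at s within {?a..?b})"
          unfolding g_def using ab by (intro has_vector_derivative_within_subset[OF deriv]) auto
        have "dist ?a s < d" using s ab \<open>h < d\<close> by (auto simp: dist_real_def)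
        moreover have "s \<in> {0..S}" "?a \<in> {0..S}"
          using s ab(1,2) \<open>?b \<le> S\<close> \<open>0 \<le> s\<close> by (meson atLeastAtMost_iff less_imp_le order_trans)+
        ultimately show "g s \<in> cball (g ?a) \<epsilon>"
          by (simp add: d(2) less_imp_le)
      qed (use ab in auto)
      then have "norm ((W ?b - W ?a) /\<^sub>R h - g ?a) \<le> \<epsilon>"
        unfolding ab(3) by (simp add: dist_norm norm_minus_commute)
      then have "h * norm ((W ?b - W ?a) /\<^sub>R h - g ?a) \<le> h * \<epsilon>" using h by (rule mult_left_mono)
      also have "h * norm ((W ?b - W ?a) /\<^sub>R h - g ?a) = norm (h *\<^sub>R ((W ?b - W ?a) /\<^sub>R h - g ?a))"
        using h by simp
      also have "h *\<^sub>R ((W ?b - W ?a) /\<^sub>R h - g ?a) = W ?b - W ?a - h *\<^sub>R g ?a"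
        using \<open>h > 0\<close> by (simp add: scaleR_diff_right)
      finally show ?thesis .
    qed simp
    \<comment> \<open>Each of the k local errors h \<epsilon> is amplified by at most (1 +
      hL)^k.\<close>
    have err: "norm (euler F h k (W 0) - W (real k * h)) \<le> real k * h * \<epsilon> * (1 + h * L) ^ k" if "k \<le> Suc n" for k
      using that
    proof (induction k)
      case (Suc k)
      let ?x = "euler F h k (W 0)" and ?w = "W (real k * h)" and ?t = "real k * h"
      have "?t \<le> S" unfolding hS[symmetric] using Suc.prems h by (intro mult_right_mono) auto
      then have t: "?t \<in> {0..S}" using h by simp
      have ge1: "1 \<le> (1 + h * L) ^ Suc k" using h \<open>0 \<le> L\<close> by (intro one_le_power) simp
      have "euler F h (Suc k) (W 0) - W (real (Suc k) * h)
          = (?x - ?w) + h *\<^sub>R (F ?t ?x - F ?t ?w) - (W (real (Suc k) * h) - ?w - h *\<^sub>R g ?t)"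
        by (simp add: g_def algebra_simps)
      also have "norm \<dots> \<le> (norm (?x - ?w) + h * (L * norm (?x - ?w))) + h * \<epsilon>"
      proof -
        have tri: "norm (a + b - c) \<le> norm a + norm b + norm c" for a b c :: 'a
          using norm_triangle_ineq4[of "a + b" c] norm_triangle_ineq[of a b] by linarith
        have "norm (h *\<^sub>R (F ?t ?x - F ?t ?w)) \<le> h * (L * norm (?x - ?w))"
          using lip[OF t, of ?x ?w] h by (simp add: mult_left_mono)
        then show ?thesis
          using tri[of "?x - ?w" "h *\<^sub>R (F ?t ?x - F ?t ?w)" "W (real (Suc k) * h) - ?w - h *\<^sub>R g ?t"]
            step[of k] Suc.prems by linarith
      qed
      also have "\<dots> = (1 + h * L) * norm (?x - ?w) + h * \<epsilon>" by (simp add: algebra_simps)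
      also have "\<dots> \<le> (1 + h * L) * (?t * \<epsilon> * (1 + h * L) ^ k) + h * \<epsilon> * (1 + h * L) ^ Suc k"
        using Suc h \<open>0 \<le> L\<close> \<open>\<epsilon> > 0\<close> mult_left_mono[OF ge1, of "h * \<epsilon>"] by (intro add_mono mult_left_mono) auto
      also have "\<dots> = real (Suc k) * h * \<epsilon> * (1 + h * L) ^ Suc k" by (simp add: algebra_simps)
      finally show ?case .
    qed simp
    have "(1 + h * L) ^ Suc n \<le> exp (h * L) ^ Suc n"
      using h \<open>0 \<le> L\<close> by (intro power_mono) auto
    also have "\<dots> = exp (real (Suc n) * (h * L))" by (rule exp_of_nat_mult[symmetric])
    also have "\<dots> = exp (L * S)" unfolding hS[symmetric] by (simp add: mult_ac)
    finally have pow: "(1 + h * L) ^ Suc n \<le> exp (L * S)" .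
    have "norm (euler F h (Suc n) (W 0) - W S) \<le> S * \<epsilon> * (1 + h * L) ^ Suc n"
      using err[of "Suc n"] unfolding hS by simp
    also have "\<dots> \<le> S * \<epsilon> * exp (L * S)"
      using pow \<open>0 \<le> S\<close> \<open>\<epsilon> > 0\<close> by (intro mult_left_mono) auto
    also have "\<dots> \<le> (1 + S * exp (L * S)) * \<epsilon>" using \<open>\<epsilon> > 0\<close> by (simp add: algebra_simps)
    also have "\<dots> = r / 2"
      unfolding \<epsilon>_def using pos by (metis less_irrefl nonzero_mult_div_cancel_left times_divide_eq_right)
    also have "\<dots> < r" using \<open>0 < r\<close> by simp
    finally show "norm (euler F (S / real (Suc n)) (Suc n) (W 0) - W S) < r" by (simp add: h_def)
  qed
qed

lemma C11_continuous:
  assumes "C11 c G"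
  shows "continuous_on UNIV G"
proof -
  obtain D where c: "0 \<le> c" and D: "\<And>x k. \<bar>D x k\<bar> \<le> c * norm k"
    "\<And>x k. \<bar>G (x + k) - G x - D x k\<bar> \<le> c * (norm k)\<^sup>2"
    using assms unfolding C11_def by metis
  have "isCont G x" for x
    unfolding isCont_iff
  proof (rule LIM_zero_cancel, rule Lim_null_comparison)
    show "\<forall>\<^sub>F k in at 0. norm (G (x + k) - G x) \<le> c * norm k + c * (norm k)\<^sup>2"
      using D[of x] by (intro always_eventually allI) (smt (verit) real_norm_def)
    have "((\<lambda>k::'a. c * norm k + c * (norm k)\<^sup>2) \<longlongrightarrow> c * norm (0::'a) + c * (norm (0::'a))\<^sup>2) (at 0)"
      by (intro tendsto_intros tendsto_norm[OF tendsto_ident_at])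
    then show "((\<lambda>k::'a. c * norm k + c * (norm k)\<^sup>2) \<longlongrightarrow> 0) (at 0)" by simp
  qed
  then show ?thesis by (simp add: continuous_at_imp_continuous_on)
qed

section \<open>The Gaussian channel: prior plus independent normal noise\<close>

locale gaussian_channel = bounded_prior \<mu> R for \<mu> :: "'a::euclidean_space measure" and R +
  fixes c :: real
  assumes c_pos: "0 < c"
    and noise_prob: "prob_space (density lborel (\<lambda>u::'a. ennreal (c * exp (- (norm u)\<^sup>2 / 2))))"
begin

definition noise :: "'a measure" where
  "noise = density lborel (\<lambda>u. ennreal (c * exp (- (norm u)\<^sup>2 / 2)))"

lemma sets_noise [measurable_cong]: "sets noise = sets borel"
  by (simp add: noise_def)

sublocale noise: prob_space noise
  unfolding noise_def by (rule noise_prob)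

sublocale pair: pair_prob_space \<mu> noise ..

lemma AE_pair_prior_bound: "AE z in \<mu> \<Otimes>\<^sub>M noise. norm (fst z) \<le> R"
proof (rule pair.AE_pair_measure)
  show "AE y in \<mu>. AE u in noise. norm (fst (y, u)) \<le> R"
    using prior_bound by eventually_elim simp
qed measurable

text \<open>This is the conditioning step in analytic form. The pair of y and x = u + s y has
  density c \<open>wt s x y\<close> with respect to \<mu> times Lebesgue measure, so by Fubini the
  expectation of g(x, y) is the integral over x of quantities that vanish by hypothesis.\<close>

lemma wt_centered_imp_orthogonal:
  assumes g [measurable]: "(\<lambda>(x, y). g x y) \<in> borel_measurable (borel \<Otimes>\<^sub>M borel)"
    and bd: "\<And>x y. norm y \<le> R \<Longrightarrow> \<bar>g x y\<bar> \<le> B"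
    and zero: "\<And>x. (\<integral>y. wt s x y * g x y \<partial>\<mu>) = 0"
  shows "(\<integral>(y, u). g (u + s *\<^sub>R y) y \<partial>(\<mu> \<Otimes>\<^sub>M noise)) = 0"
proof -
  interpret L: pair_sigma_finite \<mu> "lborel :: 'a measure" ..
  have B: "0 \<le> B" using bd[of 0 0] R_nonneg by (simp add: order_trans[OF abs_ge_zero])
  have translate: "(\<integral>u. f u \<partial>lborel) = (\<integral>u. f (u + a) \<partial>lborel)" 
    if [measurable]: "f \<in> borel_measurable borel" for f :: "'a \<Rightarrow> real" and a
  proof -
    have "(\<integral>u. f u \<partial>lborel) = (\<integral>u. f u \<partial>distr lborel borel ((+) a))" by (simp add: lborel_distr_plus)
    also have "\<dots> = (\<integral>u. f (a + u) \<partial>lborel)" by (subst integral_distr) auto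
    finally show ?thesis by (simp add: add.commute)
  qed
  have bd_AE: "AE y in \<mu>. \<forall>x. \<bar>g x y\<bar> \<le> B"
    using prior_bound by eventually_elim (use bd in auto)
  \<comment> \<open>For fixed y this is the noise density translated by s y. Times B, it is the
    integrable majorant that Fubini's theorem asks for.\<close>
  have wt_lborel: "integrable lborel (\<lambda>x. c * wt s x y)" "(\<integral>x. c * wt s x y \<partial>lborel) = 1" for y
  proof -
    have 1: "(\<integral>\<^sup>+u. ennreal (c * exp (- (norm (u::'a))\<^sup>2 / 2)) \<partial>lborel) = 1"
      using noise.emeasure_space_1 by (simp add: noise_def emeasure_density)
    have "(\<integral>\<^sup>+x. ennreal (c * wt s x y) \<partial>lborel) = (\<integral>\<^sup>+x. ennreal (c * wt s x y) \<partial>distr lborel borel ((+) (s *\<^sub>R y)))"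
      by (simp add: lborel_distr_plus)
    also have "\<dots> = (\<integral>\<^sup>+u. ennreal (c * exp (- (norm (u::'a))\<^sup>2 / 2)) \<partial>lborel)"
      by (subst nn_integral_distr) (auto simp: wt_def)
    finally have 2: "(\<integral>\<^sup>+x. ennreal (c * wt s x y) \<partial>lborel) = 1" using 1 by simp
    have "has_bochner_integral lborel (\<lambda>x. c * wt s x y) 1"
      using 2 c_pos by (intro has_bochner_integral_nn_integral) (auto simp: wt_pos less_imp_le)
    then show "integrable lborel (\<lambda>x. c * wt s x y)" "(\<integral>x. c * wt s x y \<partial>lborel) = 1"
      by (auto simp: has_bochner_integral_iff)
  qed
  have meas: "(\<lambda>(y, x). c * (wt s x y * g x y)) \<in> borel_measurable (\<mu> \<Otimes>\<^sub>M lborel)" by measurable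
  have int: "integrable (\<mu> \<Otimes>\<^sub>M lborel) (\<lambda>(y, x). c * (wt s x y * g x y))"
  proof (rule L.Fubini_integrable)
    have le: "AE y in \<mu>. \<forall>x. norm (c * (wt s x y * g x y)) \<le> B * (c * wt s x y)"
      using bd_AE
    proof eventually_elim
      fix y assume y: "\<forall>x. \<bar>g x y\<bar> \<le> B"
      show "\<forall>x. norm (c * (wt s x y * g x y)) \<le> B * (c * wt s x y)"
      proof
        fix x
        have "norm (c * (wt s x y * g x y)) = (c * wt s x y) * \<bar>g x y\<bar>"
          using c_pos wt_pos[of s x y] by (simp add: abs_mult)
        also have "\<dots> \<le> (c * wt s x y) * B"
          using y c_pos wt_pos[of s x y] by (intro mult_left_mono) auto
        finally show "norm (c * (wt s x y * g x y)) \<le> B * (c * wt s x y)" by (simp add: mult.commute)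
      qed
    qed
    show "integrable \<mu> (\<lambda>y. \<integral>x. norm (case (y, x) of (y, x) \<Rightarrow> c * (wt s x y * g x y)) \<partial>lborel)"
    proof (rule integrable_bounded[where B=B])
      show "AE y in \<mu>. norm (\<integral>x. norm (case (y, x) of (y, x) \<Rightarrow> c * (wt s x y * g x y)) \<partial>lborel) \<le> B"
        using le
      proof eventually_elim
        fix y assume y: "\<forall>x. norm (c * (wt s x y * g x y)) \<le> B * (c * wt s x y)"
        have "(\<integral>x. norm (c * (wt s x y * g x y)) \<partial>lborel) \<le> (\<integral>x. B * (c * wt s x y) \<partial>lborel)"
          by (rule integral_mono') (use y wt_lborel(1) B c_pos wt_pos in \<open>auto simp: less_imp_le\<close>)
        also have "\<dots> = B" using wt_lborel(2) by simp
        finally show "norm (\<integral>x. norm (case (y, x) of (y, x) \<Rightarrow> c * (wt s x y * g x y)) \<partial>lborel) \<le> B"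
          by (simp add: integral_nonneg_AE)
      qed
    qed measurable
    show "AE y in \<mu>. integrable lborel (\<lambda>x. case (y, x) of (y, x) \<Rightarrow> c * (wt s x y * g x y))"
      using le
    proof eventually_elim
      fix y assume y: "\<forall>x. norm (c * (wt s x y * g x y)) \<le> B * (c * wt s x y)"
      show "integrable lborel (\<lambda>x. case (y, x) of (y, x) \<Rightarrow> c * (wt s x y * g x y))"
        by (rule Bochner_Integration.integrable_bound[of _ "\<lambda>x. B * (c * wt s x y)"])
          (use wt_lborel(1)[of y] y in \<open>auto intro!: AE_I2 order_trans[OF _ abs_ge_self]\<close>)
    qed
  qed (rule meas)
  have int': "integrable (\<mu> \<Otimes>\<^sub>M noise) (\<lambda>(y, u). g (u + s *\<^sub>R y) y)"
  proof (rule pair.P.integrable_const_bound[where B=B])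
    show "AE z in \<mu> \<Otimes>\<^sub>M noise. norm (case z of (y, u) \<Rightarrow> g (u + s *\<^sub>R y) y) \<le> B"
      using AE_pair_prior_bound by eventually_elim (auto simp: bd)
  qed measurable
  have "(\<integral>(y, u). g (u + s *\<^sub>R y) y \<partial>(\<mu> \<Otimes>\<^sub>M noise)) = (\<integral>y. (\<integral>u. g (u + s *\<^sub>R y) y \<partial>noise) \<partial>\<mu>)"
    by (rule pair.integral_fst'[symmetric, OF int', simplified])
  also have "\<dots> = (\<integral>y. (\<integral>x. c * (wt s x y * g x y) \<partial>lborel) \<partial>\<mu>)"
  proof (rule Bochner_Integration.integral_cong[OF refl])
    fix y
    have "(\<integral>u. g (u + s *\<^sub>R y) y \<partial>noise) = (\<integral>u. (c * exp (- (norm u)\<^sup>2 / 2)) *\<^sub>R g (u + s *\<^sub>R y) y \<partial>lborel)"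
      unfolding noise_def using c_pos by (subst integral_density) auto
    also have "\<dots> = (\<integral>x. c * (wt s x y * g x y) \<partial>lborel)"
      by (subst translate[of "\<lambda>x. c * (wt s x y * g x y)" "s *\<^sub>R y"]) (auto simp: wt_def mult.assoc)
    finally show "(\<integral>u. g (u + s *\<^sub>R y) y \<partial>noise) = (\<integral>x. c * (wt s x y * g x y) \<partial>lborel)" .
  qed
  also have "\<dots> = (\<integral>x. (\<integral>y. c * (wt s x y * g x y) \<partial>\<mu>) \<partial>lborel)"
    using L.Fubini_integral[of "\<lambda>y x. c * (wt s x y * g x y)", OF int] by (rule sym)
  also have "\<dots> = 0" by (simp add: zero)
  finally show ?thesis .
qed

end

context gaussian_channel
begin

text \<open>From x = u + s y the two arguments move by h y and by h \<open>F s x\<close>, both of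
  length at most hR. Each Taylor remainder costs b (hR)^2, hence the 2; the first-order terms differ
  by \<open>g\<close>, which has expectation 0.\<close>

lemma C11_one_step:
  assumes G: "C11 b G" and bd: "\<And>x. \<bar>G x\<bar> \<le> B" and h: "0 \<le> h"
  shows "\<bar>(\<integral>(y, u). G (u + (s + h) *\<^sub>R y) \<partial>(\<mu> \<Otimes>\<^sub>M noise))
      - (\<integral>(y, u). G (u + s *\<^sub>R y + h *\<^sub>R F s (u + s *\<^sub>R y)) \<partial>(\<mu> \<Otimes>\<^sub>M noise))\<bar> \<le> 2 * b * (h * R)\<^sup>2"
proof -
  obtain D where b: "0 \<le> b" and D: "\<And>x. linear (D x)" "\<And>x k. \<bar>D x k\<bar> \<le> b * norm k"
    "\<And>x k. \<bar>G (x + k) - G x - D x k\<bar> \<le> b * (norm k)\<^sup>2"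
    using G unfolding C11_def by metis
  have G_meas [measurable]: "G \<in> borel_measurable borel"
    by (intro borel_measurable_continuous_onI C11_continuous[OF G])
  define g where "g x y = h * D x (y - F s x)" for x y
  \<comment> \<open>\<open>D\<close> is an arbitrary choice; its measurability comes from being a limit of difference quotients.\<close>
  have lim: "(\<lambda>n. real (Suc n) * (G (x + k /\<^sub>R real (Suc n)) - G x)) \<longlonglongrightarrow> D x k" for x k
  proof (rule LIM_zero_cancel, rule Lim_null_comparison)
    have "\<bar>real (Suc n) * (G (x + k /\<^sub>R real (Suc n)) - G x) - D x k\<bar> \<le> b * (norm k)\<^sup>2 / real (Suc n)" for n
    proof -
      let ?m = "real (Suc n)"
      have "?m * (G (x + k /\<^sub>R ?m) - G x) - D x k = ?m * (G (x + k /\<^sub>R ?m) - G x - D x (k /\<^sub>R ?m))"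
        by (simp add: linear_cmul[OF D(1)] right_diff_distrib del: of_nat_Suc)
      also have "\<bar>\<dots>\<bar> \<le> ?m * (b * (norm (k /\<^sub>R ?m))\<^sup>2)"
        unfolding abs_mult using mult_left_mono[OF D(3)[of x "k /\<^sub>R ?m"], of ?m] by simp
      also have "\<dots> = b * (norm k)\<^sup>2 / ?m" by (simp add: power2_eq_square divide_simps del: of_nat_Suc)
      finally show ?thesis .
    qed
    then show "\<forall>\<^sub>F n in sequentially. norm (real (Suc n) * (G (x + k /\<^sub>R real (Suc n)) - G x) - D x k) \<le> b * (norm k)\<^sup>2 / real (Suc n)"
      by simp
    show "(\<lambda>n. b * (norm k)\<^sup>2 / real (Suc n)) \<longlonglongrightarrow> 0"
      using tendsto_mult_right_zero[OF LIMSEQ_inverse_real_of_nat, of "b * (norm k)\<^sup>2"] by (simp add: divide_inverse)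
  qed
  have g_meas [measurable]: "(\<lambda>(x, y). g x y) \<in> borel_measurable (borel \<Otimes>\<^sub>M borel)"
  proof (rule borel_measurable_LIMSEQ_real)
    show "(\<lambda>n. case p of (x, y) \<Rightarrow> h * (real (Suc n) * (G (x + (y - F s x) /\<^sub>R real (Suc n)) - G x)))
        \<longlonglongrightarrow> (case p of (x, y) \<Rightarrow> g x y)" for p
      unfolding g_def by (cases p) (auto intro!: tendsto_mult_left lim simp del: of_nat_Suc)
  qed measurable
  have g_bd: "\<bar>g x y\<bar> \<le> h * (b * (2 * R))" if "norm y \<le> R" for x y
  proof -
    have "norm (y - F s x) \<le> 2 * R"
      using norm_triangle_ineq4[of y "F s x"] that F_bound[of s x] by simp
    then have "b * norm (y - F s x) \<le> b * (2 * R)" using b by (rule mult_left_mono)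
    then have "\<bar>D x (y - F s x)\<bar> \<le> b * (2 * R)" using D(2)[of x "y - F s x"] by linarith
    then show ?thesis using h by (simp add: g_def abs_mult mult_left_mono)
  qed
  have g_zero: "(\<integral>y. wt s x y * g x y \<partial>\<mu>) = 0" for x
  proof -
    have int: "integrable \<mu> (\<lambda>y. wt s x y *\<^sub>R (y - F s x))"
      using integrable_weighted_deviation[of "\<lambda>_. 1" 1 s x] by simp
    have "(\<integral>y. wt s x y * g x y \<partial>\<mu>) = (\<integral>y. h * D x (wt s x y *\<^sub>R (y - F s x)) \<partial>\<mu>)"
      by (simp add: g_def linear_cmul[OF D(1)] mult_ac)
    also have "\<dots> = h * D x (\<integral>y. wt s x y *\<^sub>R (y - F s x) \<partial>\<mu>)"
      using integral_bounded_linear[OF linear_conv_bounded_linear[THEN iffD1, OF D(1)[of x]] int] by simp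
    also have "\<dots> = 0" by (simp add: F_centered linear_0[OF D(1)])
    finally show ?thesis .
  qed
  have ortho: "(\<integral>(y, u). g (u + s *\<^sub>R y) y \<partial>(\<mu> \<Otimes>\<^sub>M noise)) = 0"
    by (rule wt_centered_imp_orthogonal[OF g_meas g_bd g_zero])
  have int1: "integrable (\<mu> \<Otimes>\<^sub>M noise) (\<lambda>(y, u). G (u + (s + h) *\<^sub>R y))"
    by (rule pair.P.integrable_const_bound[where B=B]) (auto simp: bd)
  have int2: "integrable (\<mu> \<Otimes>\<^sub>M noise) (\<lambda>(y, u). G (u + s *\<^sub>R y + h *\<^sub>R F s (u + s *\<^sub>R y)))"
    by (rule pair.P.integrable_const_bound[where B=B]) (auto simp: bd)
  have int3: "integrable (\<mu> \<Otimes>\<^sub>M noise) (\<lambda>(y, u). g (u + s *\<^sub>R y) y)"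
  proof (rule pair.P.integrable_const_bound[where B="h * (b * (2 * R))"])
    show "AE z in \<mu> \<Otimes>\<^sub>M noise. norm (case z of (y, u) \<Rightarrow> g (u + s *\<^sub>R y) y) \<le> h * (b * (2 * R))"
      using AE_pair_prior_bound by eventually_elim (auto simp: g_bd)
  qed measurable
  define f where "f = (\<lambda>(y, u). G (u + (s + h) *\<^sub>R y) - G (u + s *\<^sub>R y + h *\<^sub>R F s (u + s *\<^sub>R y)) - g (u + s *\<^sub>R y) y)"
  have f_int: "integrable (\<mu> \<Otimes>\<^sub>M noise) f"
    using Bochner_Integration.integrable_diff[OF Bochner_Integration.integrable_diff[OF int1 int2] int3]
    unfolding f_def by (simp add: case_prod_unfold)
  have f_bd: "AE z in \<mu> \<Otimes>\<^sub>M noise. \<bar>f z\<bar> \<le> 2 * b * (h * R)\<^sup>2"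
    using AE_pair_prior_bound
  proof eventually_elim
    fix z :: "'a \<times> 'a" assume "norm (fst z) \<le> R"
    then obtain y u where z: "z = (y, u)" and y: "norm y \<le> R" by (cases z) auto
    let ?x = "u + s *\<^sub>R y"
    have rem: "\<bar>G (?x + h *\<^sub>R v) - G ?x - D ?x (h *\<^sub>R v)\<bar> \<le> b * (h * R)\<^sup>2" if "norm v \<le> R" for v
    proof -
      have "norm (h *\<^sub>R v) \<le> h * R" using h that by (simp add: mult_left_mono)
      then have "b * (norm (h *\<^sub>R v))\<^sup>2 \<le> b * (h * R)\<^sup>2" using b by (intro mult_left_mono power_mono) auto
      then show ?thesis using D(3)[of ?x "h *\<^sub>R v"] by linarith
    qed
    have "f z = (G (?x + h *\<^sub>R y) - G ?x - D ?x (h *\<^sub>R y)) - (G (?x + h *\<^sub>R F s ?x) - G ?x - D ?x (h *\<^sub>R F s ?x))"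
      by (simp add: f_def z g_def linear_cmul[OF D(1)] linear_diff[OF D(1)] scaleR_add_left algebra_simps)
    then show "\<bar>f z\<bar> \<le> 2 * b * (h * R)\<^sup>2"
      using rem[OF y] rem[OF F_bound[of s ?x]] by linarith
  qed
  have "(\<integral>(y, u). G (u + (s + h) *\<^sub>R y) \<partial>(\<mu> \<Otimes>\<^sub>M noise))
      - (\<integral>(y, u). G (u + s *\<^sub>R y + h *\<^sub>R F s (u + s *\<^sub>R y)) \<partial>(\<mu> \<Otimes>\<^sub>M noise)) = (\<integral>z. f z \<partial>(\<mu> \<Otimes>\<^sub>M noise))"
    using ortho
      Bochner_Integration.integral_diff[OF Bochner_Integration.integrable_diff[OF int1 int2] int3]
      Bochner_Integration.integral_diff[OF int1 int2]
    by (simp add: f_def case_prod_beta)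
  also have "\<bar>\<dots>\<bar> \<le> 2 * b * (h * R)\<^sup>2"
  proof (rule abs_leI)
    show "(\<integral>z. f z \<partial>(\<mu> \<Otimes>\<^sub>M noise)) \<le> 2 * b * (h * R)\<^sup>2"
      by (rule pair.P.integral_le_const[OF f_int]) (use f_bd in \<open>eventually_elim, auto\<close>)
    have "- (2 * b * (h * R)\<^sup>2) \<le> (\<integral>z. f z \<partial>(\<mu> \<Otimes>\<^sub>M noise))"
      by (rule pair.P.integral_ge_const[OF f_int]) (use f_bd in \<open>eventually_elim, auto\<close>)
    then show "- (\<integral>z. f z \<partial>(\<mu> \<Otimes>\<^sub>M noise)) \<le> 2 * b * (h * R)\<^sup>2" by linarith
  qed
  finally show ?thesis .
qed

lemma euler_measurable [measurable]: "euler F h k \<in> borel_measurable borel"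
  by (induction k) simp_all

text \<open>The induction takes the last Euler step off the scheme and composes it with the test
  function, so \<open>G\<close> and its constant \<open>b\<close> must vary; each step multiplies
  the constant by q. \<open>L\<close> adds the Lipschitz and the remainder constant of F on [0,S],
  so that one number dominates all three bounds required by \<open>C11_euler_step\<close>.\<close>

lemma C11_euler_error:
  assumes "0 \<le> S" "0 \<le> h" "h \<le> 1"
  defines "L \<equiv> 16 * R\<^sup>2 * S + 24 * R ^ 3 * S\<^sup>2"
  assumes "real k * h \<le> S" "C11 b G" "\<And>x. \<bar>G x\<bar> \<le> B"
  shows "\<bar>(\<integral>(y, u). G (u + (real k * h) *\<^sub>R y) \<partial>(\<mu> \<Otimes>\<^sub>M noise))
      - (\<integral>(y, u). G (euler F h k u) \<partial>(\<mu> \<Otimes>\<^sub>M noise))\<bar>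
    \<le> real k * (2 * b * (1 + h * (3 * L + L\<^sup>2)) ^ k * (h * R)\<^sup>2)"
  using assms(5-7)
proof (induction k arbitrary: b G)
  case 0
  then show ?case by simp
next
  case (Suc k)
  define q where "q = 1 + h * (3 * L + L\<^sup>2)"
  define s where "s = real k * h"
  define G' where "G' = (\<lambda>x. G (x + h *\<^sub>R F s x))"
  have R3: "0 \<le> R ^ 3" using R_nonneg by simp
  have L: "0 \<le> L" using \<open>0 \<le> S\<close> R3 by (simp add: L_def)
  have q: "1 \<le> q" using L \<open>0 \<le> h\<close> by (simp add: q_def)
  have b: "0 \<le> b" using Suc.prems by (simp add: C11_def)
  have s: "0 \<le> s" "s \<le> S" using Suc.prems(1) \<open>0 \<le> h\<close> by (auto simp: s_def algebra_simps)
  have LS: "16 * R\<^sup>2 * \<bar>s\<bar> \<le> L" "2 * R\<^sup>2 * \<bar>s\<bar> \<le> L" "24 * R ^ 3 * s\<^sup>2 \<le> L"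
  proof -
    have "16 * R\<^sup>2 * \<bar>s\<bar> \<le> 16 * R\<^sup>2 * S" "24 * R ^ 3 * s\<^sup>2 \<le> 24 * R ^ 3 * S\<^sup>2"
      using s R3 by (auto intro!: mult_left_mono power_mono)
    moreover have "2 * R\<^sup>2 * \<bar>s\<bar> \<le> 16 * R\<^sup>2 * \<bar>s\<bar>" by (intro mult_right_mono) auto
    moreover have "0 \<le> 16 * R\<^sup>2 * S" "0 \<le> 24 * R ^ 3 * S\<^sup>2" using R3 \<open>0 \<le> S\<close> by auto
    ultimately show "16 * R\<^sup>2 * \<bar>s\<bar> \<le> L" "2 * R\<^sup>2 * \<bar>s\<bar> \<le> L" "24 * R ^ 3 * s\<^sup>2 \<le> L"
      unfolding L_def by linarith+
  qed
  have "C11 (b * q) G'"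
    unfolding q_def G'_def
  proof (rule C11_euler_step[OF Suc.prems(2) \<open>0 \<le> h\<close> \<open>h \<le> 1\<close> L])
    show "norm (F s (x + k) - F s x) \<le> L * norm k" for x k
      by (rule order_trans[OF F_lipschitz]) (intro mult_right_mono LS norm_ge_zero)
    show "\<exists>A. linear A \<and> (\<forall>k. norm (A k) \<le> L * norm k) \<and> (\<forall>k. norm (F s (x + k) - F s x - A k) \<le> L * (norm k)\<^sup>2)" for x
    proof -
      obtain A where A: "linear A" "\<And>k. norm (A k) \<le> 2 * R\<^sup>2 * \<bar>s\<bar> * norm k"
        "\<And>k. norm (F s (x + k) - F s x - A k) \<le> 24 * R ^ 3 * s\<^sup>2 * (norm k)\<^sup>2"
        using F_differentiable[of s x] by auto
      show ?thesis
        by (intro exI[of _ A] conjI allI A(1) order_trans[OF A(2)] order_trans[OF A(3)] mult_right_mono LS) auto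
    qed
  qed
  then have IH: "\<bar>(\<integral>(y, u). G' (u + s *\<^sub>R y) \<partial>(\<mu> \<Otimes>\<^sub>M noise)) - (\<integral>(y, u). G' (euler F h k u) \<partial>(\<mu> \<Otimes>\<^sub>M noise))\<bar>
      \<le> real k * (2 * (b * q) * q ^ k * (h * R)\<^sup>2)"
    unfolding s_def q_def by (intro Suc.IH) (use s Suc.prems(3) in \<open>simp_all add: s_def G'_def\<close>)
  have step: "\<bar>(\<integral>(y, u). G (u + (s + h) *\<^sub>R y) \<partial>(\<mu> \<Otimes>\<^sub>M noise)) - (\<integral>(y, u). G' (u + s *\<^sub>R y) \<partial>(\<mu> \<Otimes>\<^sub>M noise))\<bar>
      \<le> 2 * b * (h * R)\<^sup>2"
    unfolding G'_def by (rule C11_one_step[OF Suc.prems(2,3) \<open>0 \<le> h\<close>])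
  \<comment> \<open>The error of the new step is enlarged by \<open>q ^ Suc k\<close> so that all
    summands take the same form.\<close>
  have "2 * b * (h * R)\<^sup>2 * 1 \<le> 2 * b * (h * R)\<^sup>2 * q ^ Suc k"
    using b q by (intro mult_left_mono one_le_power) auto
  moreover have "real (Suc k) * (2 * b * q ^ Suc k * (h * R)\<^sup>2)
      = real k * (2 * (b * q) * q ^ k * (h * R)\<^sup>2) + 2 * b * (h * R)\<^sup>2 * q ^ Suc k"
    by (simp add: algebra_simps)
  moreover have "real (Suc k) * h = s + h" by (simp add: s_def algebra_simps)
  moreover have "G (euler F h (Suc k) u) = G' (euler F h k u)" for u by (simp add: G'_def s_def)
  ultimately show ?case
    using IH step unfolding q_def[symmetric] by simp
qed

text \<open>Measurability in the initial value is inherited from the Euler maps, which are Borel and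
  converge pointwise to the flow.\<close>

lemma flow_measurable:
  assumes W: "\<And>w. W w 0 = w"
    "\<And>w t. 0 \<le> t \<Longrightarrow> (W w has_vector_derivative F t (W w t)) (at t within {0..})"
    and S: "0 \<le> S"
  shows "(\<lambda>w. W w S) \<in> borel_measurable borel"
    and "(\<lambda>n. euler F (S / real (Suc n)) (Suc n) w) \<longlonglongrightarrow> W w S"
proof -
  show lim: "(\<lambda>n. euler F (S / real (Suc n)) (Suc n) w) \<longlonglongrightarrow> W w S" for w
  proof -
    have "norm (F t x - F t y) \<le> (16 * R\<^sup>2 * S) * norm (x - y)" if t: "t \<in> {0..S}" for t x y
    proof -
      have "norm (F t x - F t y) \<le> 16 * R\<^sup>2 * \<bar>t\<bar> * norm (x - y)"
        using F_lipschitz[of t y "x - y"] by simp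
      also have "\<dots> \<le> 16 * R\<^sup>2 * S * norm (x - y)" using t by (intro mult_right_mono mult_left_mono) auto
      finally show ?thesis .
    qed
    from euler_converges[OF F_continuous this W(2) S] show ?thesis using S by (simp add: W(1))
  qed
  show "(\<lambda>w. W w S) \<in> borel_measurable borel"
    by (rule borel_measurable_LIMSEQ_metric[OF _ lim]) measurable
qed

text \<open>Both sides are limits of the same Euler expectations: the right one by dominated
  convergence, the left one because n + 1 errors of order h^2 with h = S/(n + 1) add up to O(1/(n +
  1)). The integration over y on the right is a dummy that keeps everything on one product
  space.\<close>

lemma flow_law_C11:
  assumes W: "\<And>w. W w 0 = w"
    "\<And>w t. 0 \<le> t \<Longrightarrow> (W w has_vector_derivative F t (W w t)) (at t within {0..})"
    and S: "0 \<le> S" and G: "C11 b G" and bd: "\<And>x. \<bar>G x\<bar> \<le> B"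
  shows "(\<integral>(y, u). G (u + S *\<^sub>R y) \<partial>(\<mu> \<Otimes>\<^sub>M noise)) = (\<integral>(y, u). G (W u S) \<partial>(\<mu> \<Otimes>\<^sub>M noise))"
proof -
  define L where "L = 16 * R\<^sup>2 * S + 24 * R ^ 3 * S\<^sup>2"
  define K where "K = 3 * L + L\<^sup>2"
  have R3: "0 \<le> R ^ 3" using R_nonneg by simp
  have K: "0 \<le> K" using S R3 by (simp add: K_def L_def)
  have b: "0 \<le> b" using G by (simp add: C11_def)
  have [measurable]: "G \<in> borel_measurable borel"
    by (intro borel_measurable_continuous_onI C11_continuous[OF G])
  have [measurable]: "(\<lambda>w. W w S) \<in> borel_measurable borel"
    by (rule flow_measurable[OF W S])
  let ?E = "\<lambda>n. \<integral>(y, u). G (euler F (S / real (Suc n)) (Suc n) u) \<partial>(\<mu> \<Otimes>\<^sub>M noise)"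
  let ?X = "\<integral>(y, u). G (u + S *\<^sub>R y) \<partial>(\<mu> \<Otimes>\<^sub>M noise)"
  have "?E \<longlonglongrightarrow> (\<integral>(y, u). G (W u S) \<partial>(\<mu> \<Otimes>\<^sub>M noise))"
  proof (rule integral_dominated_convergence[where w="\<lambda>_. B"])
    have "isCont G x" for x
      using C11_continuous[OF G] by (simp add: continuous_on_eq_continuous_at)
    then show "AE z in \<mu> \<Otimes>\<^sub>M noise. (\<lambda>n. case z of (y, u) \<Rightarrow> G (euler F (S / real (Suc n)) (Suc n) u))
        \<longlonglongrightarrow> (case z of (y, u) \<Rightarrow> G (W u S))"
      by (auto intro!: AE_I2 isCont_tendsto_compose[of _ G] flow_measurable(2)[OF W S] simp del: euler.simps of_nat_Suc)
  qed (auto simp: bd case_prod_beta simp del: euler.simps)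
  moreover have "?E \<longlonglongrightarrow> ?X"
  proof (rule LIM_zero_cancel, rule Lim_null_comparison)
    \<comment> \<open>For n \<ge> N the step size S/(n + 1) is at most 1, as
      \<open>C11_euler_error\<close> requires.\<close>
    obtain N where N: "S < real N" using reals_Archimedean2 by blast
    have bound: "norm (?E n - ?X) \<le> (2 * b * exp (K * S) * (S * R)\<^sup>2) / real (Suc n)" if n: "N \<le> n" for n
    proof -
      define h where "h = S / real (Suc n)"
      have h: "0 \<le> h" "h \<le> 1" "real (Suc n) * h = S" using S N n by (auto simp: h_def field_simps)
      have pow: "(1 + h * K) ^ Suc n \<le> exp (K * S)"
      proof -
        have "(1 + h * K) ^ Suc n \<le> exp (h * K) ^ Suc n"
          using h K by (intro power_mono) auto
        also have "\<dots> = exp (real (Suc n) * (h * K))" by (rule exp_of_nat_mult[symmetric])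
        also have "\<dots> = exp (K * S)" unfolding h(3)[symmetric] by (simp add: mult_ac)
        finally show ?thesis .
      qed
      have "norm (?E n - ?X) \<le> real (Suc n) * (2 * b * (1 + h * K) ^ Suc n * (h * R)\<^sup>2)"
        using C11_euler_error[OF S h(1,2) _ G bd, of "Suc n"]
        unfolding h(3) K_def L_def by (simp add: h_def abs_minus_commute del: euler.simps power_Suc of_nat_Suc)
      also have "\<dots> \<le> real (Suc n) * (2 * b * exp (K * S) * (h * R)\<^sup>2)"
        using b pow by (intro mult_left_mono mult_right_mono) auto
      also have "\<dots> = (2 * b * exp (K * S) * (S * R)\<^sup>2) / real (Suc n)"
        by (simp add: h_def power2_eq_square divide_simps del: of_nat_Suc)
      finally show ?thesis .
    qed
    then show "\<forall>\<^sub>F n in sequentially. norm (?E n - ?X) \<le> (2 * b * exp (K * S) * (S * R)\<^sup>2) / real (Suc n)"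
      by (auto simp: eventually_sequentially)
    show "(\<lambda>n. (2 * b * exp (K * S) * (S * R)\<^sup>2) / real (Suc n)) \<longlonglongrightarrow> 0"
      using tendsto_mult_right_zero[OF LIMSEQ_inverse_real_of_nat, of "2 * b * exp (K * S) * (S * R)\<^sup>2"]
      by (simp add: divide_inverse)
  qed
  ultimately show ?thesis by (rule LIMSEQ_unique[symmetric])
qed

end

section \<open>Test functions determining a measure\<close>

text \<open>The scalar part of the Taylor expansion of 1/(1 + |P|^2): n and n' are the norms of P
  before and after a move, d the linear change of n^2 and e its remainder. The inequality 2n \<le> 1
  + n^2 absorbs the growth of d, so the bounds depend on \<kappa> alone.\<close>

lemma inverse_one_plus_square_taylor:
  fixes n n' d e \<kappa> :: real
  assumes n: "0 \<le> n" "0 \<le> n'" and \<kappa>: "0 \<le> \<kappa>" and d: "\<bar>d\<bar> \<le> 2 * n * \<kappa>" and de: "n'\<^sup>2 - n\<^sup>2 = d + e"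
    and e: "\<bar>e\<bar> \<le> \<kappa>\<^sup>2" and lip: "\<bar>n' - n\<bar> \<le> \<kappa>"
  shows "\<bar>d / (1 + n\<^sup>2)\<^sup>2\<bar> \<le> \<kappa>"
    and "\<bar>1 / (1 + n'\<^sup>2) - 1 / (1 + n\<^sup>2) + d / (1 + n\<^sup>2)\<^sup>2\<bar> \<le> 2 * \<kappa>\<^sup>2"
proof -
  define a a' where "a = 1 + n\<^sup>2" and "a' = 1 + n'\<^sup>2"
  have a: "1 \<le> a" "1 \<le> a'" by (auto simp: a_def a'_def)
  have two: "2 * n \<le> a" "2 * n' \<le> a'"
    using sum_squares_bound[of n 1] sum_squares_bound[of n' 1] by (auto simp: a_def a'_def)
  have "\<bar>d\<bar> \<le> a * \<kappa>" using d mult_right_mono[OF two(1) \<kappa>] by linarith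
  then have da: "\<bar>d / a\<bar> \<le> \<kappa>" using a by (simp add: abs_divide pos_divide_le_eq mult.commute)
  have "\<bar>d / a\<^sup>2\<bar> = \<bar>d / a\<bar> / a" using a by (simp add: power2_eq_square abs_divide)
  also have "\<dots> \<le> \<bar>d / a\<bar> / 1" using a by (intro divide_left_mono) auto
  finally show "\<bar>d / (1 + n\<^sup>2)\<^sup>2\<bar> \<le> \<kappa>" using da by (simp add: a_def)
  have aa: "1 \<le> a * a'" using a mult_mono[of 1 a 1 a'] by simp
  have ea: "\<bar>e / (a * a')\<bar> \<le> \<kappa>\<^sup>2"
  proof -
    have "\<bar>e / (a * a')\<bar> = \<bar>e\<bar> / (a * a')" using aa by (simp add: abs_divide)
    also have "\<dots> \<le> \<bar>e\<bar> / 1" using aa by (intro divide_left_mono) auto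
    finally show ?thesis using e by simp
  qed
  have \<Delta>: "\<bar>(d + e) / (a * a')\<bar> \<le> \<kappa>"
  proof -
    have "n + n' \<le> a * a'"
    proof -
      have "1 * a' \<le> a * a'" using a by (intro mult_right_mono) auto
      moreover have "a * 1 \<le> a * a'" using a by (intro mult_left_mono) auto
      ultimately show ?thesis using two by linarith
    qed
    then have "\<kappa> * (n + n') \<le> \<kappa> * (a * a')" using \<kappa> by (rule mult_left_mono)
    moreover have "d + e = (n' - n) * (n + n')" using de by (simp add: power2_eq_square algebra_simps)
    then have "\<bar>d + e\<bar> \<le> \<kappa> * (n + n')"
      using lip n by (simp add: abs_mult mult_right_mono)
    ultimately show ?thesis using aa by (simp add: abs_divide pos_divide_le_eq)
  qed
  \<comment> \<open>Both factors of the product are of first order in \<kappa>, so the product is of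
    second order like e; each part contributes \<kappa>^2.\<close>
  have "1 / a' - 1 / a + d / a\<^sup>2 = (d / a) * ((d + e) / (a * a')) - e / (a * a')"
  proof -
    have a': "a' = a + (d + e)" using de by (simp add: a_def a'_def)
    have "1 / a' - 1 / a + d / a\<^sup>2 = (a\<^sup>2 - a * a' + d * a') / (a\<^sup>2 * a')"
      using a by (simp add: field_simps power2_eq_square)
    also have "a\<^sup>2 - a * a' + d * a' = d * (d + e) - e * a"
      by (simp add: a' power2_eq_square algebra_simps)
    also have "\<dots> / (a\<^sup>2 * a') = (d / a) * ((d + e) / (a * a')) - e / (a * a')"
      using a by (simp add: field_simps power2_eq_square)
    finally show ?thesis .
  qed
  also have "\<bar>\<dots>\<bar> \<le> \<kappa> * \<kappa> + \<kappa>\<^sup>2"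
    using mult_mono[OF da \<Delta>] \<kappa> ea
    by (intro order_trans[OF abs_triangle_ineq4] add_mono) (auto simp: abs_mult)
  finally show "\<bar>1 / (1 + n'\<^sup>2) - 1 / (1 + n\<^sup>2) + d / (1 + n\<^sup>2)\<^sup>2\<bar> \<le> 2 * \<kappa>\<^sup>2"
    by (simp add: a_def a'_def power2_eq_square)
qed

text \<open>The positive parts of the coordinates of m (w - b). For m > 0 it vanishes exactly on the
  orthant below b, so 1/(1 + norm^2) is 1 there and tends to 0 elsewhere as the sharpness m
  grows.\<close>

definition orthant_excess :: "real \<Rightarrow> 'a::euclidean_space \<Rightarrow> 'a \<Rightarrow> 'a" where
  "orthant_excess m b w = (\<Sum>i\<in>Basis. (m * max 0 (w \<bullet> i - b \<bullet> i)) *\<^sub>R i)"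

lemma inner_orthant_excess: "i \<in> Basis \<Longrightarrow> orthant_excess m b w \<bullet> i = m * max 0 (w \<bullet> i - b \<bullet> i)"
  by (simp add: orthant_excess_def inner_sum_left_Basis)

text \<open>Squaring makes the positive part differentiable with a quadratic remainder, coordinate
  by coordinate. The constant is the sum of the derivative bound m and the remainder bound 2
  m^2.\<close>

lemma C11_orthant:
  fixes b :: "'a::euclidean_space"
  assumes m: "0 \<le> m"
  shows "C11 (m + 2 * m\<^sup>2) (\<lambda>w. 1 / (1 + (norm (orthant_excess m b w))\<^sup>2))"
  unfolding C11_def
proof (intro conjI exI allI)
  let ?P = "orthant_excess m b"
  let ?D = "\<lambda>w k. - (2 * m * (?P w \<bullet> k)) / (1 + (norm (?P w))\<^sup>2)\<^sup>2"
  show "0 \<le> m + 2 * m\<^sup>2" using m by simp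
  show "linear (?D w)" for w
    by (rule linearI) (auto simp: inner_add_right algebra_simps add_divide_distrib diff_divide_distrib)
  have taylor: "\<bar>?D w k\<bar> \<le> m * norm k \<and>
      \<bar>1 / (1 + (norm (?P (w + k)))\<^sup>2) - 1 / (1 + (norm (?P w))\<^sup>2) - ?D w k\<bar> \<le> 2 * (m * norm k)\<^sup>2" for w k
  proof -
    define d where "d = 2 * m * (?P w \<bullet> k)"
    define e where "e = (norm (?P (w + k)))\<^sup>2 - (norm (?P w))\<^sup>2 - d"
    \<comment> \<open>The square of the positive part has derivative 2 max(0,t), which is Lipschitz
      with constant 2; this is the remainder of that expansion.\<close>
    have scalar: "\<bar>(max 0 (t + s))\<^sup>2 - (max 0 t)\<^sup>2 - 2 * max 0 t * s\<bar> \<le> s\<^sup>2" for t s :: real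
    proof (cases "0 \<le> t")
      case True
      show ?thesis
      proof (cases "0 \<le> t + s")
        case False
        have "t * (t + 2 * s) \<le> 0" using True False by (intro mult_nonneg_nonpos) auto
        moreover have "0 \<le> (t + s)\<^sup>2" by simp
        ultimately have "\<bar>t * (t + 2 * s)\<bar> \<le> s\<^sup>2"
          by (simp add: power2_eq_square algebra_simps abs_le_iff)
        moreover have "(max 0 (t + s))\<^sup>2 - (max 0 t)\<^sup>2 - 2 * max 0 t * s = - (t * (t + 2 * s))"
          using True False by (simp add: max_def power2_eq_square algebra_simps)
        ultimately show ?thesis by simp
      qed (use True in \<open>simp add: max_def power2_eq_square algebra_simps\<close>)
    next
      case False
      have "(max 0 (t + s))\<^sup>2 \<le> \<bar>s\<bar>\<^sup>2" using False by (intro power_mono) auto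
      then show ?thesis using False by (simp add: max_def)
    qed
    have lip: "norm (?P (w + k) - ?P w) \<le> norm (m *\<^sub>R k)"
    proof (rule norm_le_componentwise)
      fix i :: 'a assume "i \<in> Basis"
      then have "(?P (w + k) - ?P w) \<bullet> i = m * (max 0 (w \<bullet> i - b \<bullet> i + k \<bullet> i) - max 0 (w \<bullet> i - b \<bullet> i))"
        by (simp add: inner_diff_left inner_orthant_excess inner_add_left algebra_simps)
      also have "\<bar>\<dots>\<bar> \<le> \<bar>m * (k \<bullet> i)\<bar>"
        unfolding abs_mult by (intro mult_left_mono) auto
      finally show "\<bar>(?P (w + k) - ?P w) \<bullet> i\<bar> \<le> \<bar>m *\<^sub>R k \<bullet> i\<bar>" by simp
    qed
    have sq: "(norm (?P w))\<^sup>2 = m\<^sup>2 * (\<Sum>i\<in>Basis. (max 0 (w \<bullet> i - b \<bullet> i))\<^sup>2)" for w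
      unfolding power2_norm_eq_inner
      by (subst euclidean_inner) (simp add: inner_orthant_excess sum_distrib_left power2_eq_square mult_ac)
    have "d = m\<^sup>2 * (\<Sum>i\<in>Basis. 2 * max 0 (w \<bullet> i - b \<bullet> i) * (k \<bullet> i))"
      unfolding d_def by (subst euclidean_inner) (simp add: inner_orthant_excess sum_distrib_left power2_eq_square mult_ac)
    then have "e = m\<^sup>2 * (\<Sum>i\<in>Basis. (max 0 (w \<bullet> i - b \<bullet> i + k \<bullet> i))\<^sup>2 - (max 0 (w \<bullet> i - b \<bullet> i))\<^sup>2
        - 2 * max 0 (w \<bullet> i - b \<bullet> i) * (k \<bullet> i))"
      unfolding e_def sq sum_subtractf by (simp add: algebra_simps)
    also have "\<bar>\<dots>\<bar> \<le> m\<^sup>2 * (\<Sum>i\<in>Basis. (k \<bullet> i)\<^sup>2)"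
      unfolding abs_mult by (intro mult_mono order_trans[OF sum_abs] sum_mono scalar) (auto intro: sum_nonneg)
    also have "\<dots> = (m * norm k)\<^sup>2"
      unfolding power_mult_distrib power2_norm_eq_inner by (subst (2) euclidean_inner) (simp add: power2_eq_square)
    finally have e: "\<bar>e\<bar> \<le> (m * norm k)\<^sup>2" .
    have d: "\<bar>d\<bar> \<le> 2 * norm (?P w) * (m * norm k)"
      using Cauchy_Schwarz_ineq2[of "?P w" k] m mult_left_mono[of "\<bar>?P w \<bullet> k\<bar>" "norm (?P w) * norm k" m]
      by (simp add: d_def abs_mult mult_ac)
    have lip': "\<bar>norm (?P (w + k)) - norm (?P w)\<bar> \<le> m * norm k"
      using lip m order_trans[OF norm_triangle_ineq3 lip] by simp
    show ?thesis
      using inverse_one_plus_square_taylor[OF _ _ _ d _ e lip'] m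
      by (simp add: e_def d_def)
  qed
  fix w k :: 'a
  have "\<bar>?D w k\<bar> \<le> m * norm k" using taylor by blast
  also have "\<dots> \<le> (m + 2 * m\<^sup>2) * norm k" by (intro mult_right_mono) auto
  finally show "\<bar>?D w k\<bar> \<le> (m + 2 * m\<^sup>2) * norm k" .
  have "\<bar>1 / (1 + (norm (?P (w + k)))\<^sup>2) - 1 / (1 + (norm (?P w))\<^sup>2) - ?D w k\<bar> \<le> 2 * (m * norm k)\<^sup>2"
    using taylor by blast
  also have "\<dots> \<le> (m + 2 * m\<^sup>2) * (norm k)\<^sup>2"
    using m by (simp add: power_mult_distrib distrib_right)
  finally show "\<bar>1 / (1 + (norm (?P (w + k)))\<^sup>2) - 1 / (1 + (norm (?P w))\<^sup>2) - ?D w k\<bar> \<le> (m + 2 * m\<^sup>2) * (norm k)\<^sup>2" .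
qed

lemma measurable_orthant_excess [measurable]: "orthant_excess m b \<in> borel_measurable borel"
  unfolding orthant_excess_def by measurable

lemma orthant_test_tendsto:
  fixes b w :: "'a::ordered_euclidean_space"
  shows "(\<lambda>n. 1 / (1 + (norm (orthant_excess (real n) b w))\<^sup>2)) \<longlonglongrightarrow> indicator {..b} w"
proof (cases "w \<le> b")
  case True
  then have "orthant_excess m b w = 0" for m
    by (auto simp: orthant_excess_def eucl_le[where 'a='a] intro!: sum.neutral)
  then show ?thesis using True by simp
next
  case False
  then obtain i where i: "i \<in> Basis" "b \<bullet> i < w \<bullet> i" by (auto simp: eucl_le[where 'a='a] not_le)
  define \<delta> where "\<delta> = w \<bullet> i - b \<bullet> i"
  have \<delta>: "0 < \<delta>" using i by (simp add: \<delta>_def)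
  have "(\<lambda>n. 1 / (1 + (norm (orthant_excess (real n) b w))\<^sup>2)) \<longlonglongrightarrow> 0"
  proof (rule tendsto_sandwich[where f="\<lambda>_. 0" and h="\<lambda>n. 1 / (1 + real n * \<delta> * (real n * \<delta>))"])
    have "real n * \<delta> \<le> norm (orthant_excess (real n) b w)" for n
      using Basis_le_norm[OF i(1), of "orthant_excess (real n) b w"] \<delta> i
      by (simp add: inner_orthant_excess \<delta>_def max_def)
    then have "real n * \<delta> * (real n * \<delta>) \<le> (norm (orthant_excess (real n) b w))\<^sup>2" for n
      unfolding power2_eq_square using \<delta> by (intro mult_mono) auto
    then have "1 / (1 + (norm (orthant_excess (real n) b w))\<^sup>2) \<le> 1 / (1 + real n * \<delta> * (real n * \<delta>))" for n
      using \<delta> by (intro divide_left_mono) (auto intro!: mult_pos_pos add_pos_nonneg)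
    then show "\<forall>\<^sub>F n in sequentially. 1 / (1 + (norm (orthant_excess (real n) b w))\<^sup>2) \<le> 1 / (1 + real n * \<delta> * (real n * \<delta>))"
      by simp
    have "filterlim (\<lambda>n. 1 + real n * \<delta> * (real n * \<delta>)) at_top sequentially"
      using \<delta> by real_asymp
    then show "(\<lambda>n. 1 / (1 + real n * \<delta> * (real n * \<delta>))) \<longlonglongrightarrow> 0"
      by (rule tendsto_divide_0[OF tendsto_const filterlim_at_top_imp_at_infinity])
  qed auto
  then show ?thesis using False by simp
qed

lemma orthant_test_bound: "norm (1 / (1 + (norm v)\<^sup>2) :: real) \<le> 1"
proof -
  have "1 / (1 + (norm v)\<^sup>2) \<le> 1 / 1" by (intro divide_left_mono) (auto intro: add_pos_nonneg)
  moreover have "0 \<le> 1 / (1 + (norm v)\<^sup>2)" by simp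
  ultimately show ?thesis by simp
qed

section \<open>Measures determined by closed lower orthants\<close>

lemma measure_eqI_atMost:
  fixes M N :: "'a::ordered_euclidean_space measure"
  assumes M: "prob_space M" "sets M = sets borel" and N: "prob_space N" "sets N = sets borel"
    and eq: "\<And>b. measure M {..b} = measure N {..b}"
  shows "M = N"
proof (rule measure_eqI_generator_eq[where E="range atMost" and \<Omega>=UNIV and A="\<lambda>n. {..real n *\<^sub>R One}"])
  interpret M: prob_space M by fact
  interpret N: prob_space N by fact
  show "Int_stable (range (atMost :: 'a \<Rightarrow> _))"
  proof (rule Int_stableI)
    fix x y :: "'a set" assume "x \<in> range atMost" "y \<in> range atMost"
    then obtain a b where "x = {..a}" "y = {..b}" by auto
    then have "x \<inter> y = {..inf a b}" by auto
    then show "x \<inter> y \<in> range atMost" by blast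
  qed
  fix X :: "'a set" assume "X \<in> range atMost"
  then show "emeasure M X = emeasure N X"
    using eq by (auto simp: M.emeasure_eq_measure N.emeasure_eq_measure)
next
  have *: "sets (borel :: 'a measure) = sigma_sets UNIV (range atMost)"
    by (subst borel_eq_atMost) simp
  show "sets M = sigma_sets UNIV (range atMost)" "sets N = sigma_sets UNIV (range atMost)"
    using M(2) N(2) * by auto
  show "(\<Union>n. {..real n *\<^sub>R One}) = (UNIV :: 'a set)"
  proof (intro equalityI subset_UNIV subsetI)
    fix x :: 'a
    obtain n where n: "norm x \<le> real n" using real_arch_simple by blast
    have "x \<le> real n *\<^sub>R One"
      unfolding eucl_le[where 'a='a]
    proof
      fix i :: 'a assume i: "i \<in> Basis"
      then show "x \<bullet> i \<le> real n *\<^sub>R One \<bullet> i"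
        using Basis_le_norm[OF i, of x] n by simp
    qed
    then show "x \<in> (\<Union>n. {..real n *\<^sub>R One})" by blast
  qed
  show "emeasure M {..real n *\<^sub>R One} \<noteq> \<infinity>" for n
    using prob_space.emeasure_le_1[OF M(1)] by (metis ennreal_one_less_top infinity_ennreal_def leD)
qed auto

text \<open>The smoothed orthant indicators converge at every point, boundary included, so dominated
  convergence carries the equality of integrals over to the distribution functions.\<close>

lemma measure_eqI_C11:
  fixes M N :: "'a::ordered_euclidean_space measure"
  assumes M: "prob_space M" "sets M = sets borel" and N: "prob_space N" "sets N = sets borel"
    and eq: "\<And>c G. C11 c G \<Longrightarrow> (\<And>x. \<bar>G x\<bar> \<le> 1) \<Longrightarrow> (\<integral>x. G x \<partial>M) = (\<integral>x. G x \<partial>N)"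
  shows "M = N"
proof (rule measure_eqI_atMost[OF M N])
  have lim: "(\<lambda>n. \<integral>w. 1 / (1 + (norm (orthant_excess (real n) b w))\<^sup>2) \<partial>Q) \<longlonglongrightarrow> measure Q {..b}"
    if "prob_space Q" and [measurable_cong]: "sets Q = sets borel" for Q and b :: 'a
  proof -
    interpret Q: prob_space Q by fact
    have "(\<lambda>n. \<integral>w. 1 / (1 + (norm (orthant_excess (real n) b w))\<^sup>2) \<partial>Q) \<longlonglongrightarrow> (\<integral>w. indicator {..b} w \<partial>Q)"
      by (rule integral_dominated_convergence[where w="\<lambda>_. 1"])
        (auto simp: orthant_test_tendsto orthant_test_bound simp del: norm_divide real_norm_def intro: AE_I2)
    then show ?thesis using sets_eq_imp_space_eq[OF that(2)] by simp
  qed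
  fix b :: 'a
  have "(\<integral>w. 1 / (1 + (norm (orthant_excess (real n) b w))\<^sup>2) \<partial>M) = (\<integral>w. 1 / (1 + (norm (orthant_excess (real n) b w))\<^sup>2) \<partial>N)" for n
  proof (rule eq)
    show "C11 (real n + 2 * (real n)\<^sup>2) (\<lambda>w. 1 / (1 + (norm (orthant_excess (real n) b w))\<^sup>2))"
      by (rule C11_orthant) simp
    show "\<bar>1 / (1 + (norm (orthant_excess (real n) b w))\<^sup>2)\<bar> \<le> 1" for w
      using orthant_test_bound[of "orthant_excess (real n) b w"] by simp
  qed
  then show "measure M {..b} = measure N {..b}"
    using lim[OF M, of b] lim[OF N, of b] LIMSEQ_unique by auto
qed

section \<open>Standard normal vectors\<close>

text \<open>Minkowski's inequality with a constant as second function, by the normalisation used in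
  \<open>qnorm_triangle\<close>. In (i) it separates the norm of \<open>Y0\<close> from the constant
  K. If A = 0 then f vanishes almost surely and no division is possible.\<close>

lemma (in prob_space) minkowski_const:
  assumes [measurable]: "f \<in> borel_measurable M" and f: "\<And>x. 0 \<le> f x" and K: "0 \<le> K" and p: "1 \<le> p"
    and int: "integrable M (\<lambda>x. f x powr p)"
  defines "A \<equiv> (\<integral>x. f x powr p \<partial>M) powr (1 / p)"
  shows "(\<integral>\<^sup>+x. ennreal ((f x + K) powr p) \<partial>M) \<le> ennreal ((A + K) powr p)"
proof (cases "A = 0")
  case True
  then have "(\<integral>x. f x powr p \<partial>M) = 0" using p by (simp add: A_def)
  then have "AE x in M. f x powr p = 0"
    using integral_nonneg_eq_0_iff_AE[OF int] by simp
  then have "AE x in M. ennreal ((f x + K) powr p) = ennreal (K powr p)"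
    by eventually_elim simp
  then have "(\<integral>\<^sup>+x. ennreal ((f x + K) powr p) \<partial>M) = (\<integral>\<^sup>+x. ennreal (K powr p) \<partial>M)"
    by (rule nn_integral_cong_AE)
  then show ?thesis using True by (simp add: emeasure_space_1)
next
  case False
  then have A: "0 < A" by (simp add: A_def less_le)
  have Ap: "A powr p = (\<integral>x. f x powr p \<partial>M)" using p by (simp add: A_def powr_powr)
  define s t where "s = A / (A + K)" and "t = K / (A + K)"
  have st: "0 \<le> s" "0 \<le> t" "s + t = 1" using A K by (auto simp: s_def t_def simp flip: add_divide_distrib)
  have le: "(f x + K) powr p \<le> (A + K) powr p * (s * (f x powr p / A powr p) + t)" for x
  proof -
    have "f x + K = (A + K) * (s * (f x / A) + t * 1)"
      using A K by (simp add: s_def t_def distrib_left)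
    then have "(f x + K) powr p = (A + K) powr p * (s * (f x / A) + t * 1) powr p"
      using A K f[of x] st by (simp add: powr_mult)
    also have "\<dots> \<le> (A + K) powr p * (s * (f x / A) powr p + t * 1 powr p)"
      using A f[of x] by (intro mult_left_mono powr_convex_combination[OF p st]) auto
    finally show ?thesis using A f[of x] by (simp add: powr_divide)
  qed
  have int': "integrable M (\<lambda>x. (A + K) powr p * (s * (f x powr p / A powr p) + t))" using int by simp
  have "(\<integral>\<^sup>+x. ennreal ((f x + K) powr p) \<partial>M)
      \<le> (\<integral>\<^sup>+x. ennreal ((A + K) powr p * (s * (f x powr p / A powr p) + t)) \<partial>M)"
    by (intro nn_integral_mono ennreal_leI le)
  also have "\<dots> = ennreal (\<integral>x. (A + K) powr p * (s * (f x powr p / A powr p) + t) \<partial>M)"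
    using int' st by (intro nn_integral_eq_integral) auto
  also have "(\<integral>x. (A + K) powr p * (s * (f x powr p / A powr p) + t) \<partial>M)
      = (A + K) powr p * (s * ((\<integral>x. f x powr p \<partial>M) / A powr p) + t)"
    using int by (simp add: prob_space)
  also have "\<dots> = (A + K) powr p" using A st by (simp flip: Ap)
  finally show ?thesis .
qed

lemma (in prob_space) prob_abs_std_normal_less:
  assumes X: "distributed M lborel X std_normal_density" and m: "0 < m"
  shows "prob {\<omega> \<in> space M. \<bar>X \<omega>\<bar> < m} = 1 - erfc (m / sqrt 2)"
proof -
  have [measurable]: "X \<in> borel_measurable M" using distributed_measurable[OF X] by simp
  have law: "prob {\<omega> \<in> space M. X \<omega> \<in> A} = (\<integral>x. std_normal_density x * indicator A x \<partial>lborel)"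
    if [measurable]: "A \<in> sets borel" for A
  proof -
    have "(\<integral>x. std_normal_density x * indicator A x \<partial>lborel) = (\<integral>\<omega>. indicator A (X \<omega>) \<partial>M)"
      using distributed_integral[OF X, of "indicator A"] by simp
    also have "\<dots> = (\<integral>\<omega>. indicator {\<omega> \<in> space M. X \<omega> \<in> A} \<omega> \<partial>M)"
      by (intro Bochner_Integration.integral_cong) (auto simp: indicator_def)
    finally show ?thesis by simp
  qed
  \<comment> \<open>The substitution by sqrt 2 turns exp(-x^2/2) into exp(-x^2) and moves the lower
    limit to m / sqrt 2.\<close>
  have half: "(\<integral>x. std_normal_density x * indicator {m..} x \<partial>lborel) = erfc (m / sqrt 2) / 2"
  proof -
    have "(\<integral>x. std_normal_density x * indicator {m..} x \<partial>lborel)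
        = sqrt 2 * (\<integral>x. std_normal_density (sqrt 2 * x) * indicator {m..} (sqrt 2 * x) \<partial>lborel)"
      by (subst lborel_integral_real_affine[where c="sqrt 2" and t=0]) auto
    also have "(\<integral>x. std_normal_density (sqrt 2 * x) * indicator {m..} (sqrt 2 * x) \<partial>lborel)
        = (\<integral>x. (1 / sqrt (2 * pi)) * (indicator {m / sqrt 2..} x *\<^sub>R exp (- x\<^sup>2)) \<partial>lborel)"
    proof (rule Bochner_Integration.integral_cong[OF refl])
      fix x :: real
      have "sqrt 2 * x \<ge> m \<longleftrightarrow> x \<ge> m / sqrt 2" by (simp add: field_simps)
      then show "std_normal_density (sqrt 2 * x) * indicator {m..} (sqrt 2 * x) =
          1 / sqrt (2 * pi) * (indicator {m / sqrt 2..} x *\<^sub>R exp (- x\<^sup>2))"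
        by (simp add: std_normal_density_def indicator_def power_mult_distrib)
    qed
    also have "sqrt 2 * \<dots> = erfc (m / sqrt 2) / 2"
      by (simp add: erfc_def set_lebesgue_integral_def real_sqrt_mult)
    finally show ?thesis .
  qed
  have half': "(\<integral>x. std_normal_density x * indicator {..-m} x \<partial>lborel) = erfc (m / sqrt 2) / 2"
  proof -
    have "(\<integral>x. std_normal_density x * indicator {..-m} x \<partial>lborel)
        = (\<integral>x. std_normal_density (- x) * indicator {..-m} (- x) \<partial>lborel)"
      by (subst lborel_integral_real_affine[where c="-1" and t=0]) auto
    also have "\<dots> = (\<integral>x. std_normal_density x * indicator {m..} x \<partial>lborel)"
      by (intro Bochner_Integration.integral_cong refl) (auto simp: std_normal_density_def indicator_def)
    finally show ?thesis using half by simp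
  qed
  have "{\<omega> \<in> space M. \<bar>X \<omega>\<bar> < m} = space M - ({\<omega> \<in> space M. X \<omega> \<in> {m..}} \<union> {\<omega> \<in> space M. X \<omega> \<in> {..-m}})"
    using m by auto
  also have "prob \<dots> = 1 - prob ({\<omega> \<in> space M. X \<omega> \<in> {m..}} \<union> {\<omega> \<in> space M. X \<omega> \<in> {..-m}})"
    by (rule prob_compl) measurable
  also have "prob ({\<omega> \<in> space M. X \<omega> \<in> {m..}} \<union> {\<omega> \<in> space M. X \<omega> \<in> {..-m}})
      = prob {\<omega> \<in> space M. X \<omega> \<in> {m..}} + prob {\<omega> \<in> space M. X \<omega> \<in> {..-m}}"
    using m by (intro finite_measure_Union) auto
  also have "prob {\<omega> \<in> space M. X \<omega> \<in> {m..}} = erfc (m / sqrt 2) / 2"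
    by (subst law) (simp_all only: half, simp)
  also have "prob {\<omega> \<in> space M. X \<omega> \<in> {..-m}} = erfc (m / sqrt 2) / 2"
    by (subst law) (simp_all only: half', simp)
  finally show ?thesis by simp
qed

text \<open>The normalising constant (2 pi)^(-d/2), written as a natural power so that it splits
  into one factor per coordinate.\<close>

definition gauss_const :: "nat \<Rightarrow> real" where
  "gauss_const d = (1 / sqrt (2 * pi)) ^ d"

lemma gauss_const_pos: "0 < gauss_const d"
  by (simp add: gauss_const_def)

lemma prod_Basis_vec: "(\<Prod>b\<in>Basis. f b) = (\<Prod>i\<in>UNIV. f (axis i (1::real)))"
  for f :: "real ^ 'd \<Rightarrow> 'b::comm_monoid_mult"
proof -
  have "(Basis :: (real ^ 'd) set) = range (\<lambda>i. axis i 1)" by (auto simp: Basis_vec_def)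
  moreover have "inj (\<lambda>i::'d. axis i (1::real))" by (auto simp: inj_on_def axis_eq_axis)
  ultimately show ?thesis using prod.reindex[of "\<lambda>i::'d. axis i (1::real)" UNIV f] by (simp add: o_def)
qed

text \<open>Both laws give an orthant the product of its one-dimensional probabilities: the left by
  independence, the right because the density factors over the coordinates. Full lines in every
  coordinate give total mass 1.\<close>

lemma (in prob_space) distr_std_normal_vec:
  fixes Y :: "'a \<Rightarrow> real ^ 'd"
  assumes [measurable]: "Y \<in> borel_measurable M"
    and gauss: "\<And>i. distributed M lborel (\<lambda>\<omega>. Y \<omega> $ i) std_normal_density"
    and indep: "indep_vars (\<lambda>i. borel) (\<lambda>i \<omega>. Y \<omega> $ i) UNIV"
  shows "distr M borel Y = density lborel (\<lambda>u. ennreal (gauss_const CARD('d) * exp (- (norm u)\<^sup>2 / 2)))"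
proof -
  let ?N = "density lborel (\<lambda>u::real^'d. ennreal (gauss_const CARD('d) * exp (- (norm u)\<^sup>2 / 2)))"
  have dens: "gauss_const CARD('d) * exp (- (norm u)\<^sup>2 / 2) = (\<Prod>b\<in>Basis. std_normal_density (u \<bullet> b))" for u :: "real^'d"
  proof -
    have "(norm u)\<^sup>2 = (\<Sum>i\<in>UNIV. (u $ i)\<^sup>2)"
      unfolding power2_norm_eq_inner by (simp add: inner_vec_def power2_eq_square)
    then have "exp (- (norm u)\<^sup>2 / 2) = (\<Prod>i\<in>UNIV. exp (- (u $ i)\<^sup>2 / 2))"
      by (simp flip: exp_sum add: sum_divide_distrib sum_negf)
    then show ?thesis
      by (simp add: prod_Basis_vec std_normal_density_def prod.distrib gauss_const_def inner_axis prod_dividef power_divide)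
  qed
  have dens': "ennreal (gauss_const CARD('d) * exp (- (norm u)\<^sup>2 / 2)) = (\<Prod>b\<in>Basis. ennreal (std_normal_density (u \<bullet> b)))" for u :: "real^'d"
    unfolding dens by (rule prod_ennreal[symmetric]) simp
  have law: "emeasure M {\<omega> \<in> space M. Y \<omega> $ i \<in> A} = (\<integral>\<^sup>+x. ennreal (std_normal_density x) * indicator A x \<partial>lborel)"
    if [measurable]: "A \<in> sets borel" for A i
    using distributed_emeasure[OF gauss[of i], of A] by (simp add: vimage_def Int_def conj_commute)
  have N: "emeasure ?N (\<Inter>b\<in>Basis. {x. x \<bullet> b \<in> A b}) = (\<Prod>b\<in>Basis. \<integral>\<^sup>+x. ennreal (std_normal_density x) * indicator (A b) x \<partial>lborel)"
    if [measurable]: "\<And>b. A b \<in> sets borel" for A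
  proof -
    have [measurable]: "(\<Inter>b\<in>Basis. {x::real^'d. x \<bullet> b \<in> A b}) \<in> sets borel"
      by (intro sets.finite_INT) auto
    have ind: "indicator (\<Inter>b\<in>Basis. {x. x \<bullet> b \<in> A b}) u = (\<Prod>b\<in>Basis. indicator (A b) (u \<bullet> b) :: ennreal)" for u :: "real^'d"
    proof (cases "\<forall>b\<in>Basis. u \<bullet> b \<in> A b")
      case False
      then obtain b where "b \<in> Basis" "u \<bullet> b \<notin> A b" by blast
      then have "(\<Prod>b\<in>Basis. indicator (A b) (u \<bullet> b) :: ennreal) = 0" by (intro prod_zero) (auto intro!: bexI[of _ b])
      then show ?thesis using False by auto
    qed auto
    have "emeasure ?N (\<Inter>b\<in>Basis. {x. x \<bullet> b \<in> A b})
        = (\<integral>\<^sup>+u. (\<Prod>b\<in>Basis. ennreal (std_normal_density (u \<bullet> b)) * indicator (A b) (u \<bullet> b)) \<partial>lborel)"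
      unfolding prod.distrib dens'[symmetric] ind[symmetric] by (rule emeasure_density) auto
    also have "\<dots> = (\<Prod>b\<in>Basis. \<integral>\<^sup>+x. ennreal (std_normal_density x) * indicator (A b) x \<partial>lborel)"
      by (rule nn_integral_lborel_prod) auto
    finally show ?thesis .
  qed
  have N_prob: "prob_space ?N"
  proof
    have "(\<integral>\<^sup>+x. ennreal (std_normal_density x) \<partial>lborel) = 1"
      using prob_space.emeasure_space_1[OF prob_space_normal_density[of 1 0]] by (simp add: emeasure_density)
    then show "emeasure ?N (space ?N) = 1"
      using N[of "\<lambda>_. UNIV"] by simp
  qed
  have "measure (distr M borel Y) {..b} = measure ?N {..b}" for b
  proof -
    have "emeasure (distr M borel Y) {..b} = emeasure M (\<Inter>i\<in>UNIV. (\<lambda>\<omega>. Y \<omega> $ i) -` {..b $ i} \<inter> space M)"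
      by (subst emeasure_distr) (auto simp: less_eq_vec_def intro!: arg_cong[where f="emeasure M"])
    also have "\<dots> = (\<Prod>i\<in>UNIV. emeasure M ((\<lambda>\<omega>. Y \<omega> $ i) -` {..b $ i} \<inter> space M))"
      using indep_varsD_finite[OF indep, of "\<lambda>i. {..b $ i}"]
      by (simp add: emeasure_eq_measure prod_ennreal)
    also have "\<dots> = (\<Prod>i\<in>UNIV. \<integral>\<^sup>+x. ennreal (std_normal_density x) * indicator {..b $ i} x \<partial>lborel)"
    proof (intro prod.cong refl)
      fix i
      have "(\<lambda>\<omega>. Y \<omega> $ i) -` {..b $ i} \<inter> space M = {\<omega> \<in> space M. Y \<omega> $ i \<in> {..b $ i}}" by auto
      then show "emeasure M ((\<lambda>\<omega>. Y \<omega> $ i) -` {..b $ i} \<inter> space M)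
          = (\<integral>\<^sup>+x. ennreal (std_normal_density x) * indicator {..b $ i} x \<partial>lborel)"
        using law[of "{..b $ i}" i] by simp
    qed
    also have "\<dots> = emeasure ?N (\<Inter>e\<in>Basis. {x. x \<bullet> e \<in> {..b \<bullet> e}})"
      by (subst N) (auto simp: prod_Basis_vec inner_axis)
    also have "(\<Inter>e\<in>Basis. {x. x \<bullet> e \<in> {..b \<bullet> e}}) = {..b}" by (auto simp: eucl_le[where 'a="real^'d"])
    finally show ?thesis by (simp add: measure_def)
  qed
  then show ?thesis
    by (intro measure_eqI_atMost N_prob prob_space_distr) auto
qed

section \<open>Flow of the field and its time change\<close>

context bounded_prior
begin

text \<open>The Lipschitz constant of \<open>F r\<close> grows like \<open>r\<close>; in the time \<open>r + r\<^sup>2 / 2\<close> it becomes bounded.\<close>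

lemma flow_exists:
  "\<exists>W. W 0 = w \<and> (\<forall>t\<ge>0. (W has_vector_derivative F t (W t)) (at t within {0..}))"
proof -
  \<comment> \<open>For v = r + r^2/2 one has 2v + 1 = (1 + r)^2, so \<tau> v is 1 + r, the
    derivative of v in r. The \<open>max 0 v\<close> makes the field total in time.\<close>
  define \<tau> where "\<tau> v = sqrt (2 * max 0 v + 1)" for v :: real
  have \<tau>: "1 \<le> \<tau> v" for v by (simp add: \<tau>_def)
  \<comment> \<open>Division by dv/dr: the Lipschitz constant 16 R^2 r of \<open>F r\<close> becomes
    16 R^2 r/(1 + r), which stays below 16 R^2.\<close>
  define H where "H v x = F (\<tau> v - 1) x /\<^sub>R \<tau> v" for v x
  have "continuous_on UNIV (\<lambda>p. (case (\<tau> (fst p) - 1, snd p) of (r, w) \<Rightarrow> F r w) /\<^sub>R \<tau> (fst p))"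
    using \<tau> unfolding \<tau>_def
    by (intro continuous_intros continuous_on_compose2[OF F_continuous]) (auto simp: add_nonneg_eq_0_iff)
  then have cont: "continuous_on UNIV (\<lambda>(v, x). H v x)"
    by (simp add: H_def case_prod_beta)
  have lip: "norm (H v x - H v y) \<le> 16 * R\<^sup>2 * norm (x - y)" for v x y
  proof -
    have "norm (H v x - H v y) = norm (F (\<tau> v - 1) x - F (\<tau> v - 1) y) / \<tau> v"
      using \<tau>[of v] by (simp add: H_def divide_inverse mult.commute flip: scaleR_diff_right)
    also have "\<dots> \<le> (16 * R\<^sup>2 * (\<tau> v - 1) * norm (x - y)) / \<tau> v"
      using F_lipschitz[of "\<tau> v - 1" y "x - y"] \<tau>[of v] by (intro divide_right_mono) auto
    also have "\<dots> = (16 * R\<^sup>2 * norm (x - y)) * ((\<tau> v - 1) / \<tau> v)" by simp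
    also have "\<dots> \<le> (16 * R\<^sup>2 * norm (x - y)) * 1"
      using \<tau>[of v] by (intro mult_left_mono) auto
    finally show ?thesis by simp
  qed
  have bd: "norm (H v x) \<le> R" for v x
  proof -
    have "norm (H v x) = norm (F (\<tau> v - 1) x) / \<tau> v"
      using \<tau>[of v] by (simp add: H_def divide_inverse mult.commute)
    also have "\<dots> \<le> norm (F (\<tau> v - 1) x) / 1" using \<tau>[of v] by (intro divide_left_mono) auto
    also have "\<dots> \<le> R" using F_bound by simp
    finally show ?thesis .
  qed
  obtain u where u: "u 0 = w" "\<And>t. 0 \<le> t \<Longrightarrow> (u has_vector_derivative H t (u t)) (at t within {0..})"
    using picard_lindelof_global[OF cont lip bd, of w] by auto
  define \<theta> where "\<theta> t = t + t\<^sup>2 / 2" for t :: real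
  show ?thesis
  proof (intro exI[of _ "u \<circ> \<theta>"] conjI allI impI)
    show "(u \<circ> \<theta>) 0 = w" by (simp add: \<theta>_def u(1))
    fix t :: real assume t: "0 \<le> t"
    have im: "\<theta> ` {0..} \<subseteq> {0..}" by (auto simp: \<theta>_def)
    have "2 * max 0 (\<theta> t) + 1 = (1 + t)\<^sup>2" using t by (simp add: \<theta>_def power2_eq_square algebra_simps)
    then have \<tau>\<theta>: "\<tau> (\<theta> t) = 1 + t" using t by (simp add: \<tau>_def)
    have d\<theta>: "(\<theta> has_vector_derivative (1 + t)) (at t within {0..})"
      unfolding \<theta>_def has_real_derivative_iff_has_vector_derivative[symmetric]
      by (auto intro!: derivative_eq_intros)
    have "(u has_vector_derivative H (\<theta> t) (u (\<theta> t))) (at (\<theta> t) within \<theta> ` {0..})"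
      using im t by (intro has_vector_derivative_within_subset[OF u(2)]) (auto simp: \<theta>_def)
    from vector_diff_chain_within[OF d\<theta> this]
    show "((u \<circ> \<theta>) has_vector_derivative F t ((u \<circ> \<theta>) t)) (at t within {0..})"
      using t by (simp add: H_def \<tau>\<theta>)
  qed
qed

lemma F_diff_in_closed_convex:
  assumes S: "convex S" "closed S" and mem: "AE y in \<mu>. y - z \<in> S"
  shows "F r w - z \<in> S"
proof -
  have bd: "AE y in \<mu>. norm (y - z) \<le> R + norm z"
    using prior_bound by eventually_elim (rule order_trans[OF norm_triangle_ineq4], simp)
  have "(\<integral>y. wt r w y *\<^sub>R (y - z) \<partial>\<mu>) /\<^sub>R (\<integral>y. wt r w y \<partial>\<mu>) \<in> S"
    by (rule weighted_mean_in_closed_convex[OF S integrable_wt _ _ _ mem])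
      (use Z_pos integrable_wt_scaleR[OF _ bd] in \<open>auto simp: wt_pos less_imp_le Z_def\<close>)
  then show ?thesis
    using Z_pos[of r w] unfolding Z_scaleR_F_diff Z_def[symmetric] by simp
qed

lemma flow_in_closed_convex:
  assumes W: "\<And>t. 0 \<le> t \<Longrightarrow> (W has_vector_derivative F t (W t)) (at t within {0..})"
    and S: "convex S" "closed S" and mem: "AE y in \<mu>. y - z \<in> S" and "0 < r"
  shows "(W r - r *\<^sub>R z - W 0) /\<^sub>R r \<in> S"
proof -
  have "((\<lambda>t. W t - t *\<^sub>R z) has_vector_derivative F t (W t) - z) (at t within {0..r})" if "t \<in> {0..r}" for t
    using has_vector_derivative_within_subset[OF W, of t "{0..r}"] that
    by (auto intro!: derivative_eq_intros)
  from mvt_closed_convex[OF S \<open>0 < r\<close> this F_diff_in_closed_convex[OF S mem]]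
  show ?thesis by simp
qed

end

section \<open>The schedule and the return to the original time\<close>

lemma Tint_iff: "t \<in> Tint T \<longleftrightarrow> 0 \<le> t \<and> ereal t < T"
  by (simp add: Tint_def)

lemma Icc_subset_Tint: "t \<in> Tint T \<Longrightarrow> {0..t} \<subseteq> Tint T"
  by (auto simp: Tint_iff) (metis ereal_less_eq(3) order.strict_trans1)

locale schedule =
  fixes T :: ereal and \<sigma> \<sigma>' :: "real \<Rightarrow> real"
  assumes H: "assumption_H T \<sigma> \<sigma>'"
begin

lemma zero_in_Tint: "0 \<in> Tint T"
  using H by (simp add: assumption_H_def Tint_iff zero_ereal_def)

lemma \<sigma>_0: "\<sigma> 0 = 1"
  using H by (simp add: assumption_H_def)

lemma \<sigma>_pos: "t \<in> Tint T \<Longrightarrow> 0 < \<sigma> t"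
  using H by (simp add: assumption_H_def)

lemma \<sigma>_antimono: "s \<in> Tint T \<Longrightarrow> t \<in> Tint T \<Longrightarrow> s \<le> t \<Longrightarrow> \<sigma> t \<le> \<sigma> s"
  using H unfolding assumption_H_def by (metis less_eq_real_def)

lemma \<sigma>_le_1: "t \<in> Tint T \<Longrightarrow> \<sigma> t \<le> 1"
  using \<sigma>_antimono[OF zero_in_Tint, of t] by (simp add: \<sigma>_0 Tint_iff)

lemma \<sigma>_deriv: "t \<in> Tint T \<Longrightarrow> (\<sigma> has_real_derivative \<sigma>' t) (at t within Tint T)"
  using H by (simp add: assumption_H_def)

lemma \<sigma>'_bounded: "t \<in> Tint T \<Longrightarrow> \<exists>B. \<forall>s\<in>{0..t}. \<bar>\<sigma>' s\<bar> \<le> B"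
  using H unfolding assumption_H_def Tint_iff by blast

end

locale diffusion = schedule T \<sigma> \<sigma>' + bounded_prior \<mu> R
  for T \<sigma> \<sigma>' and \<mu> :: "(real ^ 'd) measure" and R
begin

text \<open>The exponent is homogeneous: with r = 1/\<sigma> - 1 = \<beta>/\<sigma>, the vector x -
  \<beta> y equals \<sigma> times x/\<sigma> - r y.\<close>

lemma Dmu_eq_F:
  assumes t: "t \<in> Tint T"
  shows "Dmu \<sigma> \<mu> t x = F (1 / \<sigma> t - 1) (x /\<^sub>R \<sigma> t)"
proof -
  have "wt (1 / \<sigma> t - 1) (x /\<^sub>R \<sigma> t) y = exp (- Gamma_t \<sigma> t x y)" for y
  proof -
    have "x /\<^sub>R \<sigma> t - (1 / \<sigma> t - 1) *\<^sub>R y = (x - beta \<sigma> t *\<^sub>R y) /\<^sub>R \<sigma> t"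
      using \<sigma>_pos[OF t] by (simp add: beta_def scaleR_diff_right scaleR_diff_left divide_inverse algebra_simps)
    then have "(norm (x /\<^sub>R \<sigma> t - (1 / \<sigma> t - 1) *\<^sub>R y))\<^sup>2 = (norm (x - beta \<sigma> t *\<^sub>R y))\<^sup>2 / (\<sigma> t)\<^sup>2"
      by (simp add: power_mult_distrib divide_inverse power_inverse mult.commute)
    then show ?thesis by (simp add: wt_def Gamma_t_def mult.commute)
  qed
  then show ?thesis by (simp add: Dmu_def F_def Z_def)
qed

text \<open>As r has derivative -\<sigma>'/\<sigma>^2, the product rule gives \<sigma>' W -
  (\<sigma>'/\<sigma>) F, which is (\<sigma>'/\<sigma>)(\<sigma> W - F). Only pointwise derivatives
  of \<sigma> occur.\<close>

lemma flow_solves: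
  assumes W: "\<And>r. 0 \<le> r \<Longrightarrow> (W has_vector_derivative F r (W r)) (at r within {0..})"
    and t: "t \<in> Tint T"
  shows "((\<lambda>s. \<sigma> s *\<^sub>R W (1 / \<sigma> s - 1)) has_vector_derivative
           bmu \<sigma> \<sigma>' \<mu> t (\<sigma> t *\<^sub>R W (1 / \<sigma> t - 1))) (at t within Tint T)"
proof -
  define r where "r s = 1 / \<sigma> s - 1" for s
  have r_nonneg: "0 \<le> r s" if "s \<in> Tint T" for s
    using \<sigma>_pos[OF that] \<sigma>_le_1[OF that] by (simp add: r_def)
  have dr: "(r has_vector_derivative (- \<sigma>' t / (\<sigma> t)\<^sup>2)) (at t within Tint T)"
    unfolding r_def has_real_derivative_iff_has_vector_derivative[symmetric]
    using \<sigma>_pos[OF t] by (auto intro!: derivative_eq_intros \<sigma>_deriv[OF t] simp: power2_eq_square)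
  have "(W has_vector_derivative F (r t) (W (r t))) (at (r t) within r ` Tint T)"
    by (rule has_vector_derivative_within_subset[OF W]) (use r_nonneg t in auto)
  from vector_diff_chain_within[OF dr this]
  have dW: "((\<lambda>s. W (r s)) has_vector_derivative (- \<sigma>' t / (\<sigma> t)\<^sup>2) *\<^sub>R F (r t) (W (r t))) (at t within Tint T)"
    by (simp add: o_def)
  have "((\<lambda>s. \<sigma> s *\<^sub>R W (r s)) has_vector_derivative
      \<sigma> t *\<^sub>R ((- \<sigma>' t / (\<sigma> t)\<^sup>2) *\<^sub>R F (r t) (W (r t))) + \<sigma>' t *\<^sub>R W (r t)) (at t within Tint T)"
    by (rule has_vector_derivative_scaleR[OF \<sigma>_deriv[OF t] dW])
  also have "\<sigma> t *\<^sub>R ((- \<sigma>' t / (\<sigma> t)\<^sup>2) *\<^sub>R F (r t) (W (r t))) + \<sigma>' t *\<^sub>R W (r t)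
      = bmu \<sigma> \<sigma>' \<mu> t (\<sigma> t *\<^sub>R W (r t))"
    using \<sigma>_pos[OF t]
    by (simp add: bmu_def Dmu_eq_F[OF t] r_def scaleR_diff_right power2_eq_square)
  finally show ?thesis by (simp add: r_def)
qed

text \<open>On [0,t] the field is Lipschitz in space with one constant, since \<sigma>' is bounded
  there and \<sigma> stays above \<sigma>(t) > 0; then Gronwall applies to the difference.\<close>

lemma solution_unique:
  assumes Y: "\<And>s. s \<in> Tint T \<Longrightarrow> (Y has_vector_derivative bmu \<sigma> \<sigma>' \<mu> s (Y s)) (at s within Tint T)"
    and Y': "\<And>s. s \<in> Tint T \<Longrightarrow> (Y' has_vector_derivative bmu \<sigma> \<sigma>' \<mu> s (Y' s)) (at s within Tint T)"
    and "Y 0 = Y' 0" and t: "t \<in> Tint T"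
  shows "Y t = Y' t"
proof -
  obtain B where B: "\<And>s. s \<in> {0..t} \<Longrightarrow> \<bar>\<sigma>' s\<bar> \<le> B" using \<sigma>'_bounded[OF t] by blast
  define \<kappa> where "\<kappa> = 1 / \<sigma> t"
  have \<kappa>: "1 \<le> \<kappa>" using \<sigma>_pos[OF t] \<sigma>_le_1[OF t] by (simp add: \<kappa>_def)
  have "t \<ge> 0" using t by (simp add: Tint_iff)
  then have B0: "0 \<le> B" using B[of 0] by auto
  have "(\<lambda>s. Y s - Y' s) t = 0"
  \<comment> \<open>The factor B \<kappa> bounds |\<sigma>'/\<sigma>|. The Lipschitz constant of
    \<open>Dmu\<close> has one \<kappa> from r = 1/\<sigma> - 1 and one from the rescaling
    x/\<sigma>; the summand 1 belongs to x itself.\<close>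
  proof (rule gronwall_zero[where g="\<lambda>s. bmu \<sigma> \<sigma>' \<mu> s (Y s) - bmu \<sigma> \<sigma>' \<mu> s (Y' s)" and C="(B * \<kappa>) * (1 + 16 * R\<^sup>2 * \<kappa> * \<kappa>)"])
    fix s assume s: "s \<in> {0..t}"
    then have sT: "s \<in> Tint T" using Icc_subset_Tint[OF t] by blast
    show "((\<lambda>s. Y s - Y' s) has_vector_derivative bmu \<sigma> \<sigma>' \<mu> s (Y s) - bmu \<sigma> \<sigma>' \<mu> s (Y' s)) (at s within {0..t})"
      by (intro has_vector_derivative_diff has_vector_derivative_within_subset[OF Y[OF sT]]
          has_vector_derivative_within_subset[OF Y'[OF sT]] Icc_subset_Tint t)
    have \<sigma>s: "0 < \<sigma> s" "1 / \<sigma> s \<le> \<kappa>" "\<sigma> s \<le> 1"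
      using \<sigma>_pos[OF sT] \<sigma>_pos[OF t] \<sigma>_antimono[OF sT t] \<sigma>_le_1[OF sT] s
      by (auto simp: \<kappa>_def intro: divide_left_mono)
    let ?e = "Y s - Y' s" and ?r = "1 / \<sigma> s - 1"
    have "norm (Dmu \<sigma> \<mu> s (Y s) - Dmu \<sigma> \<mu> s (Y' s)) \<le> 16 * R\<^sup>2 * \<bar>?r\<bar> * norm (?e /\<^sub>R \<sigma> s)"
      using F_lipschitz[of ?r "Y' s /\<^sub>R \<sigma> s" "?e /\<^sub>R \<sigma> s"]
      by (simp add: Dmu_eq_F[OF sT] flip: scaleR_add_right)
    also have "norm (?e /\<^sub>R \<sigma> s) = (1 / \<sigma> s) * norm ?e" using \<sigma>s by (simp add: divide_inverse)
    also have "16 * R\<^sup>2 * \<bar>?r\<bar> * ((1 / \<sigma> s) * norm ?e) \<le> 16 * R\<^sup>2 * \<kappa> * (\<kappa> * norm ?e)"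
      using \<sigma>s \<kappa> by (intro mult_mono mult_nonneg_nonneg) (auto simp: abs_le_iff)
    finally have D: "norm (Dmu \<sigma> \<mu> s (Y s) - Dmu \<sigma> \<mu> s (Y' s)) \<le> 16 * R\<^sup>2 * \<kappa> * \<kappa> * norm ?e" by (simp add: mult.assoc)
    have e: "norm (?e - (Dmu \<sigma> \<mu> s (Y s) - Dmu \<sigma> \<mu> s (Y' s))) \<le> norm ?e + 16 * R\<^sup>2 * \<kappa> * \<kappa> * norm ?e"
      using norm_triangle_ineq4[of ?e "Dmu \<sigma> \<mu> s (Y s) - Dmu \<sigma> \<mu> s (Y' s)"] D by linarith
    have "bmu \<sigma> \<sigma>' \<mu> s (Y s) - bmu \<sigma> \<sigma>' \<mu> s (Y' s) = (\<sigma>' s / \<sigma> s) *\<^sub>R (?e - (Dmu \<sigma> \<mu> s (Y s) - Dmu \<sigma> \<mu> s (Y' s)))"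
      by (simp add: bmu_def algebra_simps)
    also have "norm \<dots> = (\<bar>\<sigma>' s\<bar> * (1 / \<sigma> s)) * norm (?e - (Dmu \<sigma> \<mu> s (Y s) - Dmu \<sigma> \<mu> s (Y' s)))"
      using \<sigma>s by simp
    also have "\<dots> \<le> (B * \<kappa>) * (norm ?e + 16 * R\<^sup>2 * \<kappa> * \<kappa> * norm ?e)"
      using B[OF s] \<sigma>s B0 \<kappa> by (intro mult_mono e mult_nonneg_nonneg) auto
    finally show "norm (bmu \<sigma> \<sigma>' \<mu> s (Y s) - bmu \<sigma> \<sigma>' \<mu> s (Y' s)) \<le> (B * \<kappa>) * (1 + 16 * R\<^sup>2 * \<kappa> * \<kappa>) * norm ?e"
      by (simp add: algebra_simps)
  qed (use \<open>Y 0 = Y' 0\<close> \<open>0 \<le> t\<close> in auto)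
  then show ?thesis by simp
qed

text \<open>The average of W' - z over [0,r] has norm at most k; multiplying by \<sigma> and using
  \<sigma> r = \<beta> returns to the original variables. At r = 0 there is no average, and the
  claim is trivial.\<close>

lemma flow_qnorm_bound:
  assumes W: "\<And>r. 0 \<le> r \<Longrightarrow> (W has_vector_derivative F r (W r)) (at r within {0..})"
    and t: "t \<in> Tint T" and q: "1 \<le> q" and k: "AE y in \<mu>. qnorm q (y - z) \<le> k"
  shows "qnorm q (\<sigma> t *\<^sub>R W (1 / \<sigma> t - 1) - beta \<sigma> t *\<^sub>R z) \<le> \<sigma> t * qnorm q (W 0) + beta \<sigma> t * k"
proof -
  define r where "r = 1 / \<sigma> t - 1"
  have \<sigma>: "0 < \<sigma> t" "\<sigma> t \<le> 1" using \<sigma>_pos[OF t] \<sigma>_le_1[OF t] by auto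
  have r: "0 \<le> r" "\<sigma> t * r = beta \<sigma> t" using \<sigma> by (auto simp: r_def beta_def algebra_simps)
  have "qnorm q (W r - r *\<^sub>R z) \<le> qnorm q (W 0) + r * k"
  proof (cases "r = 0")
    case False
    then have "0 < r" using r by simp
    have "(W r - r *\<^sub>R z - W 0) /\<^sub>R r \<in> {x. qnorm q x \<le> k}"
      by (rule flow_in_closed_convex[OF W convex_qnorm_le[OF q] closed_qnorm_le[OF q] _ \<open>0 < r\<close>]) (use k in auto)
    then have "r * qnorm q ((W r - r *\<^sub>R z - W 0) /\<^sub>R r) \<le> r * k"
      using r(1) by (intro mult_left_mono) auto
    also have "r * qnorm q ((W r - r *\<^sub>R z - W 0) /\<^sub>R r) = qnorm q (r *\<^sub>R ((W r - r *\<^sub>R z - W 0) /\<^sub>R r))"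
      using r(1) by (simp only: qnorm_scaleR[OF q] abs_of_nonneg)
    also have "\<dots> = qnorm q (W r - r *\<^sub>R z - W 0)" using \<open>0 < r\<close> by simp
    finally have "qnorm q (W r - r *\<^sub>R z - W 0) \<le> r * k" .
    then show ?thesis
      using qnorm_triangle[OF q, of "W 0" "W r - r *\<^sub>R z - W 0"] by simp
  qed simp
  then have "\<bar>\<sigma> t\<bar> * qnorm q (W r - r *\<^sub>R z) \<le> \<sigma> t * (qnorm q (W 0) + r * k)"
    using \<sigma> by (simp add: mult_left_mono)
  also have "\<bar>\<sigma> t\<bar> * qnorm q (W r - r *\<^sub>R z) = qnorm q (\<sigma> t *\<^sub>R W r - beta \<sigma> t *\<^sub>R z)"
    by (simp add: qnorm_scaleR[OF q, symmetric] scaleR_diff_right r(2))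
  also have "\<sigma> t * (qnorm q (W 0) + r * k) = \<sigma> t * qnorm q (W 0) + beta \<sigma> t * k"
    by (simp add: distrib_left mult.assoc flip: r(2))
  finally show ?thesis by (simp add: r_def)
qed

end

section \<open>Laws\<close>

locale vec_channel = gaussian_channel \<mu> R "gauss_const CARD('d)"
  for \<mu> :: "(real ^ 'd) measure" and R
begin

lemma flow_law:
  assumes W: "\<And>w. W w 0 = w"
    "\<And>w t. 0 \<le> t \<Longrightarrow> (W w has_vector_derivative F t (W w t)) (at t within {0..})"
    and S: "0 \<le> S"
  shows "distr noise borel (\<lambda>u. W u S) = distr (\<mu> \<Otimes>\<^sub>M noise) borel (\<lambda>(y, u). u + S *\<^sub>R y)"
proof (rule measure_eqI_C11)
  note [measurable] = flow_measurable(1)[OF W S]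
  show "prob_space (distr noise borel (\<lambda>u. W u S))" by (rule noise.prob_space_distr) measurable
  show "prob_space (distr (\<mu> \<Otimes>\<^sub>M noise) borel (\<lambda>(y, u). u + S *\<^sub>R y))"
    by (rule pair.P.prob_space_distr) measurable
  fix b and G :: "real ^ 'd \<Rightarrow> real" assume G: "C11 b G" and bd: "\<And>x. \<bar>G x\<bar> \<le> 1"
  have [measurable]: "G \<in> borel_measurable borel"
    by (intro borel_measurable_continuous_onI C11_continuous[OF G])
  have int: "integrable (\<mu> \<Otimes>\<^sub>M noise) (\<lambda>(y, u). G (W u S))"
    by (rule pair.P.integrable_const_bound[where B=1]) (auto simp: bd)
  have "(\<integral>x. G x \<partial>distr noise borel (\<lambda>u. W u S)) = (\<integral>u. G (W u S) \<partial>noise)"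
    by (rule integral_distr) measurable
  also have "\<dots> = (\<integral>y. \<integral>u. G (W u S) \<partial>noise \<partial>\<mu>)" by (simp add: prob_space)
  also have "\<dots> = (\<integral>(y, u). G (W u S) \<partial>(\<mu> \<Otimes>\<^sub>M noise))"
    using pair.integral_fst'[OF int] by simp
  also have "\<dots> = (\<integral>(y, u). G (u + S *\<^sub>R y) \<partial>(\<mu> \<Otimes>\<^sub>M noise))"
    by (rule flow_law_C11[OF W S G bd, symmetric])
  also have "\<dots> = (\<integral>x. G x \<partial>distr (\<mu> \<Otimes>\<^sub>M noise) borel (\<lambda>(y, u). u + S *\<^sub>R y))"
    by (subst integral_distr) (auto simp: case_prod_unfold)
  finally show "(\<integral>x. G x \<partial>distr noise borel (\<lambda>u. W u S))
      = (\<integral>x. G x \<partial>distr (\<mu> \<Otimes>\<^sub>M noise) borel (\<lambda>(y, u). u + S *\<^sub>R y))" .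
qed simp_all

lemma rho_scaleR:
  assumes s: "0 < s"
  shows "s ^ CARD('d) * rho s (s *\<^sub>R u :: real ^ 'd) = gauss_const CARD('d) * exp (- (norm u)\<^sup>2 / 2)"
proof -
  have "(2 * pi * s\<^sup>2) powr (- real CARD('d) / 2) = ((2 * pi * s\<^sup>2) powr (1/2)) powr (- real CARD('d))"
    by (simp add: powr_powr)
  also have "(2 * pi * s\<^sup>2) powr (1/2) = sqrt (2 * pi) * s"
    using s by (simp add: powr_half_sqrt real_sqrt_mult)
  also have "\<dots> powr (- real CARD('d)) = (1 / (sqrt (2 * pi) * s)) ^ CARD('d)"
    using s by (simp add: powr_minus powr_realpow power_mult_distrib divide_inverse power_inverse)
  finally have "s ^ CARD('d) * (2 * pi * s\<^sup>2) powr (- real CARD('d) / 2) = gauss_const CARD('d)"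
    using s by (simp add: gauss_const_def power_divide power_mult_distrib)
  moreover have "- (norm (s *\<^sub>R u))\<^sup>2 / (2 * s\<^sup>2) = - (norm u)\<^sup>2 / 2"
    using s by (simp add: power_mult_distrib)
  ultimately show ?thesis unfolding rho_def mult.assoc[symmetric] by simp
qed

lemma rho_measurable [measurable]: "rho s \<in> borel_measurable borel"
  unfolding rho_def by measurable

text \<open>For fixed y the substitution x = s u + b y has Jacobian s^d and turns the noise density
  into \<open>rho s\<close>; Tonelli then exchanges the order of integration. Boundedness of
  \<open>rho s\<close> identifies the Bochner integral in the density with the nonnegative
  one.\<close>

lemma channel_density:
  assumes s: "0 < s"
  shows "distr (\<mu> \<Otimes>\<^sub>M noise) borel (\<lambda>(y, u). s *\<^sub>R u + b *\<^sub>R y)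
    = density lborel (\<lambda>x. ennreal (\<integral>y. rho s (x - b *\<^sub>R y) \<partial>\<mu>))" (is "?L = ?D")
proof (rule measure_eqI)
  interpret L: pair_sigma_finite \<mu> "lborel :: (real ^ 'd) measure" ..
  show "sets ?L = sets ?D" by simp
  fix A assume "A \<in> sets ?L"
  then have [measurable]: "A \<in> sets borel" by simp
  have int: "integrable \<mu> (\<lambda>y. rho s (x - b *\<^sub>R y))" for x
  proof (rule integrable_bounded[where B="(2 * pi * s\<^sup>2) powr (- real CARD('d) / 2) * 1"])
    show "AE y in \<mu>. norm (rho s (x - b *\<^sub>R y)) \<le> (2 * pi * s\<^sup>2) powr (- real CARD('d) / 2) * 1"
      by (intro AE_I2) (auto simp: rho_def abs_mult intro!: mult_left_le)
  qed measurable
  have rho_nonneg: "0 \<le> rho s x" for x :: "real ^ 'd" by (simp add: rho_def)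
  have scale: "ennreal (s ^ CARD('d)) * ennreal (rho s (s *\<^sub>R u)) = ennreal (gauss_const CARD('d) * exp (- (norm u)\<^sup>2 / 2))" for u :: "real ^ 'd"
    unfolding rho_scaleR[OF s, symmetric] by (rule ennreal_mult[symmetric]) (use s rho_nonneg in auto)
  have inner: "(\<integral>\<^sup>+u. indicator A (s *\<^sub>R u + b *\<^sub>R y) \<partial>noise) = (\<integral>\<^sup>+x. ennreal (rho s (x - b *\<^sub>R y)) * indicator A x \<partial>lborel)" for y
  proof -
    have "(\<integral>\<^sup>+x. ennreal (rho s (x - b *\<^sub>R y)) * indicator A x \<partial>lborel)
        = (\<integral>\<^sup>+x. ennreal (rho s (x - b *\<^sub>R y)) * indicator A x
            \<partial>density (distr lborel borel (\<lambda>x. b *\<^sub>R y + s *\<^sub>R x)) (\<lambda>_. ennreal (\<bar>s\<bar> ^ DIM(real ^ 'd))))"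
      using s by (subst lborel_affine[of s "b *\<^sub>R y"]) auto
    also have "\<dots> = (\<integral>\<^sup>+u. ennreal (s ^ CARD('d)) * (ennreal (rho s (s *\<^sub>R u)) * indicator A (b *\<^sub>R y + s *\<^sub>R u)) \<partial>lborel)"
      using s by (simp add: nn_integral_density nn_integral_distr)
    also have "\<dots> = (\<integral>\<^sup>+u. ennreal (gauss_const CARD('d) * exp (- (norm u)\<^sup>2 / 2)) * indicator A (s *\<^sub>R u + b *\<^sub>R y) \<partial>lborel)"
      by (simp only: mult.assoc[symmetric] scale add.commute)
    also have "\<dots> = (\<integral>\<^sup>+u. indicator A (s *\<^sub>R u + b *\<^sub>R y) \<partial>noise)"
      unfolding noise_def by (subst nn_integral_density) auto
    finally show ?thesis ..
  qed
  have "emeasure ?L A = (\<integral>\<^sup>+x. indicator A x \<partial>?L)" by simp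
  also have "\<dots> = (\<integral>\<^sup>+z. indicator A (case z of (y, u) \<Rightarrow> s *\<^sub>R u + b *\<^sub>R y) \<partial>(\<mu> \<Otimes>\<^sub>M noise))"
    by (rule nn_integral_distr) measurable
  also have "\<dots> = (\<integral>\<^sup>+y. \<integral>\<^sup>+u. indicator A (s *\<^sub>R u + b *\<^sub>R y) \<partial>noise \<partial>\<mu>)"
    by (subst noise.nn_integral_fst[symmetric]) simp_all
  also have "\<dots> = (\<integral>\<^sup>+y. \<integral>\<^sup>+x. ennreal (rho s (x - b *\<^sub>R y)) * indicator A x \<partial>lborel \<partial>\<mu>)"
    by (simp only: inner)
  also have "\<dots> = (\<integral>\<^sup>+x. \<integral>\<^sup>+y. ennreal (rho s (x - b *\<^sub>R y)) * indicator A x \<partial>\<mu> \<partial>lborel)"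
    by (rule L.Fubini'[symmetric]) measurable
  also have "\<dots> = (\<integral>\<^sup>+x. ennreal (\<integral>y. rho s (x - b *\<^sub>R y) \<partial>\<mu>) * indicator A x \<partial>lborel)"
    by (intro nn_integral_cong) (simp add: nn_integral_multc nn_integral_eq_integral[OF int] rho_nonneg)
  also have "\<dots> = emeasure ?D A" by (rule emeasure_density[symmetric]) measurable
  finally show "emeasure ?L A = emeasure ?D A" .
qed

end

text \<open>Reduces real moments to natural ones, for which Gaussian integrability is known; the 1
  covers |x| \<le> 1.\<close>

lemma abs_powr_le: "\<bar>x\<bar> powr p \<le> 1 + \<bar>x\<bar> ^ nat \<lceil>p\<rceil>" if "1 \<le> p" for x p :: real
proof (cases "\<bar>x\<bar> \<le> 1")
  case True
  then have "\<bar>x\<bar> powr p \<le> 1 powr p" using that by (intro powr_mono2) auto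
  then show ?thesis by (simp add: add_increasing2)
next
  case False
  have "\<bar>x\<bar> powr p \<le> \<bar>x\<bar> powr real (nat \<lceil>p\<rceil>)"
    using False that by (intro powr_mono) auto
  then show ?thesis using False by (simp add: powr_realpow)
qed

lemma (in prob_space) integrable_qnorm_powr:
  fixes Y :: "'a \<Rightarrow> real ^ 'd"
  assumes [measurable]: "Y \<in> borel_measurable M"
    and gauss: "\<And>i. distributed M lborel (\<lambda>\<omega>. Y \<omega> $ i) std_normal_density"
    and q: "1 \<le> q" and p: "1 \<le> p"
  shows "integrable M (\<lambda>\<omega>. qnorm q (Y \<omega>) powr p)"
proof (rule Bochner_Integration.integrable_bound)
  note [measurable] = borel_measurable_qnorm[OF q]
  let ?n = "nat \<lceil>p\<rceil>"
  let ?g = "\<lambda>\<omega>. real CARD('d) powr p * (\<Sum>i\<in>UNIV. 1 + \<bar>Y \<omega> $ i\<bar> ^ ?n)"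
  have "integrable M (\<lambda>\<omega>. \<bar>Y \<omega> $ i\<bar> ^ ?n)" for i
    using distributed_integrable[OF gauss[of i], of "\<lambda>x. \<bar>x\<bar> ^ ?n"] integrable_std_normal_moment_abs[of ?n] by simp
  then show "integrable M ?g" by simp
  show "(\<lambda>\<omega>. qnorm q (Y \<omega>) powr p) \<in> borel_measurable M" by measurable
  show "AE \<omega> in M. norm (qnorm q (Y \<omega>) powr p) \<le> norm (?g \<omega>)"
  proof (intro AE_I2)
    fix \<omega>
    \<comment> \<open>The maximum is attained at a coordinate j depending on \<omega>; the sum over
      all coordinates in \<open>?g\<close> dominates it for every \<omega>.\<close>
    have "Max (range (\<lambda>i. \<bar>Y \<omega> $ i\<bar>)) \<in> range (\<lambda>i. \<bar>Y \<omega> $ i\<bar>)" by (rule Max_in) auto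
    then obtain j where "Max (range (\<lambda>i. \<bar>Y \<omega> $ i\<bar>)) = \<bar>Y \<omega> $ j\<bar>" by (rule rangeE)
    then have j: "qnorm \<infinity> (Y \<omega>) = \<bar>Y \<omega> $ j\<bar>" by (simp add: qnorm_infinity)
    have "qnorm q (Y \<omega>) powr p \<le> (real CARD('d) * \<bar>Y \<omega> $ j\<bar>) powr p"
      using qnorm_le_card_infinity[OF q, of "Y \<omega>"] qnorm_nonneg[OF q, of "Y \<omega>"] p j by (intro powr_mono2) auto
    also have "\<dots> = real CARD('d) powr p * \<bar>Y \<omega> $ j\<bar> powr p" by (simp add: powr_mult)
    also have "\<dots> \<le> real CARD('d) powr p * (1 + \<bar>Y \<omega> $ j\<bar> ^ ?n)"
      by (intro mult_left_mono abs_powr_le[OF p]) simp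
    also have "\<dots> \<le> ?g \<omega>"
      by (intro mult_left_mono member_le_sum[of j UNIV "\<lambda>i. 1 + \<bar>Y \<omega> $ i\<bar> ^ ?n"]) (auto intro: add_nonneg_nonneg)
    finally show "norm (qnorm q (Y \<omega>) powr p) \<le> norm (?g \<omega>)" by simp
  qed
qed

section \<open>The theorem\<close>

theorem theorem2p8:
  fixes M :: "'a measure" and T :: ereal and \<sigma> \<sigma>' :: "real \<Rightarrow> real"
    and Y0 \<eta> :: "'a \<Rightarrow> real ^ 'd" and q :: ereal and K :: real
  assumes H: "assumption_H T \<sigma> \<sigma>'"
    and P: "prob_space M"
    and Y0_rv: "Y0 \<in> borel_measurable M"
    and Y0_gauss: "\<And>i. distributed M lborel (\<lambda>\<omega>. Y0 \<omega> $ i) std_normal_density"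
    and Y0_indep: "prob_space.indep_vars M (\<lambda>i. borel) (\<lambda>i \<omega>. Y0 \<omega> $ i) UNIV"
    and eta_rv: "\<eta> \<in> borel_measurable M"
    and indep: "prob_space.indep_var M borel \<eta> borel Y0"
    and q: "1 \<le> q"
    and K: "esssup M (\<lambda>\<omega>. ereal (qnorm q (\<eta> \<omega>))) \<le> ereal K"
  defines "\<mu>0 \<equiv> distr M borel \<eta>"
  shows "\<exists>Y :: real \<Rightarrow> 'a \<Rightarrow> real ^ 'd.
     (\<forall>\<omega>\<in>space M. Y 0 \<omega> = Y0 \<omega> \<and>
        (\<forall>t\<in>Tint T. ((\<lambda>s. Y s \<omega>) has_vector_derivative bmu \<sigma> \<sigma>' \<mu>0 t (Y t \<omega>)) (at t within Tint T)))
   \<and> (\<forall>Y' :: real \<Rightarrow> 'a \<Rightarrow> real ^ 'd.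
        (\<forall>\<omega>\<in>space M. Y' 0 \<omega> = Y0 \<omega> \<and>
          (\<forall>t\<in>Tint T. ((\<lambda>s. Y' s \<omega>) has_vector_derivative bmu \<sigma> \<sigma>' \<mu>0 t (Y' t \<omega>)) (at t within Tint T)))
        \<longrightarrow> (\<forall>\<omega>\<in>space M. \<forall>t\<in>Tint T. Y' t \<omega> = Y t \<omega>))
   \<and> (\<forall>t\<in>Tint T. Y t \<in> borel_measurable M \<and>
        distr M borel (Y t) = density lborel (\<lambda>x. ennreal (phi \<sigma> \<mu>0 t x)))
   \<and> (\<forall>p\<ge>1. \<forall>t\<in>Tint T.
        Wqp q p (distr M borel (Y t)) \<mu>0
          \<le> ereal ((K + (prob_space.expectation M (\<lambda>\<omega>. qnorm q (Y0 \<omega>) powr p)) powr (1 / p)) * \<sigma> t))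
   \<and> (\<forall>t\<in>Tint T. \<forall>z :: real ^ 'd. \<forall>\<omega>\<in>space M.
        ereal (qnorm q (Y t \<omega> - beta \<sigma> t *\<^sub>R z))
          \<le> ereal (\<sigma> t * qnorm q (Y0 \<omega>))
             + ereal (beta \<sigma> t) * esssup M (\<lambda>\<omega>'. ereal (qnorm q (\<eta> \<omega>' - z))))
   \<and> (\<forall>m>0. \<forall>t\<in>Tint T.
        measure M {\<omega>\<in>space M. ereal (beta \<sigma> t) * esssup M (\<lambda>\<omega>'. ereal (qnorm \<infinity> (\<eta> \<omega>')))
                                   + ereal (\<sigma> t * m) \<le> ereal (qnorm \<infinity> (Y t \<omega>))}
          \<le> 1 - (1 - erfc (m / sqrt 2)) ^ CARD('d))"
proof -
  interpret M: prob_space M by (rule P)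
  interpret sch: schedule T \<sigma> \<sigma>' by (rule schedule.intro) (rule H)
  \<comment> \<open>The Euclidean norm is at most d times any of the norms
    \<open>qnorm q\<close>.\<close>
  define R where "R = real CARD('d) * K"
  note [measurable] = Y0_rv eta_rv borel_measurable_qnorm
  have \<mu>0_AE: "(AE y in \<mu>0. P y) \<longleftrightarrow> (AE \<omega> in M. P (\<eta> \<omega>))" if "Measurable.pred borel P" for P
    using that unfolding \<mu>0_def by (subst AE_distr_iff) (auto simp: pred_def)
  have K_AE: "AE \<omega> in M. qnorm q (\<eta> \<omega>) \<le> K"
    using esssup_AE[of "\<lambda>\<omega>. ereal (qnorm q (\<eta> \<omega>))" M]
    by eventually_elim (use K order_trans in fastforce)
  have K_nonneg: "0 \<le> K"
  proof -
    have "AE \<omega> in M. 0 \<le> K"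
      using K_AE by eventually_elim (use qnorm_nonneg[OF q] order_trans in blast)
    then show ?thesis by simp
  qed
  have R_AE: "AE \<omega> in M. norm (\<eta> \<omega>) \<le> R"
    using K_AE
  proof eventually_elim
    fix \<omega> assume "qnorm q (\<eta> \<omega>) \<le> K"
    then have "real CARD('d) * qnorm q (\<eta> \<omega>) \<le> R" unfolding R_def by (intro mult_left_mono) auto
    then show "norm (\<eta> \<omega>) \<le> R" using norm_le_card_qnorm[OF q, of "\<eta> \<omega>"] by linarith
  qed
  have noise_law: "distr M borel Y0 = density lborel (\<lambda>u. ennreal (gauss_const CARD('d) * exp (- (norm u)\<^sup>2 / 2)))"
    by (rule M.distr_std_normal_vec[OF Y0_rv Y0_gauss Y0_indep])
  interpret bp: bounded_prior \<mu>0 R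
  proof (rule bounded_prior.intro)
    show "prob_space \<mu>0" unfolding \<mu>0_def by (rule M.prob_space_distr) measurable
    show "bounded_prior_axioms \<mu>0 R"
      by unfold_locales (simp_all add: \<mu>0_AE R_AE, simp add: \<mu>0_def)
  qed
  interpret ch: vec_channel \<mu>0 R
  proof (intro vec_channel.intro gaussian_channel.intro gaussian_channel_axioms.intro)
    show "bounded_prior \<mu>0 R" by (rule bp.bounded_prior_axioms)
    show "0 < gauss_const CARD('d)" by (rule gauss_const_pos)
    show "prob_space (density lborel (\<lambda>u::real^'d. ennreal (gauss_const CARD('d) * exp (- (norm u)\<^sup>2 / 2))))"
      unfolding noise_law[symmetric] by (rule M.prob_space_distr) measurable
  qed
  interpret df: diffusion T \<sigma> \<sigma>' \<mu>0 R ..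
  have noise: "ch.noise = distr M borel Y0" unfolding ch.noise_def noise_law ..
  obtain W where W: "\<And>w. W w 0 = w"
    "\<And>w r. 0 \<le> r \<Longrightarrow> (W w has_vector_derivative bp.F r (W w r)) (at r within {0..})"
    using bp.flow_exists by metis
  define Y where "Y t \<omega> = \<sigma> t *\<^sub>R W (Y0 \<omega>) (1 / \<sigma> t - 1)" for t \<omega>
  have init: "Y 0 \<omega> = Y0 \<omega>" for \<omega> by (simp add: Y_def sch.\<sigma>_0 W(1))
  have solves: "((\<lambda>s. Y s \<omega>) has_vector_derivative bmu \<sigma> \<sigma>' \<mu>0 t (Y t \<omega>)) (at t within Tint T)"
    if "t \<in> Tint T" for t \<omega>
    unfolding Y_def by (rule df.flow_solves[OF W(2) that])
  have r_nonneg: "0 \<le> 1 / \<sigma> t - 1" if "t \<in> Tint T" for t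
    using sch.\<sigma>_pos[OF that] sch.\<sigma>_le_1[OF that] by simp
  have W_meas: "(\<lambda>w. W w (1 / \<sigma> t - 1)) \<in> borel_measurable borel" if "t \<in> Tint T" for t
    by (rule ch.flow_measurable(1)[OF W r_nonneg[OF that]])
  have Y_meas: "Y t \<in> borel_measurable M" if "t \<in> Tint T" for t
  proof -
    note [measurable] = W_meas[OF that]
    show ?thesis unfolding Y_def by measurable
  qed
  \<comment> \<open>Independence of \<eta> and \<open>Y0\<close> enters as this product law; it
    gives the coupling in (i) its first marginal.\<close>
  have joint: "distr M (borel \<Otimes>\<^sub>M borel) (\<lambda>\<omega>. (\<eta> \<omega>, Y0 \<omega>)) = \<mu>0 \<Otimes>\<^sub>M ch.noise"
    using indep unfolding M.indep_var_distribution_eq noise \<mu>0_def by simp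
  have law_pair: "distr M borel (Y t) = distr (\<mu>0 \<Otimes>\<^sub>M ch.noise) borel (\<lambda>(y, u). \<sigma> t *\<^sub>R u + beta \<sigma> t *\<^sub>R y)"
    if t: "t \<in> Tint T" for t
  proof -
    note [measurable] = W_meas[OF t]
    let ?r = "1 / \<sigma> t - 1"
    have "distr M borel (Y t) = distr (distr ch.noise borel (\<lambda>u. W u ?r)) borel (\<lambda>x. \<sigma> t *\<^sub>R x)"
      unfolding noise by (simp add: distr_distr o_def Y_def[abs_def])
    also have "\<dots> = distr (distr (\<mu>0 \<Otimes>\<^sub>M ch.noise) borel (\<lambda>(y, u). u + ?r *\<^sub>R y)) borel (\<lambda>x. \<sigma> t *\<^sub>R x)"
      by (simp only: ch.flow_law[OF W r_nonneg[OF t]])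
    also have "\<dots> = distr (\<mu>0 \<Otimes>\<^sub>M ch.noise) borel (\<lambda>(y, u). \<sigma> t *\<^sub>R u + beta \<sigma> t *\<^sub>R y)"
      using sch.\<sigma>_pos[OF t]
      by (subst distr_distr) (auto intro!: distr_cong simp: o_def beta_def scaleR_add_right right_diff_distrib)
    finally show ?thesis .
  qed
  have law: "distr M borel (Y t) = density lborel (\<lambda>x. ennreal (phi \<sigma> \<mu>0 t x))" if t: "t \<in> Tint T" for t
    unfolding law_pair[OF t] ch.channel_density[OF sch.\<sigma>_pos[OF t]] phi_def ..
  \<comment> \<open>Finiteness is needed for every norm, also the maximum norm of (iii), while K
    bounds the q-norm only; the passage goes through the Euclidean bound R. It lets k be handled as
    a real number.\<close>
  have esssup_real: "\<exists>k. esssup M (\<lambda>\<omega>. ereal (qnorm q' (\<eta> \<omega> - z))) = ereal k \<and> (AE y in \<mu>0. qnorm q' (y - z) \<le> k)"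
    if q': "1 \<le> q'" for q' z
  proof -
    let ?e = "esssup M (\<lambda>\<omega>. ereal (qnorm q' (\<eta> \<omega> - z)))"
    note [measurable] = borel_measurable_qnorm[OF q']
    have "AE \<omega> in M. 0 \<le> ?e"
      using esssup_AE[of "\<lambda>\<omega>. ereal (qnorm q' (\<eta> \<omega> - z))" M]
      by eventually_elim (use qnorm_nonneg[OF q'] order_trans ereal_less_eq(5) in blast)
    then have "0 \<le> ?e" by simp
    moreover have "?e \<le> ereal (real CARD('d) * (R + norm z))"
    proof (rule esssup_I)
      show "AE \<omega> in M. ereal (qnorm q' (\<eta> \<omega> - z)) \<le> ereal (real CARD('d) * (R + norm z))"
        using R_AE
      proof eventually_elim
        fix \<omega> assume "norm (\<eta> \<omega>) \<le> R"
        then have "norm (\<eta> \<omega> - z) \<le> R + norm z" using norm_triangle_ineq4[of "\<eta> \<omega>" z] by linarith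
        moreover have "qnorm \<infinity> (\<eta> \<omega> - z) \<le> norm (\<eta> \<omega> - z)"
          by (auto simp: qnorm_infinity intro!: component_le_norm_cart simp del: vector_minus_component)
        ultimately have le: "real CARD('d) * qnorm \<infinity> (\<eta> \<omega> - z) \<le> real CARD('d) * (R + norm z)"
          by (intro mult_left_mono) auto
        show "ereal (qnorm q' (\<eta> \<omega> - z)) \<le> ereal (real CARD('d) * (R + norm z))"
          unfolding ereal_less_eq(3) by (rule order_trans[OF qnorm_le_card_infinity[OF q'] le])
      qed
    qed measurable
    ultimately obtain k where k: "?e = ereal k" by (cases ?e) auto
    have "AE \<omega> in M. qnorm q' (\<eta> \<omega> - z) \<le> k"
      using esssup_AE[of "\<lambda>\<omega>. ereal (qnorm q' (\<eta> \<omega> - z))" M] unfolding k by simp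
    then show ?thesis using k by (simp add: \<mu>0_AE)
  qed
  have pathwise: "ereal (qnorm q' (Y t \<omega> - beta \<sigma> t *\<^sub>R z))
      \<le> ereal (\<sigma> t * qnorm q' (Y0 \<omega>)) + ereal (beta \<sigma> t) * esssup M (\<lambda>\<omega>'. ereal (qnorm q' (\<eta> \<omega>' - z)))"
    if t: "t \<in> Tint T" and q': "1 \<le> q'" for t z \<omega> q'
  proof -
    obtain k where k: "esssup M (\<lambda>\<omega>. ereal (qnorm q' (\<eta> \<omega> - z))) = ereal k" "AE y in \<mu>0. qnorm q' (y - z) \<le> k"
      using esssup_real[OF q'] by blast
    show ?thesis
      using df.flow_qnorm_bound[OF W(2) t q' k(2), of "Y0 \<omega>"] unfolding k(1) Y_def W(1) by simp
  qed
  have wasserstein: "Wqp q p (distr M borel (Y t)) \<mu>0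
      \<le> ereal ((K + (M.expectation (\<lambda>\<omega>. qnorm q (Y0 \<omega>) powr p)) powr (1 / p)) * \<sigma> t)"
    if p: "1 \<le> p" and t: "t \<in> Tint T" for p t
  proof -
    note [measurable] = borel_measurable_qnorm[OF q]
    have \<sigma>: "0 < \<sigma> t" by (rule sch.\<sigma>_pos[OF t])
    define A where "A = (M.expectation (\<lambda>\<omega>. qnorm q (Y0 \<omega>) powr p)) powr (1 / p)"
    \<comment> \<open>The coupling uses X and not \<open>Y t\<close>: the two have the same law, and
      X - \<eta> = \<sigma> (Y0 - \<eta>) since \<beta> - 1 = -\<sigma>.\<close>
    define X where "X \<omega> = \<sigma> t *\<^sub>R Y0 \<omega> + beta \<sigma> t *\<^sub>R \<eta> \<omega>" for \<omega>
    have [measurable]: "X \<in> borel_measurable M" unfolding X_def by measurable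
    define \<pi> where "\<pi> = distr M (borel \<Otimes>\<^sub>M borel) (\<lambda>\<omega>. (X \<omega>, \<eta> \<omega>))"
    have "distr M borel X = distr (distr M (borel \<Otimes>\<^sub>M borel) (\<lambda>\<omega>. (\<eta> \<omega>, Y0 \<omega>))) borel (\<lambda>(y, u). \<sigma> t *\<^sub>R u + beta \<sigma> t *\<^sub>R y)"
      by (subst distr_distr) (auto simp: X_def[abs_def] o_def)
    also have "\<dots> = distr M borel (Y t)" unfolding joint law_pair[OF t] ..
    finally have law_X: "distr M borel X = distr M borel (Y t)" .
    have coupling: "\<pi> \<in> couplings (distr M borel (Y t)) \<mu>0"
      unfolding couplings_def
    proof (intro CollectI conjI)
      show "prob_space \<pi>" unfolding \<pi>_def by (rule M.prob_space_distr) measurable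
      show "distr \<pi> borel fst = distr M borel (Y t)"
        unfolding \<pi>_def law_X[symmetric] by (subst distr_distr) (auto simp: o_def)
      show "distr \<pi> borel snd = \<mu>0"
        unfolding \<pi>_def \<mu>0_def by (subst distr_distr) (auto simp: o_def)
    qed (simp add: \<pi>_def)
    define I where "I = (\<integral>\<^sup>+z. ennreal (qnorm q (fst z - snd z) powr p) \<partial>\<pi>)"
    have "I = (\<integral>\<^sup>+\<omega>. ennreal (qnorm q (X \<omega> - \<eta> \<omega>) powr p) \<partial>M)"
      unfolding I_def \<pi>_def by (subst nn_integral_distr) auto
    also have "\<dots> \<le> (\<integral>\<^sup>+\<omega>. ennreal (\<sigma> t powr p) * ennreal ((qnorm q (Y0 \<omega>) + K) powr p) \<partial>M)"
    proof (rule nn_integral_mono_AE)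
      show "AE \<omega> in M. ennreal (qnorm q (X \<omega> - \<eta> \<omega>) powr p) \<le> ennreal (\<sigma> t powr p) * ennreal ((qnorm q (Y0 \<omega>) + K) powr p)"
        using K_AE
      proof eventually_elim
        fix \<omega> assume \<omega>: "qnorm q (\<eta> \<omega>) \<le> K"
        have "X \<omega> - \<eta> \<omega> = \<sigma> t *\<^sub>R (Y0 \<omega> + (-1) *\<^sub>R \<eta> \<omega>)"
          by (simp add: X_def beta_def algebra_simps)
        then have "qnorm q (X \<omega> - \<eta> \<omega>) = \<sigma> t * qnorm q (Y0 \<omega> + (-1) *\<^sub>R \<eta> \<omega>)"
          using \<sigma> by (simp only: qnorm_scaleR[OF q] abs_of_pos)
        also have "\<dots> \<le> \<sigma> t * (qnorm q (Y0 \<omega>) + K)"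
          using \<sigma> \<omega> qnorm_triangle[OF q, of "Y0 \<omega>" "(-1) *\<^sub>R \<eta> \<omega>"] qnorm_scaleR[OF q, of "-1" "\<eta> \<omega>"]
          by (intro mult_left_mono) auto
        finally have "qnorm q (X \<omega> - \<eta> \<omega>) powr p \<le> (\<sigma> t * (qnorm q (Y0 \<omega>) + K)) powr p"
          using p qnorm_nonneg[OF q] by (intro powr_mono2) auto
        also have "\<dots> = \<sigma> t powr p * (qnorm q (Y0 \<omega>) + K) powr p"
          using \<sigma> qnorm_nonneg[OF q] K_nonneg by (simp add: powr_mult)
        finally show "ennreal (qnorm q (X \<omega> - \<eta> \<omega>) powr p) \<le> ennreal (\<sigma> t powr p) * ennreal ((qnorm q (Y0 \<omega>) + K) powr p)"
          by (simp add: ennreal_mult'[symmetric] ennreal_leI)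
      qed
    qed
    also have "\<dots> = ennreal (\<sigma> t powr p) * (\<integral>\<^sup>+\<omega>. ennreal ((qnorm q (Y0 \<omega>) + K) powr p) \<partial>M)"
      by (rule nn_integral_cmult) measurable
    also have "\<dots> \<le> ennreal (\<sigma> t powr p) * ennreal ((A + K) powr p)"
      unfolding A_def
      by (intro mult_left_mono M.minkowski_const K_nonneg p qnorm_nonneg q
          M.integrable_qnorm_powr Y0_rv Y0_gauss) (auto simp: q)
    also have "\<dots> = ennreal (\<sigma> t powr p * (A + K) powr p)" by (simp add: ennreal_mult')
    also have "\<sigma> t powr p * (A + K) powr p = (\<sigma> t * (A + K)) powr p"
      using \<sigma> K_nonneg by (simp add: powr_mult A_def)
    finally have I: "I \<le> ennreal ((\<sigma> t * (A + K)) powr p)" .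
    then have "I \<noteq> \<infinity>" by (auto simp: top_unique)
    have "enn2real I \<le> (\<sigma> t * (A + K)) powr p" using I by (simp add: enn2real_leI)
    then have "enn2real I powr (1 / p) \<le> ((\<sigma> t * (A + K)) powr p) powr (1 / p)"
      using p by (intro powr_mono2) auto
    also have "\<dots> = \<sigma> t * (A + K)" using \<sigma> K_nonneg p by (simp add: powr_powr A_def)
    finally have root: "enn2real I powr (1 / p) \<le> (K + A) * \<sigma> t" by (simp add: mult.commute add.commute)
    have "Wqp q p (distr M borel (Y t)) \<mu>0 \<le> (let I = I in if I = \<infinity> then \<infinity> else ereal (enn2real I powr (1 / p)))"
      unfolding Wqp_def I_def by (rule INF_lower[OF coupling])
    also have "\<dots> \<le> ereal ((K + A) * \<sigma> t)" using \<open>I \<noteq> \<infinity>\<close> root by simp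
    finally show ?thesis by (simp add: A_def)
  qed
  have tail: "measure M {\<omega>\<in>space M. ereal (beta \<sigma> t) * esssup M (\<lambda>\<omega>'. ereal (qnorm \<infinity> (\<eta> \<omega>')))
        + ereal (\<sigma> t * m) \<le> ereal (qnorm \<infinity> (Y t \<omega>))}
      \<le> 1 - (1 - erfc (m / sqrt 2)) ^ CARD('d)"
    if m: "0 < m" and t: "t \<in> Tint T" for m t
  proof -
    \<comment> \<open>All coordinates of \<open>Y0\<close> are below m in modulus. By the pathwise
      bound at z = 0, the event in question lies in the complement of \<open>?B\<close>.\<close>
    let ?B = "\<Inter>i\<in>UNIV. (\<lambda>\<omega>. Y0 \<omega> $ i) -` {-m<..<m} \<inter> space M"
    have sets_B: "?B \<in> sets M"
      using distributed_measurable[OF Y0_gauss]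
      by (intro sets.finite_INT measurable_sets[where A=borel]) auto
    have "M.prob ?B = (\<Prod>i\<in>(UNIV :: 'd set). M.prob ((\<lambda>\<omega>. Y0 \<omega> $ i) -` {-m<..<m} \<inter> space M))"
      using M.indep_varsD_finite[OF Y0_indep, of "\<lambda>_. {-m<..<m}"] by simp
    also have "\<dots> = (\<Prod>i\<in>(UNIV :: 'd set). 1 - erfc (m / sqrt 2))"
    proof (rule prod.cong[OF refl])
      fix i :: 'd
      have "(\<lambda>\<omega>. Y0 \<omega> $ i) -` {-m<..<m} \<inter> space M = {\<omega> \<in> space M. \<bar>Y0 \<omega> $ i\<bar> < m}" by auto
      then show "M.prob ((\<lambda>\<omega>. Y0 \<omega> $ i) -` {-m<..<m} \<inter> space M) = 1 - erfc (m / sqrt 2)"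
        using M.prob_abs_std_normal_less[OF Y0_gauss m] by simp
    qed
    finally have prob_B: "M.prob ?B = (1 - erfc (m / sqrt 2)) ^ CARD('d)" by simp
    \<comment> \<open>A finite value of the essential supremum can be cancelled on both sides,
      leaving m \<le> \<open>qnorm \<infinity> (Y0 \<omega>)\<close>.\<close>
    obtain k where k: "esssup M (\<lambda>\<omega>. ereal (qnorm \<infinity> (\<eta> \<omega> - 0))) = ereal k"
      using esssup_real[of \<infinity> 0] by auto
    have "{\<omega>\<in>space M. ereal (beta \<sigma> t) * esssup M (\<lambda>\<omega>'. ereal (qnorm \<infinity> (\<eta> \<omega>')))
        + ereal (\<sigma> t * m) \<le> ereal (qnorm \<infinity> (Y t \<omega>))} \<subseteq> space M - ?B"
    proof safe
      fix \<omega> assume \<omega>: "\<omega> \<in> ?B" and le: "ereal (beta \<sigma> t) * esssup M (\<lambda>\<omega>'. ereal (qnorm \<infinity> (\<eta> \<omega>')))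
        + ereal (\<sigma> t * m) \<le> ereal (qnorm \<infinity> (Y t \<omega>))"
      have "beta \<sigma> t * k + \<sigma> t * m \<le> qnorm \<infinity> (Y t \<omega>)" using le k by simp
      also have "\<dots> \<le> \<sigma> t * qnorm \<infinity> (Y0 \<omega>) + beta \<sigma> t * k"
        using pathwise[OF t, of \<infinity> \<omega> 0] k by simp
      finally have "m \<le> qnorm \<infinity> (Y0 \<omega>)" using sch.\<sigma>_pos[OF t] by simp
      moreover have "qnorm \<infinity> (Y0 \<omega>) < m" using \<omega> by (auto simp: qnorm_infinity abs_less_iff minus_less_iff[of _ m])
      ultimately show False by simp
    qed
    then have "measure M {\<omega>\<in>space M. ereal (beta \<sigma> t) * esssup M (\<lambda>\<omega>'. ereal (qnorm \<infinity> (\<eta> \<omega>')))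
        + ereal (\<sigma> t * m) \<le> ereal (qnorm \<infinity> (Y t \<omega>))} \<le> M.prob (space M - ?B)"
      by (rule M.finite_measure_mono) (use sets_B in auto)
    also have "\<dots> = 1 - (1 - erfc (m / sqrt 2)) ^ CARD('d)"
      using M.prob_compl[OF sets_B] prob_B by simp
    finally show ?thesis .
  qed
  show ?thesis
  proof (rule exI[of _ Y], intro conjI ballI allI impI)
    fix Y' :: "real \<Rightarrow> 'a \<Rightarrow> real ^ 'd" and \<omega> t
    assume Y': "\<forall>\<omega>\<in>space M. Y' 0 \<omega> = Y0 \<omega> \<and>
          (\<forall>t\<in>Tint T. ((\<lambda>s. Y' s \<omega>) has_vector_derivative bmu \<sigma> \<sigma>' \<mu>0 t (Y' t \<omega>)) (at t within Tint T))"
      and \<omega>: "\<omega> \<in> space M" and t: "t \<in> Tint T"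
    show "Y' t \<omega> = Y t \<omega>"
      by (rule df.solution_unique[of "\<lambda>t. Y' t \<omega>" "\<lambda>t. Y t \<omega>", OF _ solves _ t]) (use Y' \<omega> init in auto)
  qed ((rule init solves Y_meas law wasserstein tail pathwise q | assumption)+)
qed

end
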